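(* Let $\xi \in \mathcal{D}_1$ and let $N$, $M$ be arbitrary non-negative integers. Let $\mu$ and $\nu$ be complex numbers satisfying $|\Re\mu | <\min \left( N + \frac{1}{2},M + \frac{1}{2} \right)$ and $\Re\nu > \max \left( N - \frac{1}{2},M - \frac{1}{2} \right)$. Then there exist remainder terms $R_N^{(P1)} (\xi ,\mu ,\nu )$ and $R_M^{(P2)} (\xi ,\mu ,\nu )$ such that $$\begin{aligned} P_\nu ^\mu (\cosh \xi ) =\; & \frac{e^{ \left(\nu+\frac{1}{2} \right)\xi}}{\Gamma (\nu - \mu + 1)\sqrt{2\pi \sinh \xi}} \left( \sum_{n = 0}^{N - 1} a_n (\mu ) \Gamma \left( \nu - n + \tfrac{1}{2} \right) \left( \frac{-e^{ - \xi } }{\sinh \xi } \right)^n + R_N^{(P1)} (\xi ,\mu ,\nu ) \right)\\ & + \frac{C(\xi ,\mu ) e^{- \left(\nu+\frac{1}{2} \right)\xi}}{\Gamma (\nu - \mu + 1)\sqrt{2\pi \sinh \xi}} \left( \sum_{m = 0}^{M - 1} a_m (\mu ) \Gamma \left( \nu - m + \tfrac{1}{2} \right)\left( \frac{e^\xi }{\sinh \xi} \right)^m + R_M^{(P2)} (\xi ,\mu ,\nu ) \right),\end{aligned}$$ and the remainder terms satisfy the estimates $$\begin{aligned}\left| R_N^{(P1)} (\xi ,\mu ,\nu ) \right| \le \; & \left|\frac{ \cos (\pi \mu ) }{ \cos (\pi \Re\mu ) }\right|\left| a_N (\Re\mu ) \right| \Gamma \left( \Re\nu - N + \tfrac{1}{2}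 \right) \left| \frac{e^{ - \xi } }{\sinh \xi } \right|^N \\ & \times \begin{cases} 1 & \text{if } \Re (e^{2\xi } ) \le 1, \\ \min\left(\left| 1 - e^{ - 2\xi } \right|\left| \csc (2\Im\xi ) \right|,\,1 + \chi\left(N+\tfrac{1}{2}\right)\right) & \text{if } \Re (e^{2\xi } ) > 1, \end{cases}\end{aligned}$$ and $$\left| R_M^{(P2)} (\xi ,\mu ,\nu ) \right| \le \left|\frac{\cos (\pi \mu )}{\cos (\pi \Re\mu )}\right|\left|a_M (\Re\mu )\right|\Gamma \left( \Re\nu - M + \tfrac{1}{2} \right)\left| \frac{e^\xi}{\sinh \xi } \right|^M .$$ If $2\Re\mu $ is an odd integer, then the limiting values have to be taken in these bounds. The square roots are positive for positive real $\xi$ and are defined by continuity elsewhere. In addition, $R_M^{(P2)} (\xi ,\mu ,\nu )$ does not exceed the corresponding first neglected term $a_M(\mu)\Gamma(\nu-M+\frac12)\left(\frac{e^\xi}{\sinh\xi}\right)^M$ in absolute value and has the same sign, provided that $\xi$ is positive, $\mu$ and $\nu$ are real, $|\mu| <M + \frac{1}{2}$ and $\nu > M - \frac{1}{2}$.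
   Context: $\mathcal{D}_1=\{\xi\in\mathbb{C} : \Re \xi>0,\ |\Im \xi |<\pi\}$; $\cosh$ maps $\mathcal{D}_1$ biholomorphically onto $\mathbb{C}\setminus(-\infty,1]$. The associated Legendre function of the first kind is $P_\nu ^\mu (z) = \left(\frac{z + 1}{z - 1}\right)^{\mu /2}\mathbf{F}\left(\nu+1,-\nu;1-\mu;\frac{1-z}{2}\right)$ for $z\in\mathbb{C}\setminus(-\infty,1]$, where the power has its principal branch (positive base for $z>1$) and $\mathbf{F}(a,b;c;w)$ is the regularised hypergeometric function, $\mathbf{F}(a,b;c;w)=\sum_{n\ge 0}\frac{(a)_n(b)_n}{\Gamma(c+n)\,n!}w^n$ for $|w|<1$, continued analytically to $w\in\mathbb{C}\setminus[1,+\infty)$. $a_n (\mu ) = \frac{(4\mu ^2 - 1^2 )(4\mu ^2 - 3^2 ) \cdots (4\mu ^2 - (2n - 1)^2 )}{8^n n!}=\frac{(\frac12-\mu)_n(\frac12+\mu)_n}{(-2)^n n!}$, with $(\cdot)_n$ the Pochhammer symbol. $C(\xi ,\mu ) = \sin (\pi \mu )$ if $\xi > 0$, and $C(\xi,\mu)=\pm i\, e^{ \mp \pi i\mu }$ if $0<\pm \Im\xi < \pi$. $\chi(p)= \frac{\sqrt\pi\,\Gamma\left(\frac{p}{2}+1\right)}{\Gamma\left(\frac{p}{2}+\frac{1}{2}\right)}$ for $p>0$. "Limiting value" means that $|a_N(\Re\mu)|/|\cos(\pi\Re\mu)|$ is replaced by $\lim_{x\to\Re\mu}|a_N(x)|/|\cos(\pi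 x)|$. When $\sin(2\Im\xi)=0$, $|\csc(2\Im\xi)|$ is read as $+\infty$. *)

theory Defs
  imports "HOL-Complex_Analysis.Complex_Analysis"
begin

definition D1 :: "complex set" where
  "D1 = {\<xi>. Re \<xi> > 0 \<and> \<bar>Im \<xi>\<bar> < pi}"

definition slit_plane :: "complex set" where
  "slit_plane = - (complex_of_real ` {1..})"

text \<open>
  \<open>hyp2F1_reg\<close> is the analytic continuation of the regularised hypergeometric series
  from the unit disc to the plane cut along \<open>[1, \<infinity>)\<close>. By the lemma
  \<open>slit_plane_continuation_unique\<close> below, the choice operator only affects
  values on the cut.
\<close>

definition hyp2F1_reg_series :: "complex \<Rightarrow> complex \<Rightarrow> complex \<Rightarrow> complex \<Rightarrow> complex" where
  "hyp2F1_reg_series a b c w =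
     (\<Sum>n. pochhammer a n * pochhammer b n / fact n * rGamma (c + of_nat n) * w ^ n)"

definition hyp2F1_reg :: "complex \<Rightarrow> complex \<Rightarrow> complex \<Rightarrow> complex \<Rightarrow> complex" where
  "hyp2F1_reg a b c =
     (SOME F. F holomorphic_on slit_plane \<and> (\<forall>w. norm w < 1 \<longrightarrow> F w = hyp2F1_reg_series a b c w))"

text \<open>For \<open>z\<close> off the cut \<open>(-\<infinity>, 1]\<close> the base of the power is off \<open>(-\<infinity>, 0]\<close>.\<close>

definition legendre_P :: "complex \<Rightarrow> complex \<Rightarrow> complex \<Rightarrow> complex" where
  "legendre_P \<nu> \<mu> z =
     ((z + 1) / (z - 1)) powr (\<mu> / 2) * hyp2F1_reg (\<nu> + 1) (- \<nu>) (1 - \<mu>) ((1 - z) / 2)"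

definition a_coeff :: "nat \<Rightarrow> 'a :: field_char_0 \<Rightarrow> 'a" where
  "a_coeff n \<mu> = (\<Prod>k=1..n. 4 * \<mu>\<^sup>2 - (2 * of_nat k - 1)\<^sup>2) / (8 ^ n * fact n)"

text \<open>On \<open>D1\<close>, \<open>Im \<xi> = 0\<close> means that \<open>\<xi>\<close> is a positive real.\<close>

definition C_coeff :: "complex \<Rightarrow> complex \<Rightarrow> complex" where
  "C_coeff \<xi> \<mu> =
     (if Im \<xi> = 0 then sin (of_real pi * \<mu>)
      else if Im \<xi> > 0 then \<i> * exp (- (of_real pi * \<i> * \<mu>))
      else - \<i> * exp (of_real pi * \<i> * \<mu>))"

definition chi :: "real \<Rightarrow> real" where
  "chi p = sqrt pi * Gamma (p / 2 + 1) / Gamma (p / 2 + 1 / 2)"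

text \<open>\<open>|a\<^sub>N(x)| / |cos(\<pi> x)|\<close>, with its limiting value where the cosine vanishes.\<close>

definition a_cos_ratio :: "nat \<Rightarrow> real \<Rightarrow> real" where
  "a_cos_ratio N x =
     (if \<exists>k::int. odd k \<and> 2 * x = of_int k
      then Lim (at x) (\<lambda>t. \<bar>a_coeff N t\<bar> / \<bar>cos (pi * t)\<bar>)
      else \<bar>a_coeff N x\<bar> / \<bar>cos (pi * x)\<bar>)"

text \<open>The innermost case is the minimum with \<open>|csc (2 Im \<xi>)| = +\<infinity>\<close>.\<close>

definition P1_factor :: "nat \<Rightarrow> complex \<Rightarrow> real" where
  "P1_factor N \<xi> =
     (if Re (exp (2 * \<xi>)) \<le> 1 then 1
      else if sin (2 * Im \<xi>) = 0 then 1 + chi (real N + 1 / 2)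
      else min (norm (1 - exp (- 2 * \<xi>)) * \<bar>1 / sin (2 * Im \<xi>)\<bar>) (1 + chi (real N + 1 / 2)))"

definition P1_term :: "nat \<Rightarrow> complex \<Rightarrow> complex \<Rightarrow> complex \<Rightarrow> complex" where
  "P1_term n \<xi> \<mu> \<nu> = a_coeff n \<mu> * Gamma (\<nu> - of_nat n + 1 / 2) * (- exp (- \<xi>) / sinh \<xi>) ^ n"

definition P2_term :: "nat \<Rightarrow> complex \<Rightarrow> complex \<Rightarrow> complex \<Rightarrow> complex" where
  "P2_term n \<xi> \<mu> \<nu> = a_coeff n \<mu> * Gamma (\<nu> - of_nat n + 1 / 2) * (exp \<xi> / sinh \<xi>) ^ n"

lemma open_slit_plane: "open slit_plane"
proof -
  have "closed (complex_of_real ` {1..})"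
  proof -
    have "complex_of_real ` {1..} = {z. Re z \<ge> 1} \<inter> \<real>"
    proof (intro equalityI subsetI)
      fix z assume "z \<in> {z. Re z \<ge> 1} \<inter> \<real>"
      then show "z \<in> complex_of_real ` {1..}"
        by (intro image_eqI[of _ _ "Re z"]) (simp_all add: of_real_Re)
    qed auto
    then show ?thesis
      by (simp add: closed_Int closed_halfspace_Re_ge closed_complex_Reals)
  qed
  then show ?thesis
    by (simp add: slit_plane_def open_Compl)
qed

lemma connected_slit_plane: "connected slit_plane"
proof (rule starlike_imp_connected)
  have "closed_segment 0 z \<subseteq> slit_plane" if z: "z \<in> slit_plane" for z
  proof
    fix w assume "w \<in> closed_segment 0 z"
    then obtain u where u: "0 \<le> u" "u \<le> 1" "w = of_real u * z"
      by (auto simp: in_segment scaleR_conv_of_real)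
    show "w \<in> slit_plane"
    proof (rule ccontr)
      assume "w \<notin> slit_plane"
      then obtain t where t: "t \<ge> 1" "of_real u * z = of_real t"
        using u by (auto simp: slit_plane_def)
      then have "u > 0" using u by (cases "u = 0") auto
      then have "z = of_real (t / u)" "t / u \<ge> 1"
        using t u by (auto simp: field_simps)
      then have "z \<in> complex_of_real ` {1..}"
        by (intro image_eqI[of _ _ "t / u"]) simp_all
      then show False using z by (simp add: slit_plane_def)
    qed
  qed
  moreover have "0 \<in> slit_plane"
    by (auto simp: slit_plane_def)
  ultimately show "starlike slit_plane"
    unfolding starlike_def by blast
qed

lemma ball_subset_slit_plane: "ball 0 1 \<subseteq> slit_plane"
  by (auto simp: slit_plane_def)

lemma slit_plane_continuation_unique:
  assumes "F holomorphic_on slit_plane" "G holomorphic_on slit_plane"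
    and "\<And>w. norm w < 1 \<Longrightarrow> F w = G w" and "w \<in> slit_plane"
  shows "F w = G w"
proof (rule analytic_continuation_open[OF open_ball open_slit_plane _ connected_slit_plane
        ball_subset_slit_plane assms(1,2) _ assms(4)])
  show "F z = G z" if "z \<in> ball 0 1" for z
    using that assms(3) by simp
qed simp

text \<open>
  The principal square root is the branch of \<open>sqrt (2 \<pi> sinh \<xi>)\<close> on \<open>D1\<close> that is
  continuous and positive for positive \<open>\<xi>\<close>.
\<close>

lemma sinh_D1_notin_nonpos_Reals:
  assumes "\<xi> \<in> D1"
  shows "2 * of_real pi * sinh \<xi> \<notin> \<real>\<^sub>\<le>\<^sub>0"
proof
  assume *: "2 * of_real pi * sinh \<xi> \<in> \<real>\<^sub>\<le>\<^sub>0"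
  have \<xi>: "Re \<xi> > 0" "\<bar>Im \<xi>\<bar> < pi" using assms by (auto simp: D1_def)
  have Re: "Re (sinh \<xi>) = sinh (Re \<xi>) * cos (Im \<xi>)"
    and Im: "Im (sinh \<xi>) = cosh (Re \<xi>) * sin (Im \<xi>)"
    by (simp_all add: sinh_def cosh_def Re_exp Im_exp algebra_simps)
  have "2 * pi * Re (sinh \<xi>) \<le> 0" "2 * pi * Im (sinh \<xi>) = 0"
    using * by (simp_all add: complex_nonpos_Reals_iff)
  then have "sinh (Re \<xi>) * cos (Im \<xi>) \<le> 0" "cosh (Re \<xi>) * sin (Im \<xi>) = 0"
    unfolding Re Im using pi_gt_zero by (simp_all add: mult_le_0_iff)
  moreover have "sinh (Re \<xi>) > 0" "cosh (Re \<xi>) > 0"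
    using \<xi> by simp_all
  ultimately have "cos (Im \<xi>) \<le> 0" "sin (Im \<xi>) = 0"
    by (simp_all add: mult_le_0_iff)
  moreover have "Im \<xi> = 0"
    by (rule sin_eq_0_pi) (use \<xi> \<open>sin (Im \<xi>) = 0\<close> in linarith)+
  ultimately show False by simp
qed

lemma continuous_on_sqrt_sinh: "continuous_on D1 (\<lambda>\<xi>. csqrt (2 * of_real pi * sinh \<xi>))"
proof (rule holomorphic_on_imp_continuous_on, rule holomorphic_on_csqrt')
  show "(\<lambda>\<xi>. 2 * of_real pi * sinh \<xi>) holomorphic_on D1"
    unfolding sinh_field_def by (intro holomorphic_intros) simp
qed (rule sinh_D1_notin_nonpos_Reals)

lemma csqrt_sinh_of_real:
  assumes "x > 0"
  shows "csqrt (2 * of_real pi * sinh (of_real x)) = of_real (sqrt (2 * pi * sinh x))"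
proof -
  have "2 * of_real pi * sinh (complex_of_real x) = of_real (2 * pi * sinh x)"
    by (simp add: sinh_def exp_of_real scaleR_conv_of_real flip: of_real_minus)
  moreover have "2 * pi * sinh x \<ge> 0"
    using assms by simp
  ultimately show ?thesis
    by (metis Im_complex_of_real Re_complex_of_real csqrt_of_real_nonneg)
qed

end

theory Submission
  imports Defs
begin

text \<open>
  The remainders are iterated Laplace and beta integrals of the terminant
  \<open>q \<mapsto> \<integral> u powr (p - 1) * exp (- u) / (1 + u * q) du\<close> with \<open>p = N + 1/2\<close>. Expanding the
  geometric kernel shows that the partial sum plus the remainder does not depend on \<open>N\<close>;
  elementary lower bounds for \<open>|1 + u q|\<close>, or near the cut a Laplace representation of the kernel,
  give the error bounds. For \<open>N = 0\<close> and small real \<open>\<mu>\<close> the remainder collapses to an Euler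
  integral along a ray, and Cauchy's theorem expresses Mehler's integral for the hypergeometric
  function at \<open>\<xi> = \<plusminus>ib\<close> as the difference of two such rays. Analytic continuation in \<open>\<mu>\<close>
  and then in \<open>\<xi>\<close> yields the expansion off the positive axis; on it one averages the two
  boundary values.
\<close>

section \<open>Parameter integrals\<close>

lemma set_integrable_lborel_iff_absolutely_integrable:
  fixes f :: "real \<Rightarrow> 'b::euclidean_space"
  assumes "A \<in> sets borel" "continuous_on A f"
  shows "set_integrable lborel A f \<longleftrightarrow> f absolutely_integrable_on A"
proof -
  have "(\<lambda>x. indicator A x *\<^sub>R f x) \<in> borel_measurable lborel"
    using borel_measurable_continuous_on_indicator[OF assms] by simp
  then show ?thesis
    unfolding set_integrable_def by (rule integrable_completion[symmetric])
qed

lemma set_integral_has_integral: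
  fixes f :: "real \<Rightarrow> 'b::euclidean_space"
  assumes "set_integrable lborel A f" "(f has_integral I) A"
  shows "(LINT x:A|lborel. f x) = I"
  using set_borel_integral_eq_integral(2)[OF assms(1)] assms(2) by (simp add: integral_unique)

lemma set_integrable_complex_of_real_iff:
  "set_integrable M A (\<lambda>x. complex_of_real (f x)) \<longleftrightarrow> set_integrable M A f"
proof -
  have "(\<lambda>x. indicator A x *\<^sub>R complex_of_real (f x)) = (\<lambda>x. of_real (indicator A x *\<^sub>R f x))"
    by (simp add: fun_eq_iff scaleR_conv_of_real)
  then show ?thesis
    unfolding set_integrable_def by (simp only: complex_of_real_integrable_eq)
qed

lemma set_integral_substitution:
  fixes f k :: "real \<Rightarrow> 'b::euclidean_space" and g h :: "real \<Rightarrow> real"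
  assumes S: "S \<in> sets borel" and T: "T \<in> sets borel" and im: "g ` S = T" and inj: "inj_on g S"
    and der: "\<And>x. x \<in> S \<Longrightarrow> (g has_field_derivative h x) (at x)" and h: "continuous_on S h"
    and f: "continuous_on T f" and int: "set_integrable lborel T f"
    and k: "\<And>x. x \<in> S \<Longrightarrow> k x = \<bar>h x\<bar> *\<^sub>R f (g x)"
  shows "set_integrable lborel S k" and "(LINT x:S|lborel. k x) = (LINT y:T|lborel. f y)"
proof -
  have cont_g: "continuous_on S g"
    using der by (meson DERIV_isCont continuous_at_imp_continuous_on)
  have "continuous_on S (\<lambda>x. \<bar>h x\<bar> *\<^sub>R f (g x))"
    by (intro continuous_intros h continuous_on_compose2[OF f cont_g]) (use im in auto)
  then have cont_k: "continuous_on S k"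
    by (rule continuous_on_eq) (simp add: k)
  have "f absolutely_integrable_on g ` S \<and> integral (g ` S) f = integral T f"
    using int im set_integrable_lborel_iff_absolutely_integrable[OF T f] by simp
  then have "(\<lambda>x. \<bar>h x\<bar> *\<^sub>R f (g x)) absolutely_integrable_on S \<and>
      integral S (\<lambda>x. \<bar>h x\<bar> *\<^sub>R f (g x)) = integral T f"
    by (subst has_absolute_integral_change_of_variables_real)
       (use S inj der in \<open>auto intro: has_field_derivative_at_within\<close>)
  moreover have "(\<lambda>x. \<bar>h x\<bar> *\<^sub>R f (g x)) absolutely_integrable_on S \<longleftrightarrow> k absolutely_integrable_on S"
    by (rule set_integrable_cong) (use k in auto)
  moreover have "integral S (\<lambda>x. \<bar>h x\<bar> *\<^sub>R f (g x)) = integral S k"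
    by (rule integral_cong) (simp add: k)
  ultimately have k_integral: "k absolutely_integrable_on S" "integral S k = integral T f"
    by simp_all
  then show integrable_k: "set_integrable lborel S k"
    using set_integrable_lborel_iff_absolutely_integrable[OF S cont_k] by simp
  show "(LINT x:S|lborel. k x) = (LINT y:T|lborel. f y)"
    using k_integral(2) set_borel_integral_eq_integral(2)[OF integrable_k]
      set_borel_integral_eq_integral(2)[OF int] by simp
qed

lemma set_integral_scale_Ioi:
  fixes f :: "real \<Rightarrow> 'b::euclidean_space"
  assumes c: "c > 0" and f: "set_integrable lborel {0<..} f"
  shows "set_integrable lborel {0<..} (\<lambda>x. f (c * x))"
    and "(LINT x:{0<..}|lborel. f (c * x)) = (1 / c) *\<^sub>R (LINT x:{0<..}|lborel. f x)"
proof -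
  have scale: "(\<lambda>x. indicator {0<..} x *\<^sub>R f (c * x)) = (\<lambda>x. indicator {0<..} (0 + c * x) *\<^sub>R f (0 + c * x))"
    using c by (auto simp: indicator_def fun_eq_iff zero_less_mult_iff)
  show "set_integrable lborel {0<..} (\<lambda>x. f (c * x))"
    unfolding set_integrable_def scale
    by (rule lborel_integrable_real_affine) (use f c in \<open>auto simp: set_integrable_def\<close>)
  show "(LINT x:{0<..}|lborel. f (c * x)) = (1 / c) *\<^sub>R (LINT x:{0<..}|lborel. f x)"
    unfolding set_lebesgue_integral_def scale
    by (subst (2) lborel_integral_real_affine[where c = c and t = 0]) (use c in auto)
qed

lemma set_integrable_bound_continuous:
  fixes f :: "real \<Rightarrow> 'b::euclidean_space"
  assumes "A \<in> sets borel" "continuous_on A f" "set_integrable lborel A g"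
    and "\<And>x. x \<in> A \<Longrightarrow> norm (f x) \<le> (g x :: real)"
  shows "set_integrable lborel A f"
proof (rule set_integrable_bound[OF assms(3)])
  show "set_borel_measurable lborel A f"
    using borel_measurable_continuous_on_indicator[OF assms(1,2)] by (simp add: set_borel_measurable_def)
  show "AE x in lborel. x \<in> A \<longrightarrow> norm (f x) \<le> norm (g x)"
    using assms(4) by (intro AE_I2) force
qed

lemma set_integral_norm_bound_le:
  fixes f :: "real \<Rightarrow> 'b::euclidean_space"
  assumes "set_integrable lborel A g" and "\<And>x. x \<in> A \<Longrightarrow> norm (f x) \<le> g x"
  shows "norm (LINT x:A|lborel. f x) \<le> (LINT x:A|lborel. g x)"
proof -
  have "norm (LINT x:A|lborel. f x) \<le> (\<integral>x. norm (indicator A x *\<^sub>R f x) \<partial>lborel)"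
    unfolding set_lebesgue_integral_def by (rule integral_norm_bound)
  also have "\<dots> \<le> (LINT x:A|lborel. g x)"
    unfolding set_lebesgue_integral_def
  proof (rule integral_mono')
    show "integrable lborel (\<lambda>x. indicator A x *\<^sub>R g x)"
      using assms(1) by (simp add: set_integrable_def)
    show "norm (indicator A x *\<^sub>R f x) \<le> indicator A x *\<^sub>R g x" for x
      using assms(2)[of x] by (auto simp: indicator_def)
    show "0 \<le> indicator A x *\<^sub>R g x" for x
      using assms(2)[of x] order_trans[OF norm_ge_zero[of "f x"]] by (auto simp: indicator_def)
  qed
  finally show ?thesis .
qed

lemma set_integral_Fubini:
  fixes f :: "real \<Rightarrow> real \<Rightarrow> 'b::euclidean_space"
  assumes A: "A \<in> sets borel" and B: "B \<in> sets borel"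
    and cont: "continuous_on (A \<times> B) (\<lambda>p. f (fst p) (snd p))"
    and inner: "\<And>x. x \<in> A \<Longrightarrow> set_integrable lborel B (f x)"
    and outer: "set_integrable lborel A h" "\<And>x. x \<in> A \<Longrightarrow> (LINT y:B|lborel. norm (f x y)) \<le> h x"
  shows "(LINT x:A|lborel. LINT y:B|lborel. f x y) = (LINT y:B|lborel. LINT x:A|lborel. f x y)"
proof -
  let ?F = "\<lambda>p. indicator (A \<times> B) p *\<^sub>R f (fst p) (snd p)"
  have eq: "?F (x, y) = indicator A x *\<^sub>R (indicator B y *\<^sub>R f x y)"
    and eq': "?F (x, y) = indicator B y *\<^sub>R (indicator A x *\<^sub>R f x y)" for x y
    by (auto simp: indicator_def)
  have norm_F: "(\<integral>y. norm (?F (x, y)) \<partial>lborel) = indicator A x *\<^sub>R (LINT y:B|lborel. norm (f x y))" for x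
    by (auto simp: set_lebesgue_integral_def indicator_def intro!: Bochner_Integration.integral_cong)
  have "?F \<in> borel_measurable borel"
    by (rule borel_measurable_continuous_on_indicator[OF _ cont]) (use A B in \<open>auto simp: borel_prod[symmetric]\<close>)
  then have meas [measurable]: "?F \<in> borel_measurable (lborel \<Otimes>\<^sub>M lborel)"
    by (simp add: lborel_prod)
  have "integrable (lborel \<Otimes>\<^sub>M lborel) ?F"
  proof (rule lborel_pair.Fubini_integrable[OF meas])
    show "integrable lborel (\<lambda>x. \<integral>y. norm (?F (x, y)) \<partial>lborel)"
    proof (rule Bochner_Integration.integrable_bound)
      show "integrable lborel (\<lambda>x. indicator A x *\<^sub>R h x)"
        using outer(1) by (simp add: set_integrable_def)
      show "AE x in lborel. norm (\<integral>y. norm (?F (x, y)) \<partial>lborel) \<le> norm (indicator A x *\<^sub>R h x)"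
        unfolding norm_F
        by (intro AE_I2) (use outer(2) in \<open>force simp: indicator_def set_lebesgue_integral_def\<close>)
    qed measurable
    show "AE x in lborel. integrable lborel (\<lambda>y. ?F (x, y))"
      unfolding eq by (intro AE_I2) (use inner in \<open>auto simp: set_integrable_def indicator_def\<close>)
  qed
  then have "integrable (lborel \<Otimes>\<^sub>M lborel) (case_prod (\<lambda>x y. ?F (x, y)))"
    by (simp add: case_prod_beta')
  from lborel_pair.Fubini_integral[OF this]
  have "(\<integral>x. (\<integral>y. ?F (x, y) \<partial>lborel) \<partial>lborel) = (\<integral>y. (\<integral>x. ?F (x, y) \<partial>lborel) \<partial>lborel)" ..
  moreover have "(\<integral>x. (\<integral>y. ?F (x, y) \<partial>lborel) \<partial>lborel) = (LINT x:A|lborel. LINT y:B|lborel. f x y)"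
    by (simp only: eq set_lebesgue_integral_def integral_scaleR_right)
  moreover have "(\<integral>y. (\<integral>x. ?F (x, y) \<partial>lborel) \<partial>lborel) = (LINT y:B|lborel. LINT x:A|lborel. f x y)"
    by (simp only: eq' set_lebesgue_integral_def integral_scaleR_right)
  ultimately show ?thesis by simp
qed

lemma holomorphic_bounded_lipschitz:
  assumes r: "r > 0" and hol: "f holomorphic_on ball z r"
    and B: "\<And>v. v \<in> ball z r \<Longrightarrow> norm (f v) \<le> B" and w: "w \<in> ball z (r / 2)"
  shows "norm (f w - f z) \<le> 4 * B / r * norm (w - z)"
proof (rule field_differentiable_bound[where S = "ball z (r / 2)" and f' = "deriv f"])
  fix y assume y: "y \<in> ball z (r / 2)"
  have sub: "cball y (r / 4) \<subseteq> ball z r"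
  proof
    fix v assume "v \<in> cball y (r / 4)"
    then show "v \<in> ball z r"
      using y r dist_triangle[of z v y] by (simp add: dist_commute)
  qed
  then have hol': "f holomorphic_on cball y (r / 4)"
    using hol by (rule holomorphic_on_subset[rotated])
  have "norm ((deriv ^^ 1) f y) \<le> fact 1 * B / (r / 4) ^ 1"
  proof (rule Cauchy_inequality)
    show "f holomorphic_on ball y (r / 4)"
      using hol' ball_subset_cball by (rule holomorphic_on_subset)
    show "continuous_on (cball y (r / 4)) f"
      using hol' by (rule holomorphic_on_imp_continuous_on)
    show "norm (f v) \<le> B" if "norm (y - v) = r / 4" for v
      using that sub by (intro B) (auto simp: dist_norm)
  qed (use r in simp)
  then show "norm (deriv f y) \<le> 4 * B / r"
    by (simp add: field_simps)
  have "(f has_field_derivative deriv f y) (at y)"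
    using sub r by (intro holomorphic_derivI[OF hol]) (auto simp: subset_iff)
  then show "(f has_field_derivative deriv f y) (at y within ball z (r / 2))"
    by (rule has_field_derivative_at_within)
qed (use w r in auto)

lemma set_integral_dominated_convergence:
  fixes f :: "real \<Rightarrow> 'b::euclidean_space"
  assumes "A \<in> sets borel" and g: "set_integrable lborel A g"
    and s: "\<And>n. continuous_on A (s n)" and bound: "\<And>n x. x \<in> A \<Longrightarrow> norm (s n x) \<le> g x"
    and lim: "\<And>x. x \<in> A \<Longrightarrow> (\<lambda>n. s n x) \<longlonglongrightarrow> f x"
  shows "(\<lambda>n. LINT x:A|lborel. s n x) \<longlonglongrightarrow> (LINT x:A|lborel. f x)"
  unfolding set_lebesgue_integral_def
proof (rule integral_dominated_convergence[where w = "\<lambda>x. indicator A x *\<^sub>R g x"])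
  have L: "(\<lambda>n. indicator A x *\<^sub>R s n x) \<longlonglongrightarrow> indicator A x *\<^sub>R f x" for x
    using lim[of x] by (auto simp: indicator_def)
  then show "AE x in lborel. (\<lambda>n. indicator A x *\<^sub>R s n x) \<longlonglongrightarrow> indicator A x *\<^sub>R f x"
    by simp
  show M: "(\<lambda>x. indicator A x *\<^sub>R s n x) \<in> borel_measurable lborel" for n
    using borel_measurable_continuous_on_indicator[OF assms(1) s] by simp
  show "(\<lambda>x. indicator A x *\<^sub>R f x) \<in> borel_measurable lborel"
    using L M by (rule borel_measurable_LIMSEQ_metric[rotated])
  show "integrable lborel (\<lambda>x. indicator A x *\<^sub>R g x)"
    using g by (simp add: set_integrable_def)
  show "AE x in lborel. norm (indicator A x *\<^sub>R s n x) \<le> indicator A x *\<^sub>R g x" for n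
    using bound by (intro AE_I2) (auto simp: indicator_def)
qed

lemma tendsto_set_lebesgue_integral_at:
  fixes f :: "'a::metric_space \<Rightarrow> real \<Rightarrow> 'b::euclidean_space"
  assumes A: "A \<in> sets borel" and g: "set_integrable lborel A g"
    and bound: "\<forall>\<^sub>F w in at z. continuous_on A (f w) \<and> (\<forall>t\<in>A. norm (f w t) \<le> g t)"
    and lim: "\<And>t. t \<in> A \<Longrightarrow> ((\<lambda>w. f w t) \<longlongrightarrow> l t) (at z)"
  shows "((\<lambda>w. LINT t:A|lborel. f w t) \<longlongrightarrow> (LINT t:A|lborel. l t)) (at z)"
proof (subst tendsto_at_iff_sequentially, intro allI impI)
  fix X assume "\<forall>i. X i \<in> UNIV - {z}" "X \<longlonglongrightarrow> z"
  then have X: "filterlim X (at z) sequentially"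
    by (simp add: filterlim_at)
  then have "\<forall>\<^sub>F n in sequentially. continuous_on A (f (X n)) \<and> (\<forall>t\<in>A. norm (f (X n) t) \<le> g t)"
    using bound by (rule eventually_compose_filterlim[rotated])
  then obtain n0 where n0: "\<And>n. n \<ge> n0 \<Longrightarrow> continuous_on A (f (X n)) \<and> (\<forall>t\<in>A. norm (f (X n) t) \<le> g t)"
    by (auto simp: eventually_sequentially)
  have "(\<lambda>n. LINT t:A|lborel. f (X (n + n0)) t) \<longlonglongrightarrow> (LINT t:A|lborel. l t)"
  proof (rule set_integral_dominated_convergence[OF A g])
    show "(\<lambda>n. f (X (n + n0)) t) \<longlonglongrightarrow> l t" if "t \<in> A" for t
      using filterlim_compose[OF lim[OF that] X] by (rule LIMSEQ_ignore_initial_segment)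
  qed (use n0 in auto)
  then show "((\<lambda>w. LINT t:A|lborel. f w t) \<circ> X) \<longlonglongrightarrow> (LINT t:A|lborel. l t)"
    unfolding o_def by (rule LIMSEQ_offset)
qed

lemma tendsto_set_integral_difference_quotient:
  fixes f :: "complex \<Rightarrow> real \<Rightarrow> complex"
  assumes r: "r > 0" and A: "A \<in> sets borel" and g: "set_integrable lborel A g"
    and hol: "\<And>t. t \<in> A \<Longrightarrow> (\<lambda>w. f w t) holomorphic_on ball z r"
    and cont: "\<And>w. w \<in> ball z r \<Longrightarrow> continuous_on A (f w)"
    and bound: "\<And>w t. w \<in> ball z r \<Longrightarrow> t \<in> A \<Longrightarrow> norm (f w t) \<le> g t"
  shows "((\<lambda>w. LINT t:A|lborel. (f w t - f z t) / (w - z)) \<longlongrightarrow> (LINT t:A|lborel. deriv (\<lambda>w. f w t) z)) (at z)"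
proof (rule tendsto_set_lebesgue_integral_at[OF A])
  let ?Q = "\<lambda>w t. (f w t - f z t) / (w - z)"
  have norm_Q: "norm (?Q w t) \<le> 4 * g t / r" if "w \<in> ball z (r / 2) - {z}" "t \<in> A" for w t
  proof -
    have "norm (f w t - f z t) \<le> 4 * g t / r * norm (w - z)"
      by (rule holomorphic_bounded_lipschitz[OF r hol]) (use r bound that in auto)
    then show ?thesis using that by (simp add: norm_divide field_simps)
  qed
  have near: "\<forall>\<^sub>F w in at z. w \<in> ball z (r / 2) - {z}"
    using r by (auto simp: eventually_at dist_commute intro!: exI[of _ "r / 2"])
  then show "\<forall>\<^sub>F w in at z. continuous_on A (?Q w) \<and> (\<forall>t\<in>A. norm (?Q w t) \<le> 4 * g t / r)"
    by eventually_elim (use norm_Q r in \<open>auto intro!: continuous_intros cont\<close>)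
  show "set_integrable lborel A (\<lambda>t. 4 * g t / r)" using g by simp
  show "((\<lambda>w. ?Q w t) \<longlongrightarrow> deriv (\<lambda>w. f w t) z) (at z)" if "t \<in> A" for t
    using holomorphic_derivI[OF hol[OF that] open_ball, of z] r by (simp add: has_field_derivative_iff)
qed

lemma holomorphic_on_set_lebesgue_integral:
  fixes f :: "complex \<Rightarrow> real \<Rightarrow> complex"
  assumes U: "open U" and A: "A \<in> sets borel"
    and hol: "\<And>t. t \<in> A \<Longrightarrow> (\<lambda>z. f z t) holomorphic_on U"
    and cont: "\<And>z. z \<in> U \<Longrightarrow> continuous_on A (f z)"
    and dom: "\<And>z. z \<in> U \<Longrightarrow> \<exists>e>0. \<exists>g. set_integrable lborel A g \<and>
                (\<forall>w\<in>ball z e \<inter> U. \<forall>t\<in>A. norm (f w t) \<le> (g t :: real))"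
  shows "(\<lambda>z. LINT t:A|lborel. f z t) holomorphic_on U"
proof (subst holomorphic_on_open[OF U], intro ballI)
  fix z assume z: "z \<in> U"
  obtain e g where e: "e > 0" and g: "set_integrable lborel A g"
    and bound: "\<And>w t. w \<in> ball z e \<Longrightarrow> w \<in> U \<Longrightarrow> t \<in> A \<Longrightarrow> norm (f w t) \<le> g t"
    using dom[OF z] by auto
  obtain r where r: "r > 0" "ball z r \<subseteq> U" "ball z r \<subseteq> ball z e"
  proof -
    obtain r where "r > 0" "ball z r \<subseteq> U" using U z open_contains_ball by blast
    then show thesis using e by (intro that[of "min r e"]) auto
  qed
  have integrable: "set_integrable lborel A (f w)" if "w \<in> ball z r" for w
    by (rule set_integrable_bound_continuous[OF A cont g]) (use bound that r in \<open>auto simp: subset_iff\<close>)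
  have "((\<lambda>w. LINT t:A|lborel. (f w t - f z t) / (w - z)) \<longlongrightarrow> (LINT t:A|lborel. deriv (\<lambda>w. f w t) z)) (at z)"
    by (rule tendsto_set_integral_difference_quotient[OF r(1) A g holomorphic_on_subset[OF hol r(2)] cont])
       (use r bound in \<open>auto simp: subset_iff\<close>)
  moreover have "\<forall>\<^sub>F w in at z. w \<in> ball z r"
    using r(1) by (intro eventually_at_in_open') auto
  then have "\<forall>\<^sub>F w in at z. (LINT t:A|lborel. (f w t - f z t) / (w - z)) =
      ((LINT t:A|lborel. f w t) - (LINT t:A|lborel. f z t)) / (w - z)"
    by eventually_elim (use integrable r(1) in simp)
  ultimately have "((\<lambda>w. ((LINT t:A|lborel. f w t) - (LINT t:A|lborel. f z t)) / (w - z))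
      \<longlongrightarrow> (LINT t:A|lborel. deriv (\<lambda>w. f w t) z)) (at z)"
    by (rule Lim_transform_eventually)
  then show "\<exists>f'. ((\<lambda>z. LINT t:A|lborel. f z t) has_field_derivative f') (at z)"
    by (auto simp: has_field_derivative_iff)
qed

locale integral_weight =
  fixes A :: "real set" and w :: "real \<Rightarrow> complex"
  assumes open_domain: "open A" and continuous: "continuous_on A w"
    and integrable: "set_integrable lborel A w"
begin

lemma borel_domain: "A \<in> sets borel"
  using open_domain by simp

lemma norm_integrable: "set_integrable lborel A (\<lambda>t. norm (w t))"
  using integrable_norm[OF integrable[unfolded set_integrable_def]] by (simp add: set_integrable_def)

lemma mult_integrable:
  assumes "continuous_on A F" "\<And>t. t \<in> A \<Longrightarrow> norm (F t) \<le> C"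
  shows "set_integrable lborel A (\<lambda>t. w t * F t)"
proof (rule set_integrable_bound_continuous[OF borel_domain])
  show "set_integrable lborel A (\<lambda>t. norm (w t) * C)"
    using norm_integrable by (rule set_integrable_mult_left)
qed (auto intro!: continuous_intros continuous assms mult_left_mono simp: norm_mult)

lemma norm_integral_le:
  assumes "\<And>t. t \<in> A \<Longrightarrow> norm (F t) \<le> C"
  shows "norm (LINT t:A|lborel. w t * F t) \<le> (LINT t:A|lborel. norm (w t)) * C"
proof -
  have "norm (LINT t:A|lborel. w t * F t) \<le> (LINT t:A|lborel. norm (w t) * C)"
    by (intro set_integral_norm_bound_le set_integrable_mult_left norm_integrable)
       (auto simp: norm_mult intro: mult_left_mono assms)
  then show ?thesis by (simp only: set_integral_mult_left)
qed

lemma integral_holomorphic: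
  assumes "open U" and "\<And>t. t \<in> A \<Longrightarrow> (\<lambda>z. F z t) holomorphic_on U"
    and "\<And>z. z \<in> U \<Longrightarrow> continuous_on A (F z)"
    and bounded: "\<And>z. z \<in> U \<Longrightarrow> \<exists>e>0. \<exists>C. \<forall>v\<in>ball z e \<inter> U. \<forall>t\<in>A. norm (F v t) \<le> C"
  shows "(\<lambda>z. LINT t:A|lborel. w t * F z t) holomorphic_on U"
proof (rule holomorphic_on_set_lebesgue_integral)
  fix z assume "z \<in> U"
  then obtain e C where eC: "e > 0" "\<And>v t. v \<in> ball z e \<inter> U \<Longrightarrow> t \<in> A \<Longrightarrow> norm (F v t) \<le> C"
    using bounded by metis
  then have "\<forall>v\<in>ball z e \<inter> U. \<forall>t\<in>A. norm (w t * F v t) \<le> norm (w t) * C"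
    by (simp add: norm_mult mult_left_mono)
  then show "\<exists>e>0. \<exists>g. set_integrable lborel A g \<and> (\<forall>v\<in>ball z e \<inter> U. \<forall>t\<in>A. norm (w t * F v t) \<le> g t)"
    using eC(1) set_integrable_mult_left[OF norm_integrable] by blast
qed (auto intro!: holomorphic_intros continuous_intros borel_domain continuous assms)

end

lemma analytic_continuation_from_reals:
  assumes "f holomorphic_on S" "g holomorphic_on S" "open S" "connected S"
    and ab: "a < b" and sub: "complex_of_real ` {a<..<b} \<subseteq> S"
    and eq: "\<And>x. a < x \<Longrightarrow> x < b \<Longrightarrow> f (of_real x) = g (of_real x)" and z: "z \<in> S"
  shows "f z = g z"
proof -
  let ?c = "(a + b) / 2"
  have c: "?c \<in> {a<..<b}" using ab by simp
  then have "?c islimpt {a<..<b}"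
    by (intro interior_limit_point) (simp add: interior_open)
  then have lim: "of_real ?c islimpt complex_of_real ` {a<..<b}"
    unfolding islimpt_approachable by (metis dist_of_real imageI of_real_eq_iff)
  have "f z - g z = 0"
  proof (rule analytic_continuation[OF _ assms(3,4) sub _ lim _ z, where f = "\<lambda>z. f z - g z"])
    show "(\<lambda>z. f z - g z) holomorphic_on S"
      by (intro holomorphic_intros assms(1,2))
    show "of_real ?c \<in> S"
      using c sub by blast
  qed (use eq in auto)
  then show ?thesis by simp
qed

section \<open>Gamma and beta integrals\<close>

definition gamma_weight :: "complex \<Rightarrow> complex \<Rightarrow> real \<Rightarrow> complex" where
  "gamma_weight z a t = of_real t powr (z - 1) * exp (- (a * of_real t))"

lemma norm_of_real_powr: "t > 0 \<Longrightarrow> norm (complex_of_real t powr z) = t powr Re z"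
  by (simp add: norm_powr_real_powr)

lemma norm_gamma_weight: "t > 0 \<Longrightarrow> norm (gamma_weight z a t) = t powr (Re z - 1) * exp (- (Re a * t))"
  by (simp add: gamma_weight_def norm_mult norm_of_real_powr)

lemma gamma_weight_of_real:
  "t > 0 \<Longrightarrow> gamma_weight (of_real x) (of_real a) t = of_real (t powr (x - 1) * exp (- (a * t)))"
  using powr_of_real[of t "x - 1"] by (simp add: gamma_weight_def exp_of_real flip: of_real_minus of_real_mult)

lemma of_real_mult_gamma_weight: "t > 0 \<Longrightarrow> of_real t * gamma_weight z a t = gamma_weight (z + 1) a t"
  using powr_add[of "of_real t" 1 "z - 1"] by (simp add: gamma_weight_def)

lemma continuous_on_gamma_weight: "continuous_on {0<..} (gamma_weight z a)"
  unfolding gamma_weight_def by (intro continuous_intros) auto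

lemma gamma_weight_integral_rate_1:
  assumes "Re z > 0"
  shows "set_integrable lborel {0<..} (gamma_weight z 1)" "(LINT t:{0<..}|lborel. gamma_weight z 1 t) = Gamma z"
proof -
  have eq: "gamma_weight z 1 = (\<lambda>t. of_real t powr (z - 1) / of_real (exp t))"
    by (simp add: gamma_weight_def fun_eq_iff exp_minus field_simps exp_of_real)
  show "set_integrable lborel {0<..} (gamma_weight z 1)"
    using absolutely_integrable_Gamma_integral'[OF assms]
    by (subst set_integrable_lborel_iff_absolutely_integrable[OF _ continuous_on_gamma_weight]) (simp_all add: eq)
  then show "(LINT t:{0<..}|lborel. gamma_weight z 1 t) = Gamma z"
    by (rule set_integral_has_integral) (unfold eq, rule Gamma_integral_complex'[OF assms])
qed

lemma gamma_weight_integral_real_rate: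
  assumes z: "Re z > 0" and a: "a > 0"
  shows "set_integrable lborel {0<..} (gamma_weight z (of_real a))"
    and "(LINT t:{0<..}|lborel. gamma_weight z (of_real a) t) = Gamma z * of_real a powr (- z)"
proof -
  have powr_nonzero: "complex_of_real a powr (z - 1) \<noteq> 0"
    and powr_pred: "of_real a powr (z - 1) = complex_of_real a powr z / of_real a"
    using a by (simp_all add: powr_diff)
  have scale: "gamma_weight z 1 (a * t) = of_real a powr (z - 1) * gamma_weight z (of_real a) t" if "t \<in> {0<..}" for t
    using a that by (simp add: gamma_weight_def powr_times_real)
  have "set_integrable lborel {0<..} (\<lambda>t. of_real a powr (z - 1) * gamma_weight z (of_real a) t)"
    using set_integral_scale_Ioi(1)[OF a gamma_weight_integral_rate_1(1)[OF z]]
    by (rule set_integrable_cong[THEN iffD1, OF refl refl, rotated]) (rule scale)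
  then show "set_integrable lborel {0<..} (gamma_weight z (of_real a))"
    using powr_nonzero by simp
  have "of_real a powr (z - 1) * (LINT t:{0<..}|lborel. gamma_weight z (of_real a) t) =
      (LINT t:{0<..}|lborel. gamma_weight z 1 (a * t))"
    unfolding set_integral_mult_right[symmetric]
    by (intro set_lebesgue_integral_cong) (simp_all add: scale)
  also have "\<dots> = Gamma z / of_real a"
    using set_integral_scale_Ioi(2)[OF a gamma_weight_integral_rate_1(1)[OF z]] gamma_weight_integral_rate_1(2)[OF z]
    by (simp add: scaleR_conv_of_real divide_inverse)
  finally show "(LINT t:{0<..}|lborel. gamma_weight z (of_real a) t) = Gamma z * of_real a powr (- z)"
    using a powr_nonzero unfolding powr_pred by (simp add: powr_minus field_simps)
qed

lemma notin_nonpos_Reals_Re: "Re z > 0 \<Longrightarrow> z \<notin> \<real>\<^sub>\<le>\<^sub>0"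
  by (auto simp: complex_nonpos_Reals_iff)

lemma pos_notin_nonpos_Ints: "x > 0 \<Longrightarrow> (x::real) \<notin> \<int>\<^sub>\<le>\<^sub>0"
  and notin_nonpos_Ints_Re: "Re z > 0 \<Longrightarrow> z \<notin> \<int>\<^sub>\<le>\<^sub>0"
  by (auto elim!: nonpos_Ints_cases)

lemma
  assumes z: "Re z > 0" and a: "Re a > 0"
  shows integral_weight_gamma: "integral_weight {0<..} (gamma_weight z a)"
    and integral_norm_gamma_weight: "(LINT t:{0<..}|lborel. norm (gamma_weight z a t)) =
        Gamma (Re z) * Re a powr (- Re z)"
proof -
  have norm_eq: "of_real (norm (gamma_weight z a t)) = gamma_weight (of_real (Re z)) (of_real (Re a)) t"
    if "t \<in> {0<..}" for t
    using that gamma_weight_of_real[of t "Re z" "Re a"] by (simp add: norm_gamma_weight)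
  have "set_integrable lborel {0<..} (\<lambda>t. complex_of_real (norm (gamma_weight z a t)))"
    using gamma_weight_integral_real_rate(1)[of "of_real (Re z)" "Re a"] z a
    by (subst set_integrable_cong[OF refl refl norm_eq]) simp_all
  then have "set_integrable lborel {0<..} (\<lambda>t. norm (gamma_weight z a t))"
    by (simp only: set_integrable_complex_of_real_iff)
  then have "set_integrable lborel {0<..} (gamma_weight z a)"
    by (rule set_integrable_bound_continuous[OF _ continuous_on_gamma_weight, rotated]) auto
  then show "integral_weight {0<..} (gamma_weight z a)"
    by unfold_locales (simp_all add: continuous_on_gamma_weight)
  have "complex_of_real (LINT t:{0<..}|lborel. norm (gamma_weight z a t)) =
      (LINT t:{0<..}|lborel. gamma_weight (of_real (Re z)) (of_real (Re a)) t)"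
    unfolding set_integral_complex_of_real[symmetric]
    by (intro set_lebesgue_integral_cong) (simp_all add: norm_eq)
  also have "\<dots> = of_real (Gamma (Re z) * Re a powr (- Re z))"
    using z a powr_of_real[of "Re a" "- Re z"]
    by (subst gamma_weight_integral_real_rate(2)) (auto simp: Gamma_complex_of_real)
  finally show "(LINT t:{0<..}|lborel. norm (gamma_weight z a t)) = Gamma (Re z) * Re a powr (- Re z)"
    by (simp only: of_real_eq_iff)
qed

lemma integral_gamma_weight:
  assumes z: "Re z > 0" and a: "Re a > 0"
  shows "(LINT t:{0<..}|lborel. gamma_weight z a t) = Gamma z * a powr (- z)"
proof -
  define \<epsilon> where "\<epsilon> = Re a / 2"
  have \<epsilon>: "\<epsilon> > 0" "\<epsilon> < Re a" using a by (simp_all add: \<epsilon>_def)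
  let ?H = "{a. Re a > \<epsilon>}"
  have weight: "integral_weight {0<..} (gamma_weight z (of_real \<epsilon>))"
    using z \<epsilon> by (intro integral_weight_gamma) simp_all
  have split: "gamma_weight z a t = gamma_weight z (of_real \<epsilon>) t * exp (- ((a - of_real \<epsilon>) * of_real t))" for a t
    by (simp add: gamma_weight_def exp_add[symmetric] algebra_simps)
  show ?thesis
  proof (rule analytic_continuation_from_reals[where S = ?H and a = \<epsilon> and b = "2 * \<epsilon>"
        and f = "\<lambda>a. LINT t:{0<..}|lborel. gamma_weight z a t" and g = "\<lambda>a. Gamma z * a powr (- z)"])
    have "(\<lambda>a. LINT t:{0<..}|lborel. gamma_weight z (of_real \<epsilon>) t * exp (- ((a - of_real \<epsilon>) * of_real t)))
        holomorphic_on ?H"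
    proof (rule integral_weight.integral_holomorphic[OF weight])
      have "norm (exp (- ((v - of_real \<epsilon>) * of_real t))) \<le> 1" if "Re v > \<epsilon>" "t > 0" for v and t :: real
        using that by simp
      then show "\<exists>e>0. \<exists>C. \<forall>v\<in>ball a e \<inter> ?H. \<forall>t\<in>{0<..}.
          norm (exp (- ((v - of_real \<epsilon>) * of_real t))) \<le> C" for a
        by (intro exI[of _ 1] conjI ballI zero_less_one) blast
    qed (intro holomorphic_intros continuous_intros open_halfspace_Re_gt)+
    then show "(\<lambda>a. LINT t:{0<..}|lborel. gamma_weight z a t) holomorphic_on ?H"
      by (simp only: split[symmetric])
    show "(\<lambda>a. Gamma z * a powr (- z)) holomorphic_on ?H"
      using \<epsilon> by (intro holomorphic_intros notin_nonpos_Reals_Re) auto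
    show "connected ?H"
      by (intro convex_connected convex_halfspace_Re_gt)
  qed (use \<epsilon> z in \<open>auto intro!: gamma_weight_integral_real_rate open_halfspace_Re_gt\<close>)
qed

lemma integral_gamma_weight_1:
  assumes "Re a > 0"
  shows "(LINT s:{0<..}|lborel. gamma_weight 1 a s) = inverse a"
  using integral_gamma_weight[of 1 a] assms
  by (simp only: powr_minus powr_to_1 Gamma_1 mult_1 one_complex.sel zero_less_one)

lemma (in integral_weight) gamma_Fubini:
  assumes z: "Re z > 0" and c: "c > 0" and a: "continuous_on A a" "\<And>t. t \<in> A \<Longrightarrow> Re (a t) \<ge> c"
  shows "(LINT t:A|lborel. LINT y:{0<..}|lborel. w t * gamma_weight z (a t) y) =
    (LINT y:{0<..}|lborel. LINT t:A|lborel. w t * gamma_weight z (a t) y)"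
proof (rule set_integral_Fubini[OF borel_domain])
  have "continuous_on (A \<times> {0<..}) (\<lambda>p. w (fst p))" "continuous_on (A \<times> {0<..}) (\<lambda>p. a (fst p))"
    by (rule continuous_on_compose2[OF continuous continuous_on_fst[OF continuous_on_id]], force)
       (rule continuous_on_compose2[OF a(1) continuous_on_fst[OF continuous_on_id]], force)
  then show "continuous_on (A \<times> {0<..}) (\<lambda>p. w (fst p) * gamma_weight z (a (fst p)) (snd p))"
    unfolding gamma_weight_def by (intro continuous_intros) auto
  show "set_integrable lborel A (\<lambda>t. norm (w t) * (Gamma (Re z) * c powr (- Re z)))"
    by (intro set_integrable_mult_left norm_integrable)
  fix t assume "t \<in> A"
  then have Re_ge: "Re (a t) \<ge> c" by (rule a(2))
  then have Re_pos: "Re (a t) > 0" using c by simp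
  show "set_integrable lborel {0<..} (\<lambda>y. w t * gamma_weight z (a t) y)"
    by (intro set_integrable_mult_right integral_weight.integrable[OF integral_weight_gamma[OF z Re_pos]])
  have "Re (a t) powr (- Re z) \<le> c powr (- Re z)"
    using z c Re_ge by (intro powr_mono2') auto
  then show "(LINT y:{0<..}|lborel. norm (w t * gamma_weight z (a t) y)) \<le> norm (w t) * (Gamma (Re z) * c powr (- Re z))"
    using z by (simp only: norm_mult set_integral_mult_right integral_norm_gamma_weight[OF z Re_pos])
      (intro mult_left_mono, auto simp: Gamma_real_pos less_imp_le)
qed simp

lemma gamma_integral_real:
  fixes x a :: real
  assumes "x > 0" "a > 0"
  shows "set_integrable lborel {0<..} (\<lambda>t. t powr (x - 1) * exp (- (a * t)))"
    and "(LINT t:{0<..}|lborel. t powr (x - 1) * exp (- (a * t))) = Gamma x * a powr (- x)"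
proof -
  have eq: "norm (gamma_weight (of_real x) (of_real a) t) = t powr (x - 1) * exp (- (a * t))" if "t \<in> {0<..}" for t
    using that by (simp add: norm_gamma_weight)
  show "set_integrable lborel {0<..} (\<lambda>t. t powr (x - 1) * exp (- (a * t)))"
    using integral_weight.norm_integrable[OF integral_weight_gamma[of "of_real x" "of_real a"]] assms
    by (subst set_integrable_cong[OF refl refl eq[symmetric]]) auto
  have "(LINT t:{0<..}|lborel. t powr (x - 1) * exp (- (a * t))) =
      (LINT t:{0<..}|lborel. norm (gamma_weight (of_real x) (of_real a) t))"
    by (rule set_lebesgue_integral_cong) (simp_all add: eq)
  then show "(LINT t:{0<..}|lborel. t powr (x - 1) * exp (- (a * t))) = Gamma x * a powr (- x)"
    using integral_norm_gamma_weight[of "of_real x" "of_real a"] assms by simp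
qed

definition beta_weight :: "complex \<Rightarrow> complex \<Rightarrow> real \<Rightarrow> complex" where
  "beta_weight a b r = of_real r powr (a - 1) * of_real (1 - r) powr (b - 1)"

lemma norm_beta_weight:
  "r \<in> {0<..<1} \<Longrightarrow> norm (beta_weight a b r) = r powr (Re a - 1) * (1 - r) powr (Re b - 1)"
  using norm_of_real_powr[of "1 - r"] by (simp add: beta_weight_def norm_mult norm_of_real_powr)

lemma beta_weight_of_real:
  "r \<in> {0<..<1} \<Longrightarrow> beta_weight (of_real a) (of_real b) r = of_real (r powr (a - 1) * (1 - r) powr (b - 1))"
  using powr_of_real[of r "a - 1"] powr_of_real[of "1 - r" "b - 1"] by (simp add: beta_weight_def)

lemma of_real_mult_beta_weight:
  assumes "r \<in> {0<..<1}"
  shows "of_real (r * (1 - r)) * beta_weight a b r = beta_weight (a + 1) (b + 1) r"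
proof -
  have "complex_of_real (1 - r) \<noteq> 0" using assms by (simp only: of_real_eq_0_iff) simp
  then show ?thesis
    using assms powr_add[of "of_real r" 1 "a - 1"] powr_add[of "of_real (1 - r)" 1 "b - 1"]
    by (simp add: beta_weight_def)
qed

lemma continuous_on_beta_weight: "continuous_on {0<..<1} (beta_weight a b)"
  unfolding beta_weight_def by (intro continuous_intros) auto

lemma beta_integral_real:
  assumes "a > 0" "b > (0::real)"
  shows "set_integrable lborel {0<..<1} (\<lambda>t. t powr (a - 1) * (1 - t) powr (b - 1))"
    and "(LINT t:{0<..<1}|lborel. t powr (a - 1) * (1 - t) powr (b - 1)) = Beta a b"
proof -
  show "set_integrable lborel {0<..<1} (\<lambda>t. t powr (a - 1) * (1 - t) powr (b - 1))"
    by (rule set_integrable_subset[OF integrable_Beta[OF assms]]) auto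
  then show "(LINT t:{0<..<1}|lborel. t powr (a - 1) * (1 - t) powr (b - 1)) = Beta a b"
    using has_integral_Beta_real[OF assms]
    by (intro set_integral_has_integral) (simp_all add: has_integral_Icc_iff_Ioo)
qed

lemma
  assumes "Re a > 0" "Re b > 0"
  shows integral_weight_beta: "integral_weight {0<..<1} (beta_weight a b)"
    and integral_norm_beta_weight: "(LINT r:{0<..<1}|lborel. norm (beta_weight a b r)) = Beta (Re a) (Re b)"
proof -
  have "set_integrable lborel {0<..<1} (beta_weight a b)"
    by (rule set_integrable_bound_continuous[OF _ continuous_on_beta_weight beta_integral_real(1)[OF assms]])
       (simp_all add: norm_beta_weight)
  then show "integral_weight {0<..<1} (beta_weight a b)"
    by unfold_locales (simp_all add: continuous_on_beta_weight)
  have "(LINT r:{0<..<1}|lborel. norm (beta_weight a b r)) =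
      (LINT r:{0<..<1}|lborel. r powr (Re a - 1) * (1 - r) powr (Re b - 1))"
    by (rule set_lebesgue_integral_cong) (simp_all add: norm_beta_weight)
  then show "(LINT r:{0<..<1}|lborel. norm (beta_weight a b r)) = Beta (Re a) (Re b)"
    using beta_integral_real(2)[OF assms] by simp
qed

lemma beta_weight_integral_holomorphic:
  assumes U: "open U" and fg: "f holomorphic_on U" "g holomorphic_on U"
    and pos: "\<And>z. z \<in> U \<Longrightarrow> Re (f z) > 0 \<and> Re (g z) > 0"
    and F: "continuous_on {0<..<1} F" "\<And>r. r \<in> {0<..<1} \<Longrightarrow> norm (F r) \<le> C"
  shows "(\<lambda>z. LINT r:{0<..<1}|lborel. beta_weight (f z) (g z) r * F r) holomorphic_on U"
proof (rule holomorphic_on_set_lebesgue_integral[OF U])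
  fix z assume z: "z \<in> U"
  define \<delta> where "\<delta> = min (Re (f z)) (Re (g z)) / 2"
  have \<delta>: "\<delta> > 0" "\<delta> < Re (f z)" "\<delta> < Re (g z)"
    using pos[OF z] by (auto simp: \<delta>_def)
  have "continuous_on U (\<lambda>v. min (Re (f v)) (Re (g v)))"
    by (intro continuous_intros holomorphic_on_imp_continuous_on fg)
  then have "open (U \<inter> (\<lambda>v. min (Re (f v)) (Re (g v))) -` {\<delta><..})"
    using U open_greaterThan by (rule continuous_open_preimage)
  moreover have "z \<in> U \<inter> (\<lambda>v. min (Re (f v)) (Re (g v))) -` {\<delta><..}"
    using z \<delta> by simp
  ultimately obtain e where e: "e > 0" "ball z e \<subseteq> U \<inter> (\<lambda>v. min (Re (f v)) (Re (g v))) -` {\<delta><..}"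
    by (rule openE)
  have "norm (beta_weight (f v) (g v) r * F r) \<le> C * (r powr (\<delta> - 1) * (1 - r) powr (\<delta> - 1))"
    if "v \<in> ball z e" "r \<in> {0<..<1}" for v r
  proof -
    have "norm (beta_weight (f v) (g v) r) \<le> r powr (\<delta> - 1) * (1 - r) powr (\<delta> - 1)"
      unfolding norm_beta_weight[OF that(2)]
      using that e by (intro mult_mono powr_mono') (auto simp: subset_iff less_imp_le)
    then show ?thesis
      using F(2)[OF that(2)] unfolding norm_mult by (subst mult.commute) (intro mult_mono, auto)
  qed
  then show "\<exists>e>0. \<exists>h. set_integrable lborel {0<..<1} h \<and>
      (\<forall>v\<in>ball z e \<inter> U. \<forall>r\<in>{0<..<1}. norm (beta_weight (f v) (g v) r * F r) \<le> h r)"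
    using e(1) set_integrable_mult_right[OF beta_integral_real(1)[OF \<delta>(1,1)]] by blast
next
  show "(\<lambda>z. beta_weight (f z) (g z) r * F r) holomorphic_on U" if "r \<in> {0<..<1}" for r
  proof -
    have "complex_of_real (1 - r) \<notin> \<real>\<^sub>\<le>\<^sub>0" "complex_of_real r \<notin> \<real>\<^sub>\<le>\<^sub>0"
      using that by (intro notin_nonpos_Reals_Re; simp)+
    then show ?thesis
      unfolding beta_weight_def by (intro holomorphic_intros fg)
  qed
qed (auto intro!: continuous_intros continuous_on_beta_weight F)

lemma integral_beta_weight:
  assumes a: "Re a > 0" and b: "Re b > 0"
  shows "(LINT r:{0<..<1}|lborel. beta_weight a b r) = Beta a b"
proof -
  let ?R = "{z::complex. Re z > 0}"
  have R: "open ?R" "connected ?R" "complex_of_real ` {0<..<1} \<subseteq> ?R"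
    by (auto intro!: open_halfspace_Re_gt convex_connected convex_halfspace_Re_gt)
  have hol: "(\<lambda>x. LINT r:{0<..<1}|lborel. beta_weight (f x) (g x) r) holomorphic_on ?R"
    if "f holomorphic_on ?R" "g holomorphic_on ?R" "\<And>x. x \<in> ?R \<Longrightarrow> Re (f x) > 0 \<and> Re (g x) > 0" for f g
    using beta_weight_integral_holomorphic[OF R(1) that, of "\<lambda>_. 1" 1] by simp
  have real: "(LINT r:{0<..<1}|lborel. beta_weight (of_real x) (of_real y) r) = Beta (of_real x) (of_real y)"
    if "x > 0" "y > 0" for x y
  proof -
    have "(LINT r:{0<..<1}|lborel. beta_weight (of_real x) (of_real y) r) =
        (LINT r:{0<..<1}|lborel. of_real (r powr (x - 1) * (1 - r) powr (y - 1)))"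
      by (rule set_lebesgue_integral_cong) (simp_all add: beta_weight_of_real)
    then show ?thesis
      by (simp only: set_integral_complex_of_real beta_integral_real(2)[OF that] Beta_complex_of_real)
  qed
  have "(LINT r:{0<..<1}|lborel. beta_weight x (of_real y) r) = Beta x (of_real y)" if "Re x > 0" "y > 0" for x y
    by (rule analytic_continuation_from_reals[OF hol _ R(1,2) zero_less_one R(3)])
       (use that in \<open>auto intro!: holomorphic_intros real notin_nonpos_Ints_Re\<close>)
  then show ?thesis
    by (intro analytic_continuation_from_reals[OF hol _ R(1,2) zero_less_one R(3), where g = "Beta a" and z = b])
       (use a b in \<open>auto intro!: holomorphic_intros notin_nonpos_Ints_Re\<close>)
qed

lemma image_frac_one_plus: "(\<lambda>s::real. s / (1 + s)) ` {0<..} = {0<..<1}"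
proof (intro equalityI subsetI)
  fix v :: real assume "v \<in> {0<..<1}"
  then show "v \<in> (\<lambda>s. s / (1 + s)) ` {0<..}"
    by (intro image_eqI[of _ _ "v / (1 - v)"]) (auto simp: field_simps)
qed (auto simp: field_simps)

lemma set_integral_frac_one_plus:
  fixes f k :: "real \<Rightarrow> 'b::euclidean_space"
  assumes "continuous_on {0<..<1} f" "set_integrable lborel {0<..<1} f"
    and "\<And>s. s > 0 \<Longrightarrow> k s = (1 / (1 + s)\<^sup>2) *\<^sub>R f (s / (1 + s))"
  shows "set_integrable lborel {0<..} k" and "(LINT s:{0<..}|lborel. k s) = (LINT r:{0<..<1}|lborel. f r)"
proof -
  have der: "((\<lambda>s. s / (1 + s)) has_field_derivative 1 / (1 + s)\<^sup>2) (at s)" if "s \<in> {0<..}" for s :: real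
    by (rule derivative_eq_intros refl)+ (use that in \<open>auto simp: field_simps power2_eq_square\<close>)
  have cont: "continuous_on {0<..} (\<lambda>s::real. 1 / (1 + s)\<^sup>2)"
    by (intro continuous_intros) auto
  have inj: "inj_on (\<lambda>s::real. s / (1 + s)) {0<..}"
    by (rule inj_onI) (auto simp: field_simps)
  note sub = set_integral_substitution[OF _ _ image_frac_one_plus inj der cont assms(1,2), of k]
  show "set_integrable lborel {0<..} k" "(LINT s:{0<..}|lborel. k s) = (LINT r:{0<..<1}|lborel. f r)"
    using sub assms(3) by simp_all
qed

lemma frac_one_plus_powr:
  assumes "s > (0::real)"
  shows "(s / (1 + s)) powr (a - 1) * (1 - s / (1 + s)) powr (b - 1) = s powr (a - 1) * (1 + s) powr (2 - (a + b))"
proof -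
  have "(1 + s) powr (2 - (a + b)) = inverse ((1 + s) powr (a - 1)) * inverse ((1 + s) powr (b - 1))"
    unfolding powr_minus[symmetric] powr_add[symmetric] by (simp add: algebra_simps)
  moreover have "1 - s / (1 + s) = inverse (1 + s)" using assms by (simp add: field_simps)
  ultimately show ?thesis using assms by (simp add: powr_divide inverse_powr divide_inverse powr_mult)
qed

lemma beta_prime_integral_real:
  assumes "a > 0" "b > (0::real)"
  shows "set_integrable lborel {0<..} (\<lambda>s. s powr (a - 1) * (1 + s) powr (- (a + b)))"
    and "(LINT s:{0<..}|lborel. s powr (a - 1) * (1 + s) powr (- (a + b))) = Beta a b"
proof -
  let ?f = "\<lambda>t::real. t powr (a - 1) * (1 - t) powr (b - 1)"
  have eq: "s powr (a - 1) * (1 + s) powr (- (a + b)) = (1 / (1 + s)\<^sup>2) *\<^sub>R ?f (s / (1 + s))" if s: "s > 0" for s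
  proof -
    have "(1 + s) powr (2 - (a + b)) = (1 + s)\<^sup>2 * (1 + s) powr (- (a + b))"
      using s by (simp only: powr_diff powr_minus_divide) (simp add: powr_numeral)
    then show ?thesis unfolding frac_one_plus_powr[OF s] using s by simp
  qed
  have "continuous_on {0<..<1} ?f" by (intro continuous_intros) auto
  note sub = set_integral_frac_one_plus[OF this beta_integral_real(1)[OF assms] eq]
  show "set_integrable lborel {0<..} (\<lambda>s. s powr (a - 1) * (1 + s) powr (- (a + b)))"
    "(LINT s:{0<..}|lborel. s powr (a - 1) * (1 + s) powr (- (a + b))) = Beta a b"
    using sub beta_integral_real(2)[OF assms] by simp_all
qed

definition beta_prime_weight :: "complex \<Rightarrow> complex \<Rightarrow> real \<Rightarrow> complex" where
  "beta_prime_weight a b s = of_real s powr (a - 1) * of_real (1 + s) powr (- (a + b))"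

lemma norm_beta_prime_weight:
  "s > 0 \<Longrightarrow> norm (beta_prime_weight a b s) = s powr (Re a - 1) * (1 + s) powr (- (Re a + Re b))"
  using norm_of_real_powr[of "1 + s"] by (simp add: beta_prime_weight_def norm_mult norm_of_real_powr)

lemma integral_weight_beta_prime:
  assumes "Re a > 0" "Re b > 0"
  shows "integral_weight {0<..} (beta_prime_weight a b)"
proof
  show cont: "continuous_on {0<..} (beta_prime_weight a b)"
    unfolding beta_prime_weight_def by (intro continuous_intros) (auto simp: complex_eq_iff)
  show "set_integrable lborel {0<..} (beta_prime_weight a b)"
    by (rule set_integrable_bound_continuous[OF _ cont beta_prime_integral_real(1)[OF assms]])
       (simp_all add: norm_beta_prime_weight)
qed simp

section \<open>The terminant\<close>

lemma chi_integral:
  assumes p: "p > 0"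
  shows "set_integrable lborel {0<..} (\<lambda>y. (1 + y\<^sup>2) powr (- ((p + 1) / 2)))"
    and "(LINT y:{0<..}|lborel. (1 + y\<^sup>2) powr (- ((p + 1) / 2))) = chi p / p"
proof -
  let ?f = "\<lambda>s::real. s powr (1/2 - 1) * (1 + s) powr (- (1/2 + p/2))"
  let ?k = "\<lambda>y::real. 2 * (1 + y\<^sup>2) powr (- ((p + 1) / 2))"
  have im: "power2 ` {0::real<..} = {0<..}"
  proof (intro equalityI subsetI)
    fix s :: real assume "s \<in> {0<..}"
    then show "s \<in> power2 ` {0<..}" by (intro image_eqI[of _ _ "sqrt s"]) auto
  qed auto
  have inj: "inj_on power2 {0::real<..}"
    by (rule inj_onI) (simp add: power2_eq_iff_nonneg)
  have der: "(power2 has_field_derivative 2 * y) (at y)" for y :: real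
    by (auto intro!: derivative_eq_intros)
  have cont: "continuous_on {0<..} ?f"
    by (intro continuous_intros) auto
  have eq: "?k y = \<bar>2 * y\<bar> *\<^sub>R ?f (y\<^sup>2)" if y: "y \<in> {0<..}" for y
  proof -
    have "1/2 - 1 = - (1/2 :: real)" by simp
    then have "(y\<^sup>2) powr (1/2 - 1) = inverse y"
      using y by (simp only: powr_minus) (simp add: powr_half_sqrt)
    then show ?thesis using y by (simp add: field_simps)
  qed
  note beta = beta_prime_integral_real[of "1/2" "p/2"]
  note sub = set_integral_substitution[OF _ _ im inj der _ cont, of ?k]
  have k: "set_integrable lborel {0<..} ?k" "(LINT y:{0<..}|lborel. ?k y) = Beta (1/2) (p/2)"
    using sub beta p eq by (auto intro!: continuous_intros)
  then show "set_integrable lborel {0<..} (\<lambda>y. (1 + y\<^sup>2) powr (- ((p + 1) / 2)))"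
    by simp
  have "Gamma (p / 2 + 1) = p / 2 * Gamma (p / 2)"
    using p by (intro Gamma_plus1 pos_notin_nonpos_Ints) simp
  then have "Beta (1/2) (p/2) / 2 = chi p / p"
    unfolding Beta_def chi_def by (simp only:) (use p in \<open>simp add: Gamma_one_half_real add.commute[of "1/2"]\<close>)
  then show "(LINT y:{0<..}|lborel. (1 + y\<^sup>2) powr (- ((p + 1) / 2))) = chi p / p"
    using k(2) by (simp only: set_integral_mult_right)
qed

lemma norm_one_plus_mult_ge_1:
  assumes "Re q \<ge> 0" "u \<ge> 0"
  shows "norm (1 + of_real u * q) \<ge> 1"
  using complex_Re_le_cmod[of "1 + of_real u * q"] mult_nonneg_nonneg[OF assms(2,1)] by simp

lemma norm_one_plus_mult_ge_Im:
  assumes "Im q \<noteq> 0"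
  shows "norm (1 + of_real u * q) \<ge> \<bar>Im q\<bar> / norm q"
proof -
  have q: "q \<noteq> 0" using assms by auto
  have "\<bar>Im q\<bar> = \<bar>Im ((1 + of_real u * q) * cnj q)\<bar>"
    by (simp add: algebra_simps)
  also have "\<dots> \<le> norm ((1 + of_real u * q) * cnj q)" by (rule abs_Im_le_cmod)
  finally have "\<bar>Im q\<bar> \<le> norm (1 + of_real u * q) * norm q" by (simp only: norm_mult complex_mod_cnj)
  then show ?thesis using q by (simp add: pos_divide_le_eq)
qed

lemma one_plus_mult_notin_nonpos_Reals:
  fixes q :: complex
  assumes "q \<notin> \<real>\<^sub>\<le>\<^sub>0" "u \<ge> 0"
  shows "1 + of_real u * q \<notin> \<real>\<^sub>\<le>\<^sub>0"
proof (cases "u = 0")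
  case False
  then have "u > 0" using assms by simp
  then have "0 < Re q \<Longrightarrow> 0 < 1 + u * Re q" by (simp add: add_pos_pos)
  with \<open>u > 0\<close> assms show ?thesis
    by (auto simp: complex_nonpos_Reals_iff not_le)
qed simp

lemma one_plus_mult_nonzero:
  fixes q :: complex
  assumes "q \<notin> \<real>\<^sub>\<le>\<^sub>0" "u \<ge> 0"
  shows "1 + of_real u * q \<noteq> 0"
  using one_plus_mult_notin_nonpos_Reals[OF assms] by auto

lemma one_plus_mult_locally_bounded_below:
  fixes q :: complex
  assumes "q \<notin> \<real>\<^sub>\<le>\<^sub>0"
  obtains e d where "e > 0" "d > 0" "\<And>w u. w \<in> ball q e \<Longrightarrow> u \<ge> 0 \<Longrightarrow> norm (1 + of_real u * w) \<ge> d"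
proof (cases "Im q = 0")
  case True
  then have "Re q > 0" using assms by (auto simp: complex_nonpos_Reals_iff)
  moreover have "Re w \<ge> 0" if "w \<in> ball q (Re q)" for w
    using that abs_Re_le_cmod[of "q - w"] by (simp add: dist_norm)
  ultimately show ?thesis
    using that[of "Re q" 1] norm_one_plus_mult_ge_1 by auto
next
  case False
  let ?e = "\<bar>Im q\<bar> / 2"
  have "norm (1 + of_real u * w) \<ge> ?e / (norm q + ?e)" if "w \<in> ball q ?e" for w u
  proof -
    have n: "norm (q - w) < ?e" using that by (simp add: dist_norm)
    have "\<bar>Im w\<bar> \<ge> ?e" using n abs_Im_le_cmod[of "q - w"] by simp
    moreover from this False have w: "Im w \<noteq> 0" by auto
    moreover have "norm w \<le> norm q + ?e" using n norm_triangle_ineq3[of q w] by simp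
    ultimately have "?e / (norm q + ?e) \<le> \<bar>Im w\<bar> / norm w"
      by (intro frac_le) auto
    also have "\<dots> \<le> norm (1 + of_real u * w)" by (rule norm_one_plus_mult_ge_Im[OF w])
    finally show ?thesis .
  qed
  then show ?thesis using that[of ?e "?e / (norm q + ?e)"] False by (auto simp: add_nonneg_pos)
qed

definition terminant :: "real \<Rightarrow> complex \<Rightarrow> complex" where
  "terminant p q = (LINT u:{0<..}|lborel. gamma_weight (of_real p) 1 u * inverse (1 + of_real u * q))"

lemma terminant_kernel_continuous:
  assumes "q \<notin> \<real>\<^sub>\<le>\<^sub>0"
  shows "continuous_on {0<..} (\<lambda>u. inverse (1 + complex_of_real u * q))"
  by (intro continuous_intros) (use one_plus_mult_nonzero[OF assms] in auto)

lemma
  assumes "p > 0"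
  shows integral_weight_terminant: "integral_weight {0<..} (gamma_weight (of_real p) 1)"
    and integral_norm_terminant_weight: "(LINT u:{0<..}|lborel. norm (gamma_weight (of_real p) 1 u)) = Gamma p"
    and integral_terminant_weight: "(LINT u:{0<..}|lborel. gamma_weight (of_real p) 1 u) = of_real (Gamma p)"
  using integral_weight_gamma[of "of_real p" 1] integral_norm_gamma_weight[of "of_real p" 1]
    integral_gamma_weight[of "of_real p" 1] assms
  by (simp_all add: Gamma_complex_of_real)

lemma terminant_integrable:
  assumes "p > 0" "q \<notin> \<real>\<^sub>\<le>\<^sub>0"
  shows "set_integrable lborel {0<..} (\<lambda>u. gamma_weight (of_real p) 1 u * inverse (1 + of_real u * q))"
proof -
  obtain e d where "e > 0" "d > 0" and d: "\<And>w u. w \<in> ball q e \<Longrightarrow> u \<ge> 0 \<Longrightarrow> norm (1 + of_real u * w) \<ge> d"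
    by (rule one_plus_mult_locally_bounded_below[OF assms(2)]) blast
  then have "norm (inverse (1 + of_real u * q)) \<le> inverse d" if "u \<in> {0<..}" for u
    using d[of q u] that by (simp add: norm_inverse le_imp_inverse_le)
  then show ?thesis
    by (rule integral_weight.mult_integrable[OF integral_weight_terminant[OF assms(1)]
      terminant_kernel_continuous[OF assms(2)]])
qed

lemma norm_terminant_le:
  assumes p: "p > 0" and d: "d > 0" "\<And>u. u > 0 \<Longrightarrow> norm (1 + of_real u * q) \<ge> d"
  shows "norm (terminant p q) \<le> Gamma p / d"
proof -
  have "norm (inverse (1 + of_real u * q)) \<le> inverse d" if "u \<in> {0<..}" for u
    using d that by (simp add: norm_inverse le_imp_inverse_le)
  then have "norm (terminant p q) \<le> (LINT u:{0<..}|lborel. norm (gamma_weight (of_real p) 1 u)) * inverse d"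
    unfolding terminant_def by (rule integral_weight.norm_integral_le[OF integral_weight_terminant[OF p]])
  then show ?thesis by (simp add: integral_norm_terminant_weight[OF p] divide_inverse)
qed

lemma norm_terminant_le_Gamma:
  assumes "p > 0" "Re q \<ge> 0"
  shows "norm (terminant p q) \<le> Gamma p"
  using norm_terminant_le[of p 1 q] norm_one_plus_mult_ge_1[OF assms(2)] assms(1) by simp

lemma norm_terminant_le_Im:
  assumes "p > 0" "Im q \<noteq> 0"
  shows "norm (terminant p q) \<le> Gamma p * (norm q / \<bar>Im q\<bar>)"
proof -
  have "q \<noteq> 0" using assms(2) by auto
  then have "\<bar>Im q\<bar> / norm q > 0" using assms(2) by simp
  from norm_terminant_le[OF assms(1) this, of q] norm_one_plus_mult_ge_Im[OF assms(2)] show ?thesis by simp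
qed

lemma terminant_holomorphic:
  assumes "p > 0"
  shows "terminant p holomorphic_on - \<real>\<^sub>\<le>\<^sub>0"
proof -
  have "(\<lambda>q. LINT u:{0<..}|lborel. gamma_weight (of_real p) 1 u * inverse (1 + of_real u * q)) holomorphic_on - \<real>\<^sub>\<le>\<^sub>0"
  proof (rule integral_weight.integral_holomorphic[OF integral_weight_terminant[OF assms]])
    fix q :: complex assume "q \<in> - \<real>\<^sub>\<le>\<^sub>0"
    then have q: "q \<notin> \<real>\<^sub>\<le>\<^sub>0" by simp
    show "continuous_on {0<..} (\<lambda>u. inverse (1 + complex_of_real u * q))"
      by (rule terminant_kernel_continuous[OF q])
    obtain e d where e: "e > 0" "d > 0" and d: "\<And>w u. w \<in> ball q e \<Longrightarrow> u \<ge> 0 \<Longrightarrow> norm (1 + of_real u * w) \<ge> d"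
      by (rule one_plus_mult_locally_bounded_below[OF q]) blast
    then have "\<forall>w\<in>ball q e \<inter> - \<real>\<^sub>\<le>\<^sub>0. \<forall>u\<in>{0<..}. norm (inverse (1 + complex_of_real u * w)) \<le> inverse d"
      by (auto simp: norm_inverse intro!: le_imp_inverse_le)
    with e show "\<exists>e>0. \<exists>C. \<forall>w\<in>ball q e \<inter> - \<real>\<^sub>\<le>\<^sub>0. \<forall>u\<in>{0<..}. norm (inverse (1 + complex_of_real u * w)) \<le> C"
      by blast
  next
    fix u :: real assume "u \<in> {0<..}"
    then show "(\<lambda>q. inverse (1 + of_real u * q)) holomorphic_on - \<real>\<^sub>\<le>\<^sub>0"
      by (intro holomorphic_intros) (use one_plus_mult_nonzero[of _ u] in auto)
  qed auto
  then show ?thesis unfolding terminant_def .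
qed

lemma terminant_plus1:
  assumes p: "p > 0" and q: "q \<notin> \<real>\<^sub>\<le>\<^sub>0"
  shows "terminant p q = of_real (Gamma p) - q * terminant (p + 1) q"
proof -
  let ?w = "gamma_weight (of_real p) 1"
  let ?f = "\<lambda>u. gamma_weight (of_real (p + 1)) 1 u * inverse (1 + of_real u * q)"
  have "terminant p q = (LINT u:{0<..}|lborel. ?w u - q * ?f u)"
    unfolding terminant_def
  proof (intro set_lebesgue_integral_cong allI impI)
    fix u :: real assume u: "u \<in> {0<..}"
    then have "gamma_weight (of_real (p + 1)) 1 u = of_real u * ?w u"
      by (simp add: of_real_mult_gamma_weight)
    then show "?w u * inverse (1 + of_real u * q) = ?w u - q * ?f u"
      using one_plus_mult_nonzero[OF q, of u] u by (simp add: field_simps)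
  qed simp
  also have "\<dots> = (LINT u:{0<..}|lborel. ?w u) - (LINT u:{0<..}|lborel. q * ?f u)"
    using p q integral_weight.integrable[OF integral_weight_terminant[OF p]]
    by (intro set_integral_diff(2) set_integrable_mult_right terminant_integrable) auto
  finally show ?thesis
    by (simp only: set_integral_mult_right integral_terminant_weight[OF p] terminant_def)
qed

lemma terminant_cnj:
  assumes "p > 0"
  shows "terminant p (cnj q) = cnj (terminant p q)"
proof -
  have "terminant p (cnj q) = (LINT u:{0<..}|lborel.
      cnj (gamma_weight (of_real p) 1 u * inverse (1 + of_real u * q)))"
    unfolding terminant_def using gamma_weight_of_real[of _ p 1] by (intro set_lebesgue_integral_cong) simp_all
  then show ?thesis
    unfolding terminant_def set_lebesgue_integral_def by (subst Bochner_Integration.integral_cnj[symmetric]) simp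
qed

text \<open>Writing \<open>1 / (1/q + u)\<close> as a Laplace integral and integrating over \<open>u\<close> first leaves an
  integrand of modulus at most \<open>(1 + y\<^sup>2) powr (- (p + 1) / 2)\<close>, uniformly in \<open>q\<close>.\<close>

lemma terminant_kernel_Laplace:
  assumes q: "Im q < 0"
  shows "q * inverse (1 + of_real u * q) = - \<i> * (LINT y:{0<..}|lborel. gamma_weight 1 (- \<i> * (1 / q + of_real u)) y)"
proof -
  have q0: "q \<noteq> 0" using q by auto
  have "Im (1 / q) > 0" using q by (simp add: Im_divide field_simps sum_power2_gt_zero_iff)
  then have Re_pos: "Re (- \<i> * (1 / q + of_real u)) > 0" by simp
  have "- \<i> * inverse (- \<i> * (1 / q + of_real u)) = (- \<i> * inverse (- \<i>)) * inverse (1 / q + of_real u)"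
    by (simp only: inverse_mult_distrib mult_ac)
  also have "\<dots> = q * inverse (q * (1 / q + of_real u))"
    using q0 by simp
  also have "q * (1 / q + of_real u) = 1 + of_real u * q"
    using q0 by (simp add: field_simps)
  finally show ?thesis
    unfolding integral_gamma_weight_1[OF Re_pos] by (rule sym)
qed

lemma terminant_Laplace:
  assumes p: "p > 0" and q: "Im q < 0"
  shows "q * terminant (p + 1) q =
    - \<i> * (LINT y:{0<..}|lborel. Gamma (of_real (p + 1)) *
        (exp (\<i> * of_real y / q) * (1 - \<i> * of_real y) powr (- of_real (p + 1))))"
proof -
  let ?w = "gamma_weight (of_real (p + 1)) 1"
  let ?a = "\<lambda>u. - \<i> * (1 / q + of_real u)"
  let ?f = "\<lambda>u y. ?w u * gamma_weight 1 (?a u) y"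
  have Im_inverse: "Im (1 / q) > 0" using q by (simp add: Im_divide field_simps sum_power2_gt_zero_iff)
  have "q * terminant (p + 1) q = (LINT u:{0<..}|lborel. ?w u * (q * inverse (1 + of_real u * q)))"
    unfolding terminant_def set_integral_mult_right[symmetric] by (simp only: mult_ac)
  also have "\<dots> = - \<i> * (LINT u:{0<..}|lborel. LINT y:{0<..}|lborel. ?f u y)"
    by (simp only: terminant_kernel_Laplace[OF q] set_integral_mult_right mult.left_commute[of _ "- \<i>"])
  also have "(LINT u:{0<..}|lborel. LINT y:{0<..}|lborel. ?f u y) =
      (LINT y:{0<..}|lborel. LINT u:{0<..}|lborel. ?f u y)"
    by (rule integral_weight.gamma_Fubini[OF integral_weight_terminant, where c = "Im (1 / q)"])
       (use p Im_inverse in \<open>auto intro!: continuous_intros\<close>)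
  also have "\<dots> = (LINT y:{0<..}|lborel. Gamma (of_real (p + 1)) *
      (exp (\<i> * of_real y / q) * (1 - \<i> * of_real y) powr (- of_real (p + 1))))"
  proof (intro set_lebesgue_integral_cong allI impI)
    fix y :: real assume y: "y \<in> {0<..}"
    have "?f u y = exp (\<i> * of_real y / q) * gamma_weight (of_real (p + 1)) (1 - \<i> * of_real y) u" for u
      using y by (simp add: gamma_weight_def exp_add[symmetric] exp_diff[symmetric] algebra_simps divide_inverse)
    then show "(LINT u:{0<..}|lborel. ?f u y) =
        Gamma (of_real (p + 1)) * (exp (\<i> * of_real y / q) * (1 - \<i> * of_real y) powr (- of_real (p + 1)))"
      using integral_gamma_weight[of "of_real (p + 1)" "1 - \<i> * of_real y"] p
      by (simp only: set_integral_mult_right) simp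
  qed simp
  finally show ?thesis .
qed

lemma terminant_Laplace_transform:
  assumes p: "p > 0" and q: "Re q \<ge> 0"
  shows "terminant p q =
    (LINT s:{0<..}|lborel. gamma_weight 1 1 s * (of_real (Gamma p) * (1 + of_real s * q) powr (- of_real p)))"
proof -
  let ?w = "gamma_weight (of_real p) 1"
  let ?f = "\<lambda>u s. ?w u * gamma_weight 1 (1 + of_real u * q) s"
  have Re_pos: "Re (1 + of_real u * q) > 0" if "u > 0" for u
    using that q by (simp add: add_pos_nonneg)
  have "terminant p q = (LINT u:{0<..}|lborel. LINT s:{0<..}|lborel. ?f u s)"
    unfolding terminant_def
    by (intro set_lebesgue_integral_cong allI impI)
       (simp, simp only: set_integral_mult_right integral_gamma_weight_1[OF Re_pos] greaterThan_iff)
  also have "\<dots> = (LINT s:{0<..}|lborel. LINT u:{0<..}|lborel. ?f u s)"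
    by (rule integral_weight.gamma_Fubini[OF integral_weight_terminant, where c = 1])
       (use p q in \<open>auto intro!: continuous_intros\<close>)
  also have "\<dots> = (LINT s:{0<..}|lborel. gamma_weight 1 1 s *
      (of_real (Gamma p) * (1 + of_real s * q) powr (- of_real p)))"
  proof (intro set_lebesgue_integral_cong allI impI)
    fix s :: real assume s: "s \<in> {0<..}"
    have "?f u s = gamma_weight 1 1 s * gamma_weight (of_real p) (1 + of_real s * q) u" for u
      using s by (simp add: gamma_weight_def exp_add[symmetric] exp_diff[symmetric] algebra_simps)
    then show "(LINT u:{0<..}|lborel. ?f u s) =
        gamma_weight 1 1 s * (of_real (Gamma p) * (1 + of_real s * q) powr (- of_real p))"
      using integral_gamma_weight[of "of_real p" "1 + of_real s * q"] p Re_pos[of s] s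
      by (simp only: set_integral_mult_right) (simp add: Gamma_complex_of_real)
  qed simp
  finally show ?thesis .
qed

lemma chi_nonneg: "p > 0 \<Longrightarrow> chi p \<ge> 0"
  unfolding chi_def by (simp add: Gamma_real_pos less_imp_le)

definition terminant_bound :: "real \<Rightarrow> real" where
  "terminant_bound p = Gamma p * (1 + chi p)"

lemma Gamma_le_terminant_bound: "p > 0 \<Longrightarrow> Gamma p \<le> terminant_bound p"
  using chi_nonneg[of p] by (simp add: terminant_bound_def algebra_simps Gamma_real_pos less_imp_le)

lemma terminant_bound_nonneg: "p > 0 \<Longrightarrow> terminant_bound p \<ge> 0"
  using Gamma_le_terminant_bound[of p] Gamma_real_pos[of p] by linarith

lemma norm_terminant_le_chi_lower:
  assumes p: "p > 0" and q: "Im q < 0"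
  shows "norm (terminant p q) \<le> terminant_bound p"
proof -
  have bound: "norm (Gamma (of_real (p + 1)) *
      (exp (\<i> * of_real y / q) * (1 - \<i> * of_real y) powr (- of_real (p + 1))))
      \<le> Gamma (p + 1) * (1 + y\<^sup>2) powr (- ((p + 1) / 2))" if y: "y \<in> {0<..}" for y
  proof -
    have "norm (exp (\<i> * of_real y / q)) \<le> 1"
      using y q by (simp add: Re_divide zero_le_divide_iff divide_le_0_iff mult_le_0_iff)
    moreover have "norm ((1 - \<i> * of_real y) powr (- complex_of_real (p + 1))) = (1 + y\<^sup>2) powr (- ((p + 1) / 2))"
      by (subst norm_powr_real_powr') (auto simp: cmod_def powr_half_sqrt[symmetric] powr_powr minus_divide_left)
    moreover have "norm (Gamma (complex_of_real (p + 1))) = Gamma (p + 1)"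
      using p by (subst Gamma_complex_of_real) (simp add: Gamma_real_pos less_imp_le)
    ultimately show ?thesis
      using p by (simp only: norm_mult)
        (intro mult_left_mono mult_left_le_one_le, auto simp: Gamma_real_pos less_imp_le)
  qed
  have "norm (q * terminant (p + 1) q) \<le> (LINT y:{0<..}|lborel. Gamma (p + 1) * (1 + y\<^sup>2) powr (- ((p + 1) / 2)))"
    unfolding terminant_Laplace[OF p q] norm_mult[of "- \<i>"]
    using set_integral_norm_bound_le[OF set_integrable_mult_right[OF chi_integral(1)[OF p]] bound] by simp
  also have "\<dots> = Gamma p * chi p"
  proof -
    have "Gamma (p + 1) = p * Gamma p"
      using p by (intro Gamma_plus1 pos_notin_nonpos_Ints)
    then show ?thesis
      using p by (simp only: set_integral_mult_right chi_integral(2)[OF p]) simp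
  qed
  finally have "norm (q * terminant (p + 1) q) \<le> Gamma p * chi p" .
  moreover have "q \<notin> \<real>\<^sub>\<le>\<^sub>0" using q by (auto simp: complex_nonpos_Reals_iff)
  from terminant_plus1[OF p this]
  have "norm (terminant p q) \<le> norm (complex_of_real (Gamma p)) + norm (q * terminant (p + 1) q)"
    by (simp only: norm_triangle_ineq4)
  ultimately show ?thesis
    using p by (simp add: terminant_bound_def algebra_simps Gamma_real_pos less_imp_le)
qed

lemma norm_terminant_le_chi:
  assumes p: "p > 0" and "q \<notin> \<real>\<^sub>\<le>\<^sub>0"
  shows "norm (terminant p q) \<le> terminant_bound p"
proof -
  consider (lower) "Im q < 0" | (upper) "Im q > 0" | (right) "Re q \<ge> 0"
    using assms by (force simp: complex_nonpos_Reals_iff)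
  then show ?thesis
  proof cases
    case lower
    then show ?thesis by (rule norm_terminant_le_chi_lower[OF p])
  next
    case upper
    then show ?thesis
      using norm_terminant_le_chi_lower[OF p, of "cnj q"] by (simp add: terminant_cnj[OF p])
  next
    case right
    then show ?thesis
      using norm_terminant_le_Gamma[OF p] Gamma_le_terminant_bound[OF p] by (meson order_trans)
  qed
qed

section \<open>The remainder function\<close>

lemma of_real_mult_notin_nonpos_Reals:
  assumes "y \<notin> \<real>\<^sub>\<le>\<^sub>0" "c > 0"
  shows "complex_of_real c * y \<notin> \<real>\<^sub>\<le>\<^sub>0"
  using assms by (auto simp: complex_nonpos_Reals_iff mult_le_0_iff)

lemma divide_of_real_notin_nonpos_Reals:
  assumes "x \<notin> \<real>\<^sub>\<le>\<^sub>0" "t > 0"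
  shows "x / complex_of_real t \<notin> \<real>\<^sub>\<le>\<^sub>0"
  using of_real_mult_notin_nonpos_Reals[OF assms(1), of "1 / t"] assms(2) by simp

definition terminant_beta :: "real \<Rightarrow> complex \<Rightarrow> complex \<Rightarrow> complex" where
  "terminant_beta p \<mu> y = (LINT r:{0<..<1}|lborel.
     beta_weight (of_real p + \<mu>) (of_real p - \<mu>) r * terminant p (of_real (2 * r * (1 - r)) * y))"

lemma
  assumes "\<bar>Re \<mu>\<bar> < p"
  shows integral_weight_terminant_beta: "integral_weight {0<..<1} (beta_weight (of_real p + \<mu>) (of_real p - \<mu>))"
    and integral_norm_terminant_beta_weight: "(LINT r:{0<..<1}|lborel.
        norm (beta_weight (of_real p + \<mu>) (of_real p - \<mu>) r)) = Beta (p + Re \<mu>) (p - Re \<mu>)"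
    and integral_terminant_beta_weight: "(LINT r:{0<..<1}|lborel.
        beta_weight (of_real p + \<mu>) (of_real p - \<mu>) r) = Beta (of_real p + \<mu>) (of_real p - \<mu>)"
proof -
  have "Re (of_real p + \<mu>) > 0" "Re (of_real p - \<mu>) > 0"
    using assms by auto
  from integral_weight_beta[OF this] integral_norm_beta_weight[OF this] integral_beta_weight[OF this]
  show "integral_weight {0<..<1} (beta_weight (of_real p + \<mu>) (of_real p - \<mu>))"
    "(LINT r:{0<..<1}|lborel. norm (beta_weight (of_real p + \<mu>) (of_real p - \<mu>) r)) = Beta (p + Re \<mu>) (p - Re \<mu>)"
    "(LINT r:{0<..<1}|lborel. beta_weight (of_real p + \<mu>) (of_real p - \<mu>) r) = Beta (of_real p + \<mu>) (of_real p - \<mu>)"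
    by simp_all
qed

lemma terminant_beta_kernel_continuous:
  assumes "p > 0" "y \<notin> \<real>\<^sub>\<le>\<^sub>0"
  shows "continuous_on {0<..<1} (\<lambda>r. terminant p (of_real (2 * r * (1 - r)) * y))"
  by (rule continuous_on_compose2[OF holomorphic_on_imp_continuous_on[OF terminant_holomorphic[OF assms(1)]]])
     (use of_real_mult_notin_nonpos_Reals[OF assms(2), of "2 * _ * (1 - _)"] in \<open>auto intro!: continuous_intros\<close>)

lemma norm_terminant_beta_kernel_le:
  assumes "p > 0" "y \<notin> \<real>\<^sub>\<le>\<^sub>0" "r \<in> {0<..<1}"
  shows "norm (terminant p (of_real (2 * r * (1 - r)) * y)) \<le> terminant_bound p"
  by (intro norm_terminant_le_chi of_real_mult_notin_nonpos_Reals) (use assms in auto)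

lemma terminant_beta_integrable:
  assumes "\<bar>Re \<mu>\<bar> < p" "y \<notin> \<real>\<^sub>\<le>\<^sub>0"
  shows "set_integrable lborel {0<..<1}
    (\<lambda>r. beta_weight (of_real p + \<mu>) (of_real p - \<mu>) r * terminant p (of_real (2 * r * (1 - r)) * y))"
  by (rule integral_weight.mult_integrable[OF integral_weight_terminant_beta[OF assms(1)]
        terminant_beta_kernel_continuous[OF _ assms(2)] norm_terminant_beta_kernel_le[OF _ assms(2)]])
     (use assms(1) in auto)

lemma norm_terminant_beta_le:
  assumes "\<bar>Re \<mu>\<bar> < p" and B: "\<And>c. c > 0 \<Longrightarrow> norm (terminant p (of_real c * y)) \<le> B"
  shows "norm (terminant_beta p \<mu> y) \<le> Beta (p + Re \<mu>) (p - Re \<mu>) * B"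
  unfolding terminant_beta_def integral_norm_terminant_beta_weight[OF assms(1), symmetric]
  by (intro integral_weight.norm_integral_le integral_weight_terminant_beta assms) auto

lemma terminant_beta_holomorphic:
  assumes "\<bar>Re \<mu>\<bar> < p"
  shows "terminant_beta p \<mu> holomorphic_on - \<real>\<^sub>\<le>\<^sub>0"
proof -
  have p: "p > 0" using assms by simp
  have "(\<lambda>y. LINT r:{0<..<1}|lborel. beta_weight (of_real p + \<mu>) (of_real p - \<mu>) r *
      terminant p (of_real (2 * r * (1 - r)) * y)) holomorphic_on - \<real>\<^sub>\<le>\<^sub>0"
  proof (rule integral_weight.integral_holomorphic[OF integral_weight_terminant_beta[OF assms]])
    fix r :: real assume r: "r \<in> {0<..<1}"
    show "(\<lambda>y. terminant p (of_real (2 * r * (1 - r)) * y)) holomorphic_on - \<real>\<^sub>\<le>\<^sub>0"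
      by (rule holomorphic_on_compose_gen[OF _ terminant_holomorphic[OF p], unfolded o_def])
         (use of_real_mult_notin_nonpos_Reals[of _ "2 * r * (1 - r)"] r in \<open>auto intro!: holomorphic_intros\<close>)
  next
    show "\<exists>e>0. \<exists>C. \<forall>v\<in>ball y e \<inter> - \<real>\<^sub>\<le>\<^sub>0. \<forall>r\<in>{0<..<1}. norm (terminant p (of_real (2 * r * (1 - r)) * v)) \<le> C" for y
      by (intro exI[of _ 1] exI[of _ "terminant_bound p"] conjI ballI norm_terminant_beta_kernel_le p) auto
  qed (rule open_Compl[OF closed_nonpos_Reals_complex], rule terminant_beta_kernel_continuous[OF p], rule ComplD)
  then show ?thesis unfolding terminant_beta_def .
qed

lemma terminant_beta_holomorphic_order:
  assumes p: "p > 0" and y: "y \<notin> \<real>\<^sub>\<le>\<^sub>0"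
  shows "(\<lambda>\<mu>. terminant_beta p \<mu> y) holomorphic_on {\<mu>. \<bar>Re \<mu>\<bar> < p}"
  unfolding terminant_beta_def
proof (rule beta_weight_integral_holomorphic)
  show "open {\<mu>. \<bar>Re \<mu>\<bar> < p}"
    by (intro open_Collect_less continuous_intros)
  show "continuous_on {0<..<1} (\<lambda>r. terminant p (of_real (2 * r * (1 - r)) * y))"
    by (rule terminant_beta_kernel_continuous[OF p y])
  show "norm (terminant p (of_real (2 * r * (1 - r)) * y)) \<le> terminant_bound p" if "r \<in> {0<..<1}" for r
    by (rule norm_terminant_beta_kernel_le[OF p y that])
qed (auto intro!: holomorphic_intros)

lemma terminant_beta_plus1:
  assumes \<mu>: "\<bar>Re \<mu>\<bar> < p" and y: "y \<notin> \<real>\<^sub>\<le>\<^sub>0"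
  shows "terminant_beta p \<mu> y =
    of_real (Gamma p) * Beta (of_real p + \<mu>) (of_real p - \<mu>) - 2 * y * terminant_beta (p + 1) \<mu> y"
proof -
  have p: "p > 0" using \<mu> by simp
  let ?w = "\<lambda>p. beta_weight (of_real p + \<mu>) (of_real p - \<mu>)"
  let ?f = "\<lambda>p r. ?w p r * terminant p (of_real (2 * r * (1 - r)) * y)"
  have "terminant_beta p \<mu> y = (LINT r:{0<..<1}|lborel. of_real (Gamma p) * ?w p r - 2 * y * ?f (p + 1) r)"
    unfolding terminant_beta_def
  proof (intro set_lebesgue_integral_cong allI impI)
    fix r :: real assume r: "r \<in> {0<..<1}"
    define c where "c = complex_of_real (r * (1 - r))"
    have "?w (p + 1) r = c * ?w p r"
    proof -
      have "of_real (p + 1) + \<mu> = (of_real p + \<mu>) + 1" "of_real (p + 1) - \<mu> = (of_real p - \<mu>) + 1"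
        by simp_all
      then show ?thesis by (simp only: c_def of_real_mult_beta_weight[OF r])
    qed
    moreover have c: "complex_of_real (2 * r * (1 - r)) = 2 * c"
      by (simp add: c_def)
    moreover have "complex_of_real (2 * r * (1 - r)) * y \<notin> \<real>\<^sub>\<le>\<^sub>0"
      using r by (intro of_real_mult_notin_nonpos_Reals y) auto
    then have "terminant p (2 * c * y) = of_real (Gamma p) - 2 * c * y * terminant (p + 1) (2 * c * y)"
      unfolding c by (rule terminant_plus1[OF p])
    ultimately show "?f p r = of_real (Gamma p) * ?w p r - 2 * y * ?f (p + 1) r"
      by (simp only:) (simp only: algebra_simps)
  qed simp
  also have "\<dots> = (LINT r:{0<..<1}|lborel. of_real (Gamma p) * ?w p r) -
      (LINT r:{0<..<1}|lborel. 2 * y * ?f (p + 1) r)"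
    using \<mu> y integral_weight.integrable[OF integral_weight_terminant_beta[OF \<mu>]]
    by (intro set_integral_diff(2) set_integrable_mult_right terminant_beta_integrable) auto
  finally show ?thesis
    by (simp only: set_integral_mult_right integral_terminant_beta_weight[OF \<mu>] terminant_beta_def)
qed

definition legendre_rem :: "nat \<Rightarrow> complex \<Rightarrow> complex \<Rightarrow> complex \<Rightarrow> complex" where
  "legendre_rem N x \<mu> \<nu> = (- 2) ^ N * cos (of_real pi * \<mu>) / of_real (pi powr (3/2)) * x ^ N *
     (LINT t:{0<..}|lborel. gamma_weight (\<nu> - of_nat N + 1/2) 1 t * terminant_beta (real N + 1/2) \<mu> (x / of_real t))"

lemma
  assumes "Re \<nu> > real N - 1/2"
  shows integral_weight_legendre_rem: "integral_weight {0<..} (gamma_weight (\<nu> - of_nat N + 1/2) 1)"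
    and integral_norm_legendre_rem_weight:
        "(LINT t:{0<..}|lborel. norm (gamma_weight (\<nu> - of_nat N + 1/2) 1 t)) = Gamma (Re \<nu> - real N + 1/2)"
    and integral_legendre_rem_weight: "(LINT t:{0<..}|lborel. gamma_weight (\<nu> - of_nat N + 1/2) 1 t) =
        Gamma (\<nu> - of_nat N + 1/2)"
  using integral_weight_gamma[of "\<nu> - of_nat N + 1/2" 1] integral_norm_gamma_weight[of "\<nu> - of_nat N + 1/2" 1]
    integral_gamma_weight[of "\<nu> - of_nat N + 1/2" 1] assms
  by simp_all

lemma legendre_rem_kernel_continuous:
  assumes \<mu>: "\<bar>Re \<mu>\<bar> < p" and x: "x \<notin> \<real>\<^sub>\<le>\<^sub>0"
  shows "continuous_on {0<..} (\<lambda>t. terminant_beta p \<mu> (x / of_real t))"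
  by (rule continuous_on_compose2[OF holomorphic_on_imp_continuous_on[OF terminant_beta_holomorphic[OF \<mu>]]])
     (use divide_of_real_notin_nonpos_Reals[OF x] in \<open>auto intro!: continuous_intros\<close>)

lemma norm_legendre_rem_kernel_le:
  assumes \<mu>: "\<bar>Re \<mu>\<bar> < p" and B: "\<And>c. c > 0 \<Longrightarrow> norm (terminant p (of_real c * x)) \<le> B" and t: "t > 0"
  shows "norm (terminant_beta p \<mu> (x / of_real t)) \<le> Beta (p + Re \<mu>) (p - Re \<mu>) * B"
proof (rule norm_terminant_beta_le[OF \<mu>])
  show "norm (terminant p (of_real c * (x / of_real t))) \<le> B" if "c > 0" for c
    using B[of "c / t"] t that by simp
qed

lemma norm_legendre_rem_kernel_le_chi:
  assumes "\<bar>Re \<mu>\<bar> < p" "x \<notin> \<real>\<^sub>\<le>\<^sub>0" "t \<in> {0<..}"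
  shows "norm (terminant_beta p \<mu> (x / of_real t)) \<le> Beta (p + Re \<mu>) (p - Re \<mu>) * terminant_bound p"
  using assms by (intro norm_legendre_rem_kernel_le norm_terminant_le_chi of_real_mult_notin_nonpos_Reals) auto

lemma legendre_rem_integrable:
  assumes "\<bar>Re \<mu>\<bar> < real N + 1/2" "x \<notin> \<real>\<^sub>\<le>\<^sub>0" "Re \<nu> > real N - 1/2"
  shows "set_integrable lborel {0<..}
    (\<lambda>t. gamma_weight (\<nu> - of_nat N + 1/2) 1 t * terminant_beta (real N + 1/2) \<mu> (x / of_real t))"
  by (rule integral_weight.mult_integrable[OF integral_weight_legendre_rem[OF assms(3)]
        legendre_rem_kernel_continuous[OF assms(1,2)] norm_legendre_rem_kernel_le_chi[OF assms(1,2)]])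

lemma legendre_rem_holomorphic:
  assumes \<mu>: "\<bar>Re \<mu>\<bar> < real N + 1/2" and \<nu>: "Re \<nu> > real N - 1/2"
  shows "(\<lambda>x. legendre_rem N x \<mu> \<nu>) holomorphic_on - \<real>\<^sub>\<le>\<^sub>0"
proof -
  let ?p = "real N + 1/2"
  have "(\<lambda>x. LINT t:{0<..}|lborel. gamma_weight (\<nu> - of_nat N + 1/2) 1 t * terminant_beta ?p \<mu> (x / of_real t))
     holomorphic_on - \<real>\<^sub>\<le>\<^sub>0"
  proof (rule integral_weight.integral_holomorphic[OF integral_weight_legendre_rem[OF \<nu>]])
    fix t :: real assume "t \<in> {0<..}"
    then show "(\<lambda>x. terminant_beta ?p \<mu> (x / of_real t)) holomorphic_on - \<real>\<^sub>\<le>\<^sub>0"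
      by (intro holomorphic_on_compose_gen[OF _ terminant_beta_holomorphic[OF \<mu>], unfolded o_def])
         (use divide_of_real_notin_nonpos_Reals[of _ t] in \<open>auto intro!: holomorphic_intros\<close>)
  next
    show "\<exists>e>0. \<exists>C. \<forall>v\<in>ball x e \<inter> - \<real>\<^sub>\<le>\<^sub>0. \<forall>t\<in>{0<..}. norm (terminant_beta ?p \<mu> (v / of_real t)) \<le> C" for x
      by (intro exI[of _ 1] exI[of _ "Beta (?p + Re \<mu>) (?p - Re \<mu>) * terminant_bound ?p"] conjI ballI
          norm_legendre_rem_kernel_le_chi \<mu>) auto
  qed (auto intro!: legendre_rem_kernel_continuous \<mu>)
  then show ?thesis unfolding legendre_rem_def by (intro holomorphic_intros) auto
qed

lemma legendre_rem_holomorphic_order: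
  assumes x: "x \<notin> \<real>\<^sub>\<le>\<^sub>0" and \<nu>: "Re \<nu> > real N - 1/2"
  shows "(\<lambda>\<mu>. legendre_rem N x \<mu> \<nu>) holomorphic_on {\<mu>. \<bar>Re \<mu>\<bar> < real N + 1/2}"
proof -
  let ?p = "real N + 1/2"
  let ?U = "{\<mu>. \<bar>Re \<mu>\<bar> < ?p}"
  have "(\<lambda>\<mu>. LINT t:{0<..}|lborel. gamma_weight (\<nu> - of_nat N + 1/2) 1 t * terminant_beta ?p \<mu> (x / of_real t))
     holomorphic_on ?U"
  proof (rule integral_weight.integral_holomorphic[OF integral_weight_legendre_rem[OF \<nu>]])
    show "open ?U" by (intro open_Collect_less continuous_intros)
    show "(\<lambda>\<mu>. terminant_beta ?p \<mu> (x / of_real t)) holomorphic_on ?U" if "t \<in> {0<..}" for t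
      using that by (intro terminant_beta_holomorphic_order divide_of_real_notin_nonpos_Reals[OF x]) auto
    show "continuous_on {0<..} (\<lambda>t. terminant_beta ?p \<mu> (x / of_real t))" if "\<mu> \<in> ?U" for \<mu>
      using that by (intro legendre_rem_kernel_continuous x) simp
    fix \<mu> assume "\<mu> \<in> ?U"
    then obtain e where e: "e > 0" "cball \<mu> e \<subseteq> ?U"
      using \<open>open ?U\<close> open_contains_cball by blast
    have "continuous_on (cball \<mu> e) (\<lambda>w. Beta (?p + Re w) (?p - Re w))"
      unfolding Beta_def using e(2)
      by (intro continuous_at_imp_continuous_on ballI continuous_intros)
         (auto simp: Gamma_eq_zero_iff subset_iff elim!: nonpos_Ints_cases)
    then have "bounded ((\<lambda>w. Beta (?p + Re w) (?p - Re w)) ` cball \<mu> e)"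
      by (intro compact_imp_bounded compact_continuous_image compact_cball)
    then obtain b where b: "\<forall>B\<in>(\<lambda>w. Beta (?p + Re w) (?p - Re w)) ` cball \<mu> e. norm B \<le> b"
      unfolding bounded_iff by blast
    have "norm (terminant_beta ?p w (x / of_real t)) \<le> b * terminant_bound ?p"
      if "w \<in> ball \<mu> e \<inter> ?U" "t \<in> {0<..}" for w t
    proof -
      have "norm (terminant_beta ?p w (x / of_real t)) \<le> Beta (?p + Re w) (?p - Re w) * terminant_bound ?p"
        using that by (intro norm_legendre_rem_kernel_le_chi x) auto
      also have "\<dots> \<le> b * terminant_bound ?p"
        using bspec[OF b imageI, of w] that by (intro mult_right_mono terminant_bound_nonneg) auto
      finally show ?thesis .
    qed
    then show "\<exists>e>0. \<exists>C. \<forall>w\<in>ball \<mu> e \<inter> ?U. \<forall>t\<in>{0<..}. norm (terminant_beta ?p w (x / of_real t)) \<le> C"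
      using e(1) by blast
  qed
  then show ?thesis unfolding legendre_rem_def by (intro holomorphic_intros) auto
qed

lemma Gamma_half_nat: "Gamma (of_nat N + 1/2) = (fact (2 * N) * sqrt pi / (4 ^ N * fact N) :: real)"
proof (induction N)
  case (Suc N)
  have "Gamma (real (Suc N) + 1/2) = (real N + 1/2) * Gamma (real N + 1/2)"
    using Gamma_plus1[OF pos_notin_nonpos_Ints, of "real N + 1/2"] by (simp add: add_ac)
  also have "\<dots> = fact (2 * Suc N) * sqrt pi / (4 ^ Suc N * fact (Suc N))"
    unfolding Suc by (simp add: divide_simps) (simp add: algebra_simps)
  finally show ?case .
qed (simp add: Gamma_one_half_real)

lemma a_coeff_pochhammer:
  fixes \<mu> :: "'a :: field_char_0"
  shows "a_coeff N \<mu> = (- 1) ^ N * (pochhammer (1/2 - \<mu>) N * pochhammer (1/2 + \<mu>) N) / (2 ^ N * fact N)"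
proof -
  have "(\<Prod>k=1..N. 4 * \<mu>\<^sup>2 - (2 * of_nat k - 1)\<^sup>2) = (- 4) ^ N * (pochhammer (1/2 - \<mu>) N * pochhammer (1/2 + \<mu>) N)"
  proof (induction N)
    case (Suc N)
    have "4 * \<mu>\<^sup>2 - (2 * of_nat (Suc N) - 1)\<^sup>2 = (- 4) * (1/2 - \<mu> + of_nat N) * (1/2 + \<mu> + of_nat N)"
      by (simp add: field_simps power2_eq_square)
    then have "(\<Prod>k=1..Suc N. 4 * \<mu>\<^sup>2 - (2 * of_nat k - 1)\<^sup>2) =
        (\<Prod>k=1..N. 4 * \<mu>\<^sup>2 - (2 * of_nat k - 1)\<^sup>2) * ((- 4) * (1/2 - \<mu> + of_nat N) * (1/2 + \<mu> + of_nat N))"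
      by simp
    then show ?case unfolding Suc pochhammer_Suc power_Suc by (simp only: mult_ac)
  qed simp
  moreover have "(8::'a) ^ N = 4 ^ N * 2 ^ N" "(- 4::'a) ^ N = (- 1) ^ N * 4 ^ N"
    by (simp_all add: power_mult_distrib[symmetric])
  ultimately show ?thesis unfolding a_coeff_def by simp
qed

lemma rGamma_half_reflection: "rGamma (1/2 - \<mu> :: complex) * rGamma (1/2 + \<mu>) = cos (of_real pi * \<mu>) / of_real pi"
  using rGamma_reflection_complex[of "1/2 - \<mu>"] by (simp add: cos_sin_eq algebra_simps)

lemma pochhammer_half_product:
  fixes \<mu> :: complex
  assumes "\<bar>Re \<mu>\<bar> < real N + 1/2"
  shows "pochhammer (1/2 - \<mu>) N * pochhammer (1/2 + \<mu>) N =
    cos (of_real pi * \<mu>) / of_real pi * (Gamma (of_nat N + 1/2 + \<mu>) * Gamma (of_nat N + 1/2 - \<mu>))"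
proof -
  have "of_nat N + 1/2 + \<mu> \<notin> \<int>\<^sub>\<le>\<^sub>0" "of_nat N + 1/2 - \<mu> \<notin> \<int>\<^sub>\<le>\<^sub>0"
    using assms by (auto elim!: nonpos_Ints_cases simp: complex_eq_iff)
  moreover have "pochhammer z N = rGamma z * Gamma (z + of_nat N)" if "z + of_nat N \<notin> \<int>\<^sub>\<le>\<^sub>0" for z :: complex
    using pochhammer_rGamma[of z N] that by (simp add: Gamma_def rGamma_eq_zero_iff)
  ultimately have "pochhammer (1/2 - \<mu>) N * pochhammer (1/2 + \<mu>) N =
     (rGamma (1/2 - \<mu>) * rGamma (1/2 + \<mu>)) * (Gamma (of_nat N + 1/2 + \<mu>) * Gamma (of_nat N + 1/2 - \<mu>))"
    by (simp add: algebra_simps)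
  then show ?thesis by (simp add: rGamma_half_reflection)
qed

lemma pi_powr_three_halves: "pi powr (3/2) = pi * sqrt pi"
  using powr_add[of pi 1 "1/2"] by (simp add: powr_half_sqrt)

lemma a_coeff_Beta:
  fixes \<mu> :: complex
  assumes "\<bar>Re \<mu>\<bar> < real N + 1/2"
  shows "a_coeff N \<mu> = (- 2) ^ N * cos (of_real pi * \<mu>) / of_real (pi powr (3/2)) *
    (of_real (Gamma (real N + 1/2)) * Beta (of_real (real N + 1/2) + \<mu>) (of_real (real N + 1/2) - \<mu>))"
proof -
  let ?G = "Gamma (of_nat N + 1/2 + \<mu>) * Gamma (of_nat N + 1/2 - \<mu>)"
  have "Beta (of_real (real N + 1/2) + \<mu>) (of_real (real N + 1/2) - \<mu>) = ?G / fact (2 * N)"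
    using Gamma_fact[of "2 * N", where 'a = complex] by (simp add: Beta_def add_ac)
  moreover have "(- 2 :: complex) ^ N = (- 1) ^ N * 2 ^ N" "(4 :: complex) ^ N = 2 ^ N * 2 ^ N"
    by (simp_all add: power_mult_distrib[symmetric])
  ultimately show ?thesis
    unfolding a_coeff_pochhammer pochhammer_half_product[OF assms] Gamma_half_nat pi_powr_three_halves
    by (simp add: field_simps)
qed

lemma of_real_a_coeff: "complex_of_real (a_coeff N m) = a_coeff N (of_real m)"
  by (simp add: a_coeff_def)

lemma of_real_cos_pi: "cos (complex_of_real pi * of_real m) = of_real (cos (pi * m))"
  by (metis cos_of_real of_real_mult)

lemma a_coeff_Beta_real:
  fixes m :: real
  assumes "\<bar>m\<bar> < real N + 1/2"
  shows "a_coeff N m = (- 1) ^ N * cos (pi * m) *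
    (2 ^ N / pi powr (3/2) * (Gamma (real N + 1/2) * Beta (real N + 1/2 + m) (real N + 1/2 - m)))"
proof -
  have "(- 2 :: real) ^ N = (- 1) ^ N * 2 ^ N"
    by (simp add: power_mult_distrib[symmetric])
  moreover have "complex_of_real (a_coeff N m) = of_real ((- 2) ^ N * cos (pi * m) / pi powr (3/2) *
      (Gamma (real N + 1/2) * Beta (real N + 1/2 + m) (real N + 1/2 - m)))"
    unfolding of_real_a_coeff using a_coeff_Beta[of "of_real m" N] assms
    by (simp only: of_real_cos_pi of_real_add[symmetric] of_real_diff[symmetric] Beta_complex_of_real) simp
  ultimately show ?thesis
    by (simp only: of_real_eq_iff) simp
qed

lemma cos_pi_eq_0_iff: "cos (pi * t) = 0 \<longleftrightarrow> (\<exists>k::int. odd k \<and> 2 * t = of_int k)"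
proof -
  have "cos (pi * t) = 0 \<longleftrightarrow> (\<exists>k::int. odd k \<and> pi * t = of_int k * (pi / 2))"
    unfolding cos_zero_iff_int by blast
  also have "\<dots> \<longleftrightarrow> (\<exists>k::int. odd k \<and> 2 * t = of_int k)"
    by (intro ex_cong conj_cong refl) (auto simp: field_simps)
  finally show ?thesis .
qed

lemma cos_pi_zero_isolated:
  assumes m: "cos (pi * m) = 0" and t: "t \<noteq> m" "\<bar>t - m\<bar> < 1"
  shows "cos (pi * t) \<noteq> 0"
proof
  assume "cos (pi * t) = 0"
  moreover have "cos (pi * t) = cos (pi * m + pi * (t - m))" by (simp add: algebra_simps)
  moreover have "sin (pi * m) \<noteq> 0" using m by (metis sin_zero_abs_cos_one abs_zero zero_neq_one)
  ultimately have sin_0: "sin (pi * (t - m)) = 0" using m by (simp only: cos_add) simp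
  have "\<bar>pi * (t - m)\<bar> < pi * 1" unfolding abs_mult using t by simp
  then have "pi * (t - m) = 0" by (intro sin_eq_0_pi[OF _ _ sin_0]) linarith+
  then show False using t by simp
qed

lemma a_cos_ratio_Beta:
  assumes m: "\<bar>m\<bar> < real N + 1/2"
  shows "a_cos_ratio N m = 2 ^ N / pi powr (3/2) *
      (Gamma (real N + 1/2) * Beta (real N + 1/2 + m) (real N + 1/2 - m))"
proof -
  let ?g = "\<lambda>m. 2 ^ N / pi powr (3/2) * (Gamma (real N + 1/2) * Beta (real N + 1/2 + m) (real N + 1/2 - m))"
  have eq: "\<bar>a_coeff N t\<bar> / \<bar>cos (pi * t)\<bar> = ?g t" if "\<bar>t\<bar> < real N + 1/2" "cos (pi * t) \<noteq> 0" for t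
  proof -
    have "Beta (real N + 1/2 + t) (real N + 1/2 - t) > 0"
      unfolding Beta_def using that by (intro divide_pos_pos mult_pos_pos Gamma_real_pos) auto
    moreover have "Gamma (real N + 1/2) > 0" by (intro Gamma_real_pos) simp
    ultimately show ?thesis
      unfolding a_coeff_Beta_real[OF that(1)] using that(2) by (simp add: abs_mult)
  qed
  show ?thesis
  proof (cases "cos (pi * m) = 0")
    case False
    then show ?thesis using eq[OF m] unfolding a_cos_ratio_def cos_pi_eq_0_iff by auto
  next
    case True
    have "(?g \<longlongrightarrow> ?g m) (at m)"
      unfolding Beta_def by (intro tendsto_intros) (use m in \<open>auto elim!: nonpos_Ints_cases simp: Gamma_eq_zero_iff\<close>)
    moreover have "open {t. \<bar>t\<bar> < real N + 1/2}" by (intro open_Collect_less continuous_intros)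
    then have "\<forall>\<^sub>F t in at m. t \<in> {t. \<bar>t\<bar> < real N + 1/2}"
      using m by (intro eventually_at_in_open') auto
    moreover have "\<forall>\<^sub>F t in at m. cos (pi * t) \<noteq> 0"
      unfolding eventually_at using cos_pi_zero_isolated[OF True] by (intro exI[of _ 1]) (auto simp: dist_real_def)
    ultimately have "((\<lambda>t. \<bar>a_coeff N t\<bar> / \<bar>cos (pi * t)\<bar>) \<longlongrightarrow> ?g m) (at m)"
      using eq by (subst tendsto_cong[where g = ?g]) (auto elim: eventually_elim2)
    then show ?thesis
      using True tendsto_Lim[of "at m"] unfolding a_cos_ratio_def cos_pi_eq_0_iff by simp
  qed
qed

definition legendre_term_bound :: "nat \<Rightarrow> complex \<Rightarrow> complex \<Rightarrow> complex \<Rightarrow> real" where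
  "legendre_term_bound N x \<mu> \<nu> =
    norm (cos (of_real pi * \<mu>)) * a_cos_ratio N (Re \<mu>) * Gamma (Re \<nu> - real N + 1/2) * norm x ^ N"

lemma legendre_term_bound_minus [simp]: "legendre_term_bound N (- x) \<mu> \<nu> = legendre_term_bound N x \<mu> \<nu>"
  by (simp add: legendre_term_bound_def)

lemma norm_legendre_rem_le:
  assumes \<mu>: "\<bar>Re \<mu>\<bar> < real N + 1/2" and \<nu>: "Re \<nu> > real N - 1/2"
    and B: "\<And>c. c > 0 \<Longrightarrow> norm (terminant (real N + 1/2) (of_real c * x)) \<le> Gamma (real N + 1/2) * B"
  shows "norm (legendre_rem N x \<mu> \<nu>) \<le> legendre_term_bound N x \<mu> \<nu> * B"
proof -
  let ?p = "real N + 1/2"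
  let ?I = "LINT t:{0<..}|lborel. gamma_weight (\<nu> - of_nat N + 1/2) 1 t * terminant_beta ?p \<mu> (x / of_real t)"
  have "norm ?I \<le> Gamma (Re \<nu> - real N + 1/2) * (Beta (?p + Re \<mu>) (?p - Re \<mu>) * (Gamma ?p * B))"
    unfolding integral_norm_legendre_rem_weight[OF \<nu>, symmetric]
    by (intro integral_weight.norm_integral_le integral_weight_legendre_rem \<nu> norm_legendre_rem_kernel_le \<mu> B) auto
  then have "norm (cos (of_real pi * \<mu>)) * (2 ^ N / pi powr (3/2)) * norm x ^ N * norm ?I \<le>
      norm (cos (of_real pi * \<mu>)) * (2 ^ N / pi powr (3/2)) * norm x ^ N *
      (Gamma (Re \<nu> - real N + 1/2) * (Beta (?p + Re \<mu>) (?p - Re \<mu>) * (Gamma ?p * B)))"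
    by (intro mult_left_mono) auto
  then show ?thesis
    unfolding legendre_rem_def legendre_term_bound_def a_cos_ratio_Beta[OF \<mu>]
    by (simp add: norm_mult norm_divide norm_power mult_ac)
qed

lemma legendre_rem_Suc:
  assumes \<mu>: "\<bar>Re \<mu>\<bar> < real N + 1/2" and x: "x \<notin> \<real>\<^sub>\<le>\<^sub>0" and \<nu>: "Re \<nu> > real (Suc N) - 1/2"
  shows "legendre_rem N x \<mu> \<nu> = a_coeff N \<mu> * Gamma (\<nu> - of_nat N + 1/2) * x ^ N + legendre_rem (Suc N) x \<mu> \<nu>"
proof -
  let ?p = "\<lambda>N. real N + 1/2"
  let ?w = "\<lambda>N. gamma_weight (\<nu> - of_nat N + 1/2) 1"
  let ?f = "\<lambda>N t. ?w N t * terminant_beta (?p N) \<mu> (x / of_real t)"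
  let ?K = "of_real (Gamma (?p N)) * Beta (of_real (?p N) + \<mu>) (of_real (?p N) - \<mu>)"
  have \<nu>N: "Re \<nu> > real N - 1/2" using \<nu> by simp
  have "(LINT t:{0<..}|lborel. ?f N t) = (LINT t:{0<..}|lborel. ?K * ?w N t - 2 * x * ?f (Suc N) t)"
  proof (intro set_lebesgue_integral_cong allI impI)
    fix t :: real assume t: "t \<in> {0<..}"
    have "?w N t = of_real t * ?w (Suc N) t"
      using t by (simp add: of_real_mult_gamma_weight algebra_simps)
    moreover have "terminant_beta (?p N) \<mu> (x / of_real t) =
        ?K - 2 * (x / of_real t) * terminant_beta (?p (Suc N)) \<mu> (x / of_real t)"
      using terminant_beta_plus1[OF \<mu> divide_of_real_notin_nonpos_Reals[OF x, of t]] t by (simp add: add_ac)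
    ultimately show "?f N t = ?K * ?w N t - 2 * x * ?f (Suc N) t"
      using t by (simp only:) (simp add: field_simps)
  qed simp
  also have "\<dots> = (LINT t:{0<..}|lborel. ?K * ?w N t) - (LINT t:{0<..}|lborel. 2 * x * ?f (Suc N) t)"
    using \<mu> x \<nu> integral_weight.integrable[OF integral_weight_legendre_rem[OF \<nu>N]]
    by (intro set_integral_diff(2) set_integrable_mult_right legendre_rem_integrable) auto
  finally have "(LINT t:{0<..}|lborel. ?f N t) =
      ?K * Gamma (\<nu> - of_nat N + 1/2) - 2 * x * (LINT t:{0<..}|lborel. ?f (Suc N) t)"
    by (simp only: set_integral_mult_right integral_legendre_rem_weight[OF \<nu>N])
  then show ?thesis
    unfolding legendre_rem_def a_coeff_Beta[OF \<mu>] by (simp only:) (simp add: algebra_simps)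
qed

lemma legendre_rem_expand:
  assumes "N \<le> M" and \<mu>: "\<bar>Re \<mu>\<bar> < real N + 1/2" and x: "x \<notin> \<real>\<^sub>\<le>\<^sub>0" and "Re \<nu> > real M - 1/2"
  shows "legendre_rem N x \<mu> \<nu> =
    (\<Sum>n=N..<M. a_coeff n \<mu> * Gamma (\<nu> - of_nat n + 1/2) * x ^ n) + legendre_rem M x \<mu> \<nu>"
  using assms(1,4)
proof (induction M rule: dec_induct)
  case (step M)
  then show ?case using legendre_rem_Suc[of \<mu> M x \<nu>] \<mu> x by simp
qed simp

section \<open>Euler's integral for the remainder\<close>

definition euler_integral :: "real \<Rightarrow> complex \<Rightarrow> complex \<Rightarrow> complex" where
  "euler_integral m \<nu> x = (LINT s:{0<..}|lborel. beta_prime_weight (1/2 - of_real m) (\<nu> + 1/2) s *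
     (1 + of_real s * (x / 2)) powr of_real (- m - 1/2))"

lemma integral_weight_euler:
  assumes "\<bar>m\<bar> < 1/2" "Re \<nu> > - 1/2"
  shows "integral_weight {0<..} (beta_prime_weight (1/2 - of_real m) (\<nu> + 1/2))"
  using assms by (intro integral_weight_beta_prime) auto

lemma euler_kernel_notin_nonpos_Reals:
  fixes x :: complex
  assumes "x \<notin> \<real>\<^sub>\<le>\<^sub>0" "s \<in> {0<..}"
  shows "1 + of_real s * (x / 2) \<notin> \<real>\<^sub>\<le>\<^sub>0"
  using one_plus_mult_notin_nonpos_Reals[OF divide_of_real_notin_nonpos_Reals[OF assms(1), of 2], of s] assms(2)
  by simp

lemma continuous_on_powr_slit:
  fixes f :: "'a::topological_space \<Rightarrow> complex"
  assumes "continuous_on A f" "\<And>x. x \<in> A \<Longrightarrow> f x \<notin> \<real>\<^sub>\<le>\<^sub>0"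
  shows "continuous_on A (\<lambda>x. f x powr c)"
  using assms unfolding continuous_on_def by (auto intro!: tendsto_powr_complex)

lemma euler_kernel_continuous:
  fixes x :: complex
  assumes "x \<notin> \<real>\<^sub>\<le>\<^sub>0"
  shows "continuous_on {0<..} (\<lambda>s. (1 + complex_of_real s * (x / 2)) powr c)"
  by (intro continuous_on_powr_slit continuous_intros euler_kernel_notin_nonpos_Reals[OF assms])

lemma norm_euler_kernel_le:
  fixes x :: complex
  assumes "m > - 1/2" "d > 0" "norm (1 + of_real s * (x / 2)) \<ge> d"
  shows "norm ((1 + of_real s * (x / 2)) powr of_real (- m - 1/2)) \<le> d powr (- m - 1/2)"
proof -
  have "norm ((1 + of_real s * (x / 2)) powr of_real (- m - 1/2)) = norm (1 + of_real s * (x / 2)) powr (- m - 1/2)"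
    by (subst norm_powr_real_powr') auto
  also have "\<dots> \<le> d powr (- m - 1/2)"
    using assms by (intro powr_mono2') auto
  finally show ?thesis .
qed

lemma euler_kernel_locally_bounded:
  fixes x :: complex
  assumes m: "m > - 1/2" and x: "x \<notin> \<real>\<^sub>\<le>\<^sub>0"
  obtains e C where "e > 0"
    "\<And>w s. w \<in> ball x e \<Longrightarrow> s > 0 \<Longrightarrow> norm ((1 + of_real s * (w / 2)) powr of_real (- m - 1/2)) \<le> C"
proof -
  have "x / 2 \<notin> \<real>\<^sub>\<le>\<^sub>0"
    using divide_of_real_notin_nonpos_Reals[OF x, of 2] by simp
  then obtain e d where e: "e > 0" and d: "d > 0"
    "\<And>w u. w \<in> ball (x / 2) e \<Longrightarrow> u \<ge> 0 \<Longrightarrow> norm (1 + of_real u * w) \<ge> d"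
    by (rule one_plus_mult_locally_bounded_below) blast
  show ?thesis
  proof (rule that[OF e norm_euler_kernel_le[OF m d(1) d(2)]])
    fix w assume w: "w \<in> ball x e"
    have "dist (x / 2) (w / 2) = dist x w / 2"
      unfolding dist_norm diff_divide_distrib[symmetric] norm_divide by simp
    then show "w / 2 \<in> ball (x / 2) e"
      using w zero_le_dist[of x w] unfolding mem_ball by linarith
  qed simp
qed

lemma euler_integrable:
  assumes m: "\<bar>m\<bar> < 1/2" and \<nu>: "Re \<nu> > - 1/2" and x: "x \<notin> \<real>\<^sub>\<le>\<^sub>0"
  shows "set_integrable lborel {0<..} (\<lambda>s. beta_prime_weight (1/2 - of_real m) (\<nu> + 1/2) s *
     (1 + of_real s * (x / 2)) powr of_real (- m - 1/2))"
proof -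
  have "m > - 1/2" using m by simp
  then obtain e C where "e > 0"
    "\<And>w s. w \<in> ball x e \<Longrightarrow> s > 0 \<Longrightarrow> norm ((1 + of_real s * (w / 2)) powr of_real (- m - 1/2)) \<le> C"
    using x by (rule euler_kernel_locally_bounded) blast
  then show ?thesis
    by (intro integral_weight.mult_integrable[OF integral_weight_euler[OF m \<nu>] euler_kernel_continuous[OF x],
        of _ C]) simp
qed

lemma euler_integral_holomorphic:
  assumes m: "\<bar>m\<bar> < 1/2" and \<nu>: "Re \<nu> > - 1/2"
  shows "euler_integral m \<nu> holomorphic_on - \<real>\<^sub>\<le>\<^sub>0"
proof -
  have m': "m > - 1/2" using m by simp
  have "(\<lambda>x. LINT s:{0<..}|lborel. beta_prime_weight (1/2 - of_real m) (\<nu> + 1/2) s *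
     (1 + of_real s * (x / 2)) powr of_real (- m - 1/2)) holomorphic_on - \<real>\<^sub>\<le>\<^sub>0"
  proof (rule integral_weight.integral_holomorphic[OF integral_weight_euler[OF m \<nu>]])
    show "(\<lambda>x. (1 + of_real s * (x / 2)) powr of_real (- m - 1/2)) holomorphic_on - \<real>\<^sub>\<le>\<^sub>0" if "s \<in> {0<..}" for s
      by (intro holomorphic_intros euler_kernel_notin_nonpos_Reals[OF _ that]) auto
    fix x :: complex assume "x \<in> - \<real>\<^sub>\<le>\<^sub>0"
    then have x: "x \<notin> \<real>\<^sub>\<le>\<^sub>0" by simp
    show "continuous_on {0<..} (\<lambda>s. (1 + complex_of_real s * (x / 2)) powr of_real (- m - 1/2))"
      by (rule euler_kernel_continuous[OF x])
    obtain e C where "e > 0"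
      "\<And>w s. w \<in> ball x e \<Longrightarrow> s > 0 \<Longrightarrow> norm ((1 + of_real s * (w / 2)) powr of_real (- m - 1/2)) \<le> C"
      using m' x by (rule euler_kernel_locally_bounded) blast
    then show "\<exists>e>0. \<exists>C. \<forall>w\<in>ball x e \<inter> - \<real>\<^sub>\<le>\<^sub>0. \<forall>s\<in>{0<..}.
        norm ((1 + complex_of_real s * (w / 2)) powr of_real (- m - 1/2)) \<le> C"
      by (intro exI[of _ e] conjI exI[of _ C]) auto
  qed auto
  then show ?thesis unfolding euler_integral_def .
qed

definition gauss_laplace :: "real \<Rightarrow> real \<Rightarrow> real" where
  "gauss_laplace a q = (LINT h:{0<..}|lborel. exp (- (a * h) - q * h\<^sup>2))"

lemma gauss_laplace_integrable:
  assumes "a > 0" "q \<ge> 0"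
  shows "set_integrable lborel {0<..} (\<lambda>h::real. exp (- (a * h) - q * h\<^sup>2))"
proof (rule set_integrable_bound_continuous)
  show "set_integrable lborel {0<..} (\<lambda>h. h powr (1 - 1) * exp (- (a * h)))"
    using assms by (intro gamma_integral_real) auto
  show "continuous_on {0<..} (\<lambda>h::real. exp (- (a * h) - q * h\<^sup>2))"
    by (intro continuous_intros)
qed (use assms in auto)

lemma gauss_laplace_le:
  assumes "a > 0" "q \<ge> 0"
  shows "gauss_laplace a q \<le> inverse a"
proof -
  have "norm (gauss_laplace a q) \<le> (LINT h:{0<..}|lborel. h powr (1 - 1) * exp (- (a * h)))"
    unfolding gauss_laplace_def using assms
    by (intro set_integral_norm_bound_le gamma_integral_real) auto
  also have "\<dots> = inverse a"
    using gamma_integral_real(2)[of 1 a] assms by (simp add: powr_minus)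
  finally show ?thesis by simp
qed

lemma gauss_laplace_scale:
  assumes "c > 0" "q \<ge> 0"
  shows "gauss_laplace 1 q = c * gauss_laplace c (c\<^sup>2 * q)"
proof -
  have "(LINT h:{0<..}|lborel. exp (- (1 * (c * h)) - q * (c * h)\<^sup>2)) = (1 / c) *\<^sub>R gauss_laplace 1 q"
    unfolding gauss_laplace_def using assms by (intro set_integral_scale_Ioi gauss_laplace_integrable) auto
  moreover have "(LINT h:{0<..}|lborel. exp (- (1 * (c * h)) - q * (c * h)\<^sup>2)) = gauss_laplace c (c\<^sup>2 * q)"
    unfolding gauss_laplace_def by (intro set_lebesgue_integral_cong) (simp_all add: power_mult_distrib mult_ac)
  ultimately show ?thesis using assms by (simp add: field_simps)
qed

text \<open>The substitution \<open>s = h + q h\<^sup>2 / 4\<close> turns \<open>1 + s q\<close> into the square \<open>(1 + q h / 2)\<^sup>2\<close>.\<close>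

lemma bij_betw_quadratic_Ioi:
  assumes q: "q > (0::real)"
  shows "bij_betw (\<lambda>h. h + q / 4 * h\<^sup>2) {0<..} {0<..}"
  unfolding bij_betw_def
proof
  show "inj_on (\<lambda>h. h + q / 4 * h\<^sup>2) {0<..}"
  proof (rule strict_mono_on_imp_inj_on, rule strict_mono_onI)
    fix a b :: real assume "a \<in> {0<..}" "a < b"
    then show "a + q / 4 * a\<^sup>2 < b + q / 4 * b\<^sup>2"
      using q by (intro add_strict_mono mult_strict_left_mono power_strict_mono) auto
  qed
  show "(\<lambda>h. h + q / 4 * h\<^sup>2) ` {0<..} = {0<..}"
  proof (intro equalityI subsetI)
    fix v :: real assume v: "v \<in> {0<..}"
    define h where "h = 2 * (sqrt (1 + v * q) - 1) / q"
    have "1 + q / 2 * h = sqrt (1 + v * q)" using q by (simp add: h_def field_simps)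
    then have "(1 + q / 2 * h)\<^sup>2 = 1 + v * q" using v q by (simp only:) simp
    then have "(h + q / 4 * h\<^sup>2) * q = v * q" by (simp add: power2_eq_square algebra_simps)
    then have "v = h + q / 4 * h\<^sup>2" using q by simp
    moreover have "h > 0" using v q by (auto simp: h_def intro!: divide_pos_pos mult_pos_pos)
    ultimately show "v \<in> (\<lambda>h. h + q / 4 * h\<^sup>2) ` {0<..}" by (intro image_eqI[of _ _ h]) simp_all
  qed (use q in \<open>auto intro!: add_pos_pos\<close>)
qed

lemma gauss_laplace_substitution:
  assumes q: "q > 0"
  shows "(LINT s:{0<..}|lborel. exp (- s) * (1 + s * q) powr (- (1/2))) = gauss_laplace 1 (q / 4)"
proof -
  let ?f = "\<lambda>s::real. exp (- s) * (1 + s * q) powr (- (1/2))"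
  let ?g = "\<lambda>h::real. h + q / 4 * h\<^sup>2"
  let ?g' = "\<lambda>h::real. 1 + q / 2 * h"
  note bij = bij_betw_quadratic_Ioi[OF q]
  have "1 + s * q > 0" if "s > 0" for s using that q by (simp add: add_pos_pos)
  then have cont: "continuous_on {0<..} ?f" by (intro continuous_intros) force
  have int: "set_integrable lborel {0<..} ?f"
  proof (rule set_integrable_bound_continuous[OF _ cont gauss_laplace_integrable[of 1 0]])
    fix s :: real assume s: "s \<in> {0<..}"
    have "(1 + s * q) powr (- (1/2)) \<le> 1 powr (- (1/2))"
      using s q by (intro powr_mono2') auto
    then show "norm (?f s) \<le> exp (- (1 * s) - 0 * s\<^sup>2)" by simp
  qed auto
  have eq: "exp (- (1 * h) - q / 4 * h\<^sup>2) = \<bar>?g' h\<bar> *\<^sub>R ?f (?g h)" if "h \<in> {0<..}" for h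
  proof -
    have square: "1 + ?g h * q = (?g' h)\<^sup>2" by (simp add: power2_eq_square algebra_simps)
    have pos: "?g' h > 0" using that q by (simp add: add_pos_pos)
    then have "((?g' h)\<^sup>2) powr (- (1/2)) = inverse (?g' h)"
      unfolding powr_minus by (subst powr_half_sqrt) auto
    then have "\<bar>?g' h\<bar> *\<^sub>R ?f (?g h) = exp (- ?g h)"
      using pos unfolding square by simp
    then show ?thesis by (simp add: algebra_simps)
  qed
  have "(LINT h:{0<..}|lborel. exp (- (1 * h) - q / 4 * h\<^sup>2)) = (LINT s:{0<..}|lborel. ?f s)"
  proof (rule set_integral_substitution(2)[OF _ _ bij_betw_imp_surj_on[OF bij]
        bij_betw_imp_inj_on[OF bij] _ _ cont int eq])
    show "(?g has_field_derivative ?g' h) (at h)" for h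
      by (rule derivative_eq_intros refl)+ simp
    show "continuous_on {0<..} ?g'" by (intro continuous_intros)
  qed auto
  then show ?thesis by (simp add: gauss_laplace_def)
qed

lemma terminant_half_of_real:
  assumes q: "q > 0"
  shows "terminant (1/2) (of_real q) = of_real (sqrt pi * gauss_laplace 1 (q / 4))"
proof -
  have "terminant (1/2) (of_real q) = (LINT s:{0<..}|lborel. gamma_weight 1 1 s *
      (of_real (Gamma (1/2)) * (1 + of_real s * of_real q) powr (- of_real (1/2))))"
    using q by (intro terminant_Laplace_transform) simp_all
  also have "\<dots> = (LINT s:{0<..}|lborel. complex_of_real (sqrt pi * (exp (- s) * (1 + s * q) powr (- (1/2)))))"
  proof (intro set_lebesgue_integral_cong allI impI)
    fix s :: real assume s: "s \<in> {0<..}"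
    have "(1 + complex_of_real s * of_real q) powr (- of_real (1/2)) = of_real ((1 + s * q) powr (- (1/2)))"
      using powr_of_real[of "1 + s * q" "- (1/2)"] s q by simp
    then show "gamma_weight 1 1 s * (of_real (Gamma (1/2)) * (1 + of_real s * of_real q) powr (- of_real (1/2))) =
        complex_of_real (sqrt pi * (exp (- s) * (1 + s * q) powr (- (1/2))))"
      using s by (simp only:) (simp add: gamma_weight_def Gamma_one_half_real exp_of_real[symmetric] mult_ac)
  qed simp
  finally show ?thesis
    by (simp only: set_integral_complex_of_real set_integral_mult_right gauss_laplace_substitution[OF q])
qed

text \<open>With \<open>r = k / (1 + k)\<close> and \<open>h = (1 + k) u\<close> the integral over \<open>k\<close> becomes a gamma integral.\<close>

lemma terminant_beta_half_gauss_laplace: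
  assumes m: "\<bar>m\<bar> < 1/2" and y: "y > 0"
  shows "terminant_beta (1/2) (of_real m) (of_real y) =
    of_real (sqrt pi * (LINT k:{0<..}|lborel. k powr (m - 1/2) * gauss_laplace (1 + k) (k * y / 2)))"
proof -
  let ?f = "\<lambda>r. beta_weight (of_real (1/2) + of_real m) (of_real (1/2) - of_real m) r *
      terminant (1/2) (of_real (2 * r * (1 - r)) * of_real y)"
  let ?k = "\<lambda>k. complex_of_real (sqrt pi * (k powr (m - 1/2) * gauss_laplace (1 + k) (k * y / 2)))"
  have half: "(1/2::real) > 0" and y': "complex_of_real y \<notin> \<real>\<^sub>\<le>\<^sub>0" using y by simp_all
  have int: "set_integrable lborel {0<..<1} ?f"
    by (rule terminant_beta_integrable) (use m y' in auto)
  have cont: "continuous_on {0<..<1} ?f"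
    by (intro continuous_intros continuous_on_beta_weight terminant_beta_kernel_continuous half y')
  have eq: "?k k = (1 / (1 + k)\<^sup>2) *\<^sub>R ?f (k / (1 + k))" if k: "k > 0" for k
  proof -
    define c where "c = 1 + k"
    have c: "c > 0" and complement: "1 - k / c = 1 / c" using k by (simp_all add: c_def field_simps)
    have r: "k / c \<in> {0<..<1}" using k by (simp add: c_def)
    have weight: "beta_weight (of_real (1/2) + of_real m) (of_real (1/2) - of_real m) (k / c) =
        of_real (k powr (m - 1/2) * c)"
      using beta_weight_of_real[OF r, of "1/2 + m" "1/2 - m", unfolded c_def frac_one_plus_powr[OF k]] k
      by (simp add: c_def)
    have "terminant (1/2) (of_real (2 * (k / c) * (1 / c) * y)) =
        of_real (sqrt pi * gauss_laplace 1 (2 * (k / c) * (1 / c) * y / 4))"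
      using k c y by (intro terminant_half_of_real) simp
    also have "gauss_laplace 1 (2 * (k / c) * (1 / c) * y / 4) = c * gauss_laplace c (k * y / 2)"
      using gauss_laplace_scale[OF c, of "2 * (k / c) * (1 / c) * y / 4"] k c y by (simp add: power2_eq_square)
    finally have "?f (k / c) = of_real (k powr (m - 1/2) * c) * of_real (sqrt pi * (c * gauss_laplace c (k * y / 2)))"
      unfolding weight complement by (simp only: of_real_mult)
    then show ?thesis
      using c unfolding c_def[symmetric] scaleR_conv_of_real by (simp only:) (simp add: power2_eq_square)
  qed
  have "terminant_beta (1/2) (of_real m) (of_real y) = (LINT k:{0<..}|lborel. ?k k)"
    unfolding terminant_beta_def by (rule set_integral_frac_one_plus(2)[OF cont int eq, symmetric])
  then show ?thesis
    by (simp only: set_integral_complex_of_real set_integral_mult_right)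
qed

definition euler_density :: "real \<Rightarrow> real \<Rightarrow> real \<Rightarrow> real" where
  "euler_density m x s = s powr (- m - 1/2) * (1 + s * (x / 2)) powr (- m - 1/2)"

lemma euler_density_nonneg: "euler_density m x s \<ge> 0"
  by (simp add: euler_density_def)

lemma euler_density_le:
  assumes "m > - 1/2" "x \<ge> 0" "s > 0"
  shows "euler_density m x s \<le> s powr (- m - 1/2)"
proof -
  have "(1 + s * (x / 2)) powr (- m - 1/2) \<le> 1 powr (- m - 1/2)"
    using assms by (intro powr_mono2') auto
  then show ?thesis
    unfolding euler_density_def by (intro mult_left_le) auto
qed

lemma continuous_on_euler_density:
  assumes "x \<ge> 0"
  shows "continuous_on {0<..} (euler_density m x)"
proof -
  have "1 + s * (x / 2) > 0" if "s > 0" for s using that assms by (simp add: add_pos_nonneg)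
  then show ?thesis
    unfolding euler_density_def by (intro continuous_intros) force+
qed

lemma euler_density_scale:
  assumes t: "t > 0"
  shows "t * euler_density m (x / t) (t * s) = t powr (1/2 - m) * euler_density m x s"
proof -
  have "t powr (1 + (- m - 1/2)) = t * t powr (- m - 1/2)"
    using t by (subst powr_add) simp
  moreover have "1 + (- m - 1/2) = 1/2 - m" by simp
  moreover have "(t * s) powr (- m - 1/2) = t powr (- m - 1/2) * s powr (- m - 1/2)" by (rule powr_mult)
  moreover have "t * s * (x / t / 2) = s * (x / 2)" using t by simp
  ultimately show ?thesis unfolding euler_density_def by (simp only: mult_ac)
qed

lemma euler_integrand_of_real:
  assumes "x \<ge> 0" "s > 0"
  shows "beta_prime_weight (1/2 - of_real m) (\<nu> + 1/2) s *
      (1 + of_real s * (of_real x / 2)) powr of_real (- m - 1/2) =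
    of_real (euler_density m x s) * of_real (1 + s) powr (- (\<nu> + 1 - of_real m))"
proof -
  have "(1 + complex_of_real s * (of_real x / 2)) powr of_real (- m - 1/2) =
      of_real ((1 + s * (x / 2)) powr (- m - 1/2))"
    using powr_of_real[of "1 + s * (x / 2)" "- m - 1/2"] assms by simp
  moreover have "beta_prime_weight (1/2 - of_real m) (\<nu> + 1/2) s =
      of_real (s powr (- m - 1/2)) * of_real (1 + s) powr (- (\<nu> + 1 - of_real m))"
    using powr_of_real[of s "- m - 1/2"] assms by (simp add: beta_prime_weight_def algebra_simps)
  ultimately show ?thesis
    by (simp only: euler_density_def of_real_mult mult_ac)
qed

lemma exp_euler_density_integrable:
  assumes m: "\<bar>m\<bar> < 1/2" and x: "x > 0"
  shows "set_integrable lborel {0<..} (\<lambda>u. exp (- u) * euler_density m x u)"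
proof (rule set_integrable_bound_continuous)
  show "continuous_on {0<..} (\<lambda>u. exp (- u) * euler_density m x u)"
    using x by (intro continuous_intros continuous_on_euler_density) simp
  show "set_integrable lborel {0<..} (\<lambda>u. u powr ((1/2 - m) - 1) * exp (- (1 * u)))"
    by (rule gamma_integral_real) (use m in auto)
  fix u :: real assume "u \<in> {0<..}"
  then show "norm (exp (- u) * euler_density m x u) \<le> u powr ((1/2 - m) - 1) * exp (- (1 * u))"
    using euler_density_le[of m x u] euler_density_nonneg[of m x u] m x by (simp add: abs_mult algebra_simps)
qed simp

lemma gamma_integral_euler_density:
  assumes m: "\<bar>m\<bar> < 1/2" and y: "y > 0" and u: "u > 0"
  shows "(LINT k:{0<..}|lborel. k powr (m - 1/2) * exp (- ((1 + k) * u) - k * y / 2 * u\<^sup>2)) =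
    Gamma (1/2 + m) * (exp (- u) * euler_density m y u)"
proof -
  define a where "a = u * (1 + u * (y / 2))"
  have a: "a > 0" using u y by (simp add: a_def add_pos_pos)
  have "k powr (m - 1/2) * exp (- ((1 + k) * u) - k * y / 2 * u\<^sup>2) =
      exp (- u) * (k powr ((1/2 + m) - 1) * exp (- (a * k)))" for k
    by (simp add: a_def exp_add[symmetric] exp_diff[symmetric] algebra_simps power2_eq_square)
  then have "(LINT k:{0<..}|lborel. k powr (m - 1/2) * exp (- ((1 + k) * u) - k * y / 2 * u\<^sup>2)) =
      exp (- u) * (Gamma (1/2 + m) * a powr (- (1/2 + m)))"
    using gamma_integral_real(2)[OF _ a, of "1/2 + m"] m by (simp only: set_integral_mult_right)
  also have "- (1/2 + m) = - m - 1/2" by simp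
  also have "a powr (- m - 1/2) = euler_density m y u"
    unfolding a_def euler_density_def by (rule powr_mult)
  finally show ?thesis by (simp add: mult_ac)
qed

lemma terminant_beta_half_of_real:
  assumes m: "\<bar>m\<bar> < 1/2" and y: "y > 0"
  shows "terminant_beta (1/2) (of_real m) (of_real y) =
    of_real (sqrt pi * Gamma (1/2 + m) * (LINT u:{0<..}|lborel. exp (- u) * euler_density m y u))"
proof -
  let ?F = "\<lambda>k u::real. k powr (m - 1/2) * exp (- ((1 + k) * u) - k * y / 2 * u\<^sup>2)"
  let ?h = "\<lambda>k. k powr ((1/2 + m) - 1) * (1 + k) powr (- ((1/2 + m) + (1/2 - m)))"
  have "(LINT k:{0<..}|lborel. k powr (m - 1/2) * gauss_laplace (1 + k) (k * y / 2)) =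
      (LINT k:{0<..}|lborel. LINT u:{0<..}|lborel. ?F k u)"
    by (simp only: gauss_laplace_def set_integral_mult_right)
  also have "\<dots> = (LINT u:{0<..}|lborel. LINT k:{0<..}|lborel. ?F k u)"
  proof (rule set_integral_Fubini)
    show "continuous_on ({0<..} \<times> {0<..}) (\<lambda>p. ?F (fst p) (snd p))"
      by (intro continuous_intros) auto
    show "set_integrable lborel {0<..} (?F k)" if "k \<in> {0<..}" for k
      by (intro set_integrable_mult_right gauss_laplace_integrable) (use that y in auto)
    show "set_integrable lborel {0<..} ?h"
      using m by (intro beta_prime_integral_real) auto
    show "(LINT u:{0<..}|lborel. norm (?F k u)) \<le> ?h k" if k: "k \<in> {0<..}" for k
    proof -
      have "(LINT u:{0<..}|lborel. norm (?F k u)) = k powr (m - 1/2) * gauss_laplace (1 + k) (k * y / 2)"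
        by (simp add: gauss_laplace_def abs_mult)
      also have "\<dots> \<le> k powr (m - 1/2) * inverse (1 + k)"
        using k y by (intro mult_left_mono gauss_laplace_le) auto
      finally show ?thesis using k by (simp add: powr_minus)
    qed
  qed auto
  also have "\<dots> = (LINT u:{0<..}|lborel. Gamma (1/2 + m) * (exp (- u) * euler_density m y u))"
    by (intro set_lebesgue_integral_cong allI impI)
       (simp, simp only: gamma_integral_euler_density[OF m y] greaterThan_iff)
  finally show ?thesis
    unfolding terminant_beta_half_gauss_laplace[OF m y] by (simp only: set_integral_mult_right mult.assoc)
qed

lemma terminant_beta_half_scaled:
  assumes m: "\<bar>m\<bar> < 1/2" and x: "x > 0" and t: "t > 0"
  shows "terminant_beta (1/2) (of_real m) (of_real x / of_real t) = of_real (sqrt pi * Gamma (1/2 + m) *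
    (t powr (1/2 - m) * (LINT s:{0<..}|lborel. exp (- (t * s)) * euler_density m x s)))"
proof -
  have "x / t > 0" using x t by simp
  then have int: "set_integrable lborel {0<..} (\<lambda>u. exp (- u) * euler_density m (x / t) u)"
    by (rule exp_euler_density_integrable[OF m])
  have "(LINT u:{0<..}|lborel. exp (- u) * euler_density m (x / t) u) =
      t * (LINT s:{0<..}|lborel. exp (- (t * s)) * euler_density m (x / t) (t * s))"
    unfolding set_integral_scale_Ioi(2)[OF t int] using t by simp
  also have "\<dots> = (LINT s:{0<..}|lborel. exp (- (t * s)) * (t * euler_density m (x / t) (t * s)))"
    by (simp only: set_integral_mult_right[symmetric] mult.left_commute)
  also have "\<dots> = t powr (1/2 - m) * (LINT s:{0<..}|lborel. exp (- (t * s)) * euler_density m x s)"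
    by (simp only: euler_density_scale[OF t] set_integral_mult_right[symmetric] mult.left_commute)
  finally show ?thesis
    using terminant_beta_half_of_real[OF m \<open>x / t > 0\<close>] by simp
qed

lemma euler_integral_Laplace:
  assumes m: "\<bar>m\<bar> < 1/2" and \<nu>: "Re \<nu> > - 1/2" and x: "x > 0"
  shows "(LINT t:{0<..}|lborel. LINT s:{0<..}|lborel. of_real (euler_density m x s) *
      gamma_weight (\<nu> + 1 - of_real m) (of_real (1 + s)) t) =
    Gamma (\<nu> + 1 - of_real m) * euler_integral m \<nu> (of_real x)"
proof -
  let ?z = "\<nu> + 1 - complex_of_real m"
  let ?f = "\<lambda>s t. of_real (euler_density m x s) * gamma_weight ?z (of_real (1 + s)) t"
  let ?w = "beta_prime_weight (1/2 - of_real m) (\<nu> + 1/2)"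
  have z: "Re ?z > 0" using m \<nu> by simp
  have Re_pos: "Re (complex_of_real (1 + s)) > 0" if "s \<in> {0<..}" for s using that by simp
  have "(LINT s:{0<..}|lborel. LINT t:{0<..}|lborel. ?f s t) = (LINT t:{0<..}|lborel. LINT s:{0<..}|lborel. ?f s t)"
  proof (rule set_integral_Fubini)
    have cont: "continuous_on {0<..} (euler_density m x)"
      using x by (intro continuous_on_euler_density) simp
    have "continuous_on ({0<..} \<times> {0<..}) (\<lambda>p. complex_of_real (euler_density m x (fst p)))"
      by (intro continuous_intros continuous_on_compose2[OF cont]) auto
    moreover have "continuous_on ({0<..} \<times> {0<..}) (\<lambda>p. gamma_weight ?z (of_real (1 + fst p)) (snd p))"
      unfolding gamma_weight_def by (intro continuous_intros) auto
    ultimately show "continuous_on ({0<..} \<times> {0<..}) (\<lambda>p. ?f (fst p) (snd p))"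
      by (intro continuous_on_mult)
    show "set_integrable lborel {0<..} (?f s)" if "s \<in> {0<..}" for s
      by (intro set_integrable_mult_right integral_weight.integrable[OF integral_weight_gamma[OF z Re_pos[OF that]]])
    show "set_integrable lborel {0<..} (\<lambda>s. Gamma (Re ?z) * norm (?w s))"
      by (intro set_integrable_mult_right integral_weight.norm_integrable[OF integral_weight_euler[OF m \<nu>]])
    show "(LINT t:{0<..}|lborel. norm (?f s t)) \<le> Gamma (Re ?z) * norm (?w s)" if s: "s \<in> {0<..}" for s
    proof -
      have "(LINT t:{0<..}|lborel. norm (?f s t)) = euler_density m x s * (Gamma (Re ?z) * (1 + s) powr (- Re ?z))"
        using integral_norm_gamma_weight[OF z Re_pos[OF s]] euler_density_nonneg[of m x s]
        by (simp only: norm_mult set_integral_mult_right norm_of_real abs_of_nonneg) simp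
      also have "\<dots> \<le> s powr (- m - 1/2) * (Gamma (Re ?z) * (1 + s) powr (- Re ?z))"
        using z s m x by (intro mult_right_mono euler_density_le) (auto simp: Gamma_real_pos less_imp_le)
      also have "\<dots> = Gamma (Re ?z) * norm (?w s)"
        using s norm_beta_prime_weight[of s "1/2 - of_real m" "\<nu> + 1/2"] by (simp add: algebra_simps)
      finally show ?thesis .
    qed
  qed auto
  moreover have "(LINT s:{0<..}|lborel. LINT t:{0<..}|lborel. ?f s t) =
      (LINT s:{0<..}|lborel. Gamma ?z * (?w s * (1 + of_real s * (of_real x / 2)) powr of_real (- m - 1/2)))"
    using x
    by (intro set_lebesgue_integral_cong allI impI)
       (simp, simp only: set_integral_mult_right integral_gamma_weight[OF z Re_pos] euler_integrand_of_real
          greaterThan_iff less_imp_le mult.left_commute)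
  ultimately show ?thesis
    by (simp only: euler_integral_def set_integral_mult_right)
qed

lemma gamma_weight_terminant_beta_half:
  assumes m: "\<bar>m\<bar> < 1/2" and x: "x > 0" and t: "t > 0"
  shows "gamma_weight (\<nu> + 1/2) 1 t * terminant_beta (1/2) (of_real m) (of_real x / of_real t) =
    of_real (sqrt pi * Gamma (1/2 + m)) *
      (LINT s:{0<..}|lborel. of_real (euler_density m x s) * gamma_weight (\<nu> + 1 - of_real m) (of_real (1 + s)) t)"
proof -
  let ?z = "\<nu> + 1 - complex_of_real m"
  have "complex_of_real t powr (?z - 1) = of_real t powr (\<nu> + 1/2 - 1) * of_real (t powr (1/2 - m))"
    using t powr_add[of "complex_of_real t" "\<nu> + 1/2 - 1" "of_real (1/2 - m)"] powr_of_real[of t "1/2 - m"]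
    by (simp add: algebra_simps)
  moreover have "exp (- (complex_of_real (1 + s) * of_real t)) =
      exp (- (1 * of_real t)) * of_real (exp (- (t * s)))" for s
    by (simp add: exp_of_real[symmetric] exp_add[symmetric] algebra_simps)
  ultimately have "of_real (euler_density m x s) * gamma_weight ?z (of_real (1 + s)) t =
      gamma_weight (\<nu> + 1/2) 1 t * of_real (t powr (1/2 - m)) * of_real (exp (- (t * s)) * euler_density m x s)" for s
    by (simp only: gamma_weight_def of_real_mult mult_ac)
  then have "(LINT s:{0<..}|lborel. of_real (euler_density m x s) * gamma_weight ?z (of_real (1 + s)) t) =
      gamma_weight (\<nu> + 1/2) 1 t * of_real (t powr (1/2 - m)) *
          of_real (LINT s:{0<..}|lborel. exp (- (t * s)) * euler_density m x s)"
    by (simp only: set_integral_mult_right set_integral_complex_of_real)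
  then show ?thesis
    by (simp only: terminant_beta_half_scaled[OF m x t] of_real_mult mult_ac)
qed

lemma legendre_rem_0_euler_pos:
  assumes m: "\<bar>m\<bar> < 1/2" and \<nu>: "Re \<nu> > - 1/2" and x: "x > 0"
  shows "legendre_rem 0 (of_real x) (of_real m) \<nu> =
    Gamma (\<nu> + 1 - of_real m) * rGamma (1/2 - of_real m) * euler_integral m \<nu> (of_real x)"
proof -
  let ?E = "Gamma (\<nu> + 1 - of_real m) * euler_integral m \<nu> (of_real x)"
  have "(LINT t:{0<..}|lborel. gamma_weight (\<nu> + 1/2) 1 t *
      terminant_beta (1/2) (of_real m) (of_real x / of_real t)) =
      (LINT t:{0<..}|lborel. of_real (sqrt pi * Gamma (1/2 + m)) *
        (LINT s:{0<..}|lborel. of_real (euler_density m x s) * gamma_weight (\<nu> + 1 - of_real m) (of_real (1 + s)) t))"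
    using gamma_weight_terminant_beta_half[OF m x] by (intro set_lebesgue_integral_cong) simp_all
  also have "\<dots> = of_real (sqrt pi * Gamma (1/2 + m)) * ?E"
    by (simp only: set_integral_mult_right euler_integral_Laplace[OF m \<nu> x])
  finally have "legendre_rem 0 (of_real x) (of_real m) \<nu> =
      of_real (cos (pi * m) / (pi * sqrt pi)) * (of_real (sqrt pi * Gamma (1/2 + m)) * ?E)"
    by (simp add: legendre_rem_def pi_powr_three_halves of_real_cos_pi)
  also have "\<dots> = of_real (cos (pi * m) / pi * Gamma (1/2 + m)) * ?E"
    by (simp add: field_simps)
  also have "complex_of_real (cos (pi * m) / pi * Gamma (1/2 + m)) = rGamma (1/2 - of_real m)"
  proof -
    have "Gamma (1/2 + complex_of_real m) = of_real (Gamma (1/2 + m))"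
      by (simp flip: Gamma_complex_of_real)
    moreover have "1/2 + complex_of_real m \<notin> \<int>\<^sub>\<le>\<^sub>0" using m by (intro notin_nonpos_Ints_Re) simp
    then have "rGamma (1/2 - of_real m) =
        (rGamma (1/2 - of_real m) * rGamma (1/2 + of_real m)) * Gamma (1/2 + complex_of_real m)"
      by (simp add: rGamma_inverse_Gamma[of "1/2 + _"] Gamma_eq_zero_iff)
    ultimately show ?thesis
      unfolding rGamma_half_reflection of_real_cos_pi by simp
  qed
  finally show ?thesis by (simp only: mult_ac)
qed

lemma connected_Compl_nonpos_Reals: "connected (- \<real>\<^sub>\<le>\<^sub>0 :: complex set)"
proof -
  have "- \<real>\<^sub>\<le>\<^sub>0 = (\<lambda>w. 1 - w) ` slit_plane"
  proof (intro equalityI subsetI)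
    fix z :: complex assume "z \<in> - \<real>\<^sub>\<le>\<^sub>0"
    then have "1 - z \<in> slit_plane" by (auto simp: slit_plane_def complex_nonpos_Reals_iff complex_eq_iff)
    then show "z \<in> (\<lambda>w. 1 - w) ` slit_plane" by (rule rev_image_eqI) simp
  next
    fix z assume "z \<in> (\<lambda>w. 1 - w) ` slit_plane"
    then obtain w where w: "w \<in> slit_plane" "z = 1 - w" by blast
    have "w = of_real (Re w)" if "z \<in> \<real>\<^sub>\<le>\<^sub>0"
      using that w(2) by (simp add: complex_nonpos_Reals_iff complex_eq_iff)
    then show "z \<in> - \<real>\<^sub>\<le>\<^sub>0"
      using w by (auto simp: slit_plane_def complex_nonpos_Reals_iff)
  qed
  moreover have "continuous_on slit_plane (\<lambda>w. 1 - w)"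
    by (intro continuous_intros)
  ultimately show ?thesis
    using connected_continuous_image connected_slit_plane by metis
qed

lemma legendre_rem_0_euler:
  assumes m: "\<bar>m\<bar> < 1/2" and \<nu>: "Re \<nu> > - 1/2" and x: "x \<notin> \<real>\<^sub>\<le>\<^sub>0"
  shows "legendre_rem 0 x (of_real m) \<nu> =
    Gamma (\<nu> + 1 - of_real m) * rGamma (1/2 - of_real m) * euler_integral m \<nu> x"
proof (rule analytic_continuation_from_reals[where S = "- \<real>\<^sub>\<le>\<^sub>0" and a = 0 and b = 1
      and f = "\<lambda>x. legendre_rem 0 x (of_real m) \<nu>"
      and g = "\<lambda>x. Gamma (\<nu> + 1 - of_real m) * rGamma (1/2 - of_real m) * euler_integral m \<nu> x"])
  show "(\<lambda>x. legendre_rem 0 x (of_real m) \<nu>) holomorphic_on - \<real>\<^sub>\<le>\<^sub>0"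
    using m \<nu> by (intro legendre_rem_holomorphic) auto
  show "(\<lambda>x. Gamma (\<nu> + 1 - of_real m) * rGamma (1/2 - of_real m) * euler_integral m \<nu> x) holomorphic_on - \<real>\<^sub>\<le>\<^sub>0"
    using m \<nu> by (intro holomorphic_intros euler_integral_holomorphic) auto
qed (use m \<nu> x connected_Compl_nonpos_Reals legendre_rem_0_euler_pos in auto)

section \<open>The Mehler contour\<close>

lemma set_integral_line_primitive:
  fixes f A :: "complex \<Rightarrow> complex"
  assumes "a \<le> b" and A: "\<And>x. x \<in> {a..b} \<Longrightarrow> (A has_field_derivative f (p + of_real x * v)) (at (p + of_real x * v))"
    and f: "continuous_on {a..b} (\<lambda>x. f (p + of_real x * v))"
  shows "(LINT x:{a..b}|lborel. v * f (p + of_real x * v)) = A (p + of_real b * v) - A (p + of_real a * v)"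
  unfolding set_lebesgue_integral_def
proof (rule integral_FTC_atLeastAtMost[OF \<open>a \<le> b\<close>])
  show "continuous_on {a..b} (\<lambda>x. v * f (p + of_real x * v))"
    by (intro continuous_intros f)
  fix x assume "a \<le> x" "x \<le> b"
  then have "(A has_field_derivative f (p + of_real x * v)) (at (p + of_real x * v))"
    using A by simp
  moreover have "((\<lambda>x. p + of_real x * v) has_vector_derivative v) (at x)"
    by (auto intro!: derivative_eq_intros simp: has_vector_derivative_def scaleR_conv_of_real)
  ultimately have "((\<lambda>x. A (p + of_real x * v)) has_vector_derivative v * f (p + of_real x * v)) (at x)"
    using field_vector_diff_chain_at by (fastforce simp: o_def)
  then show "((\<lambda>x. A (p + of_real x * v)) has_vector_derivative v * f (p + of_real x * v)) (at x within {a..b})"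
    by (rule has_vector_derivative_at_within)
qed

lemma set_integral_line_primitive_limit:
  fixes f A :: "complex \<Rightarrow> complex"
  assumes A: "\<And>x. x \<in> S \<Longrightarrow> (A has_field_derivative f (p + of_real x * v)) (at (p + of_real x * v))"
    and f: "continuous_on S (\<lambda>x. f (p + of_real x * v))" "set_integrable lborel S (\<lambda>x. f (p + of_real x * v))"
    and lu: "decseq l" "incseq u" "\<And>n::nat. l n \<le> u n" and S: "(\<Union>n. {l n..u n}) = S"
  shows "(\<lambda>n. A (p + of_real (u n) * v) - A (p + of_real (l n) * v)) \<longlonglongrightarrow> (LINT x:S|lborel. v * f (p + of_real x * v))"
proof -
  have sub: "{l n..u n} \<subseteq> S" for n using S by blast
  have "incseq (\<lambda>n. {l n..u n})"
    using lu(1,2) by (simp add: incseq_def decseq_def)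
  moreover have "set_integrable lborel (\<Union>n. {l n..u n}) (\<lambda>x. v * f (p + of_real x * v))"
    unfolding S by (intro set_integrable_mult_right f)
  ultimately have "(\<lambda>n. LINT x:{l n..u n}|lborel. v * f (p + of_real x * v)) \<longlonglongrightarrow>
      (LINT x:(\<Union>n. {l n..u n})|lborel. v * f (p + of_real x * v))"
    by (intro set_integral_cont_up) auto
  moreover have "(LINT x:{l n..u n}|lborel. v * f (p + of_real x * v)) =
      A (p + of_real (u n) * v) - A (p + of_real (l n) * v)" for n
    using sub[of n] by (intro set_integral_line_primitive lu(3) A continuous_on_subset[OF f(1)]) auto
  ultimately show ?thesis unfolding S by simp
qed

lemma has_field_derivative_bounded_below:
  fixes f :: "complex \<Rightarrow> complex"
  assumes "(f has_field_derivative D) (at z)" "D \<noteq> 0"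
  obtains \<delta> where "\<delta> > 0" "\<And>w. norm (w - z) < \<delta> \<Longrightarrow> norm (f w - f z) \<ge> norm D / 2 * norm (w - z)"
proof -
  have "((\<lambda>w. norm ((f w - f z) / (w - z))) \<longlongrightarrow> norm D) (at z)"
    using assms(1) by (intro tendsto_norm) (simp add: has_field_derivative_iff)
  then have "\<forall>\<^sub>F w in at z. norm ((f w - f z) / (w - z)) > norm D / 2"
    using assms(2) by (intro order_tendstoD) auto
  then obtain \<delta> where \<delta>: "\<delta> > 0" "\<And>w. w \<noteq> z \<Longrightarrow> dist w z < \<delta> \<Longrightarrow> norm ((f w - f z) / (w - z)) > norm D / 2"
    unfolding eventually_at by blast
  show ?thesis
  proof (rule that[OF \<delta>(1)])
    fix w assume "norm (w - z) < \<delta>"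
    then show "norm (f w - f z) \<ge> norm D / 2 * norm (w - z)"
      using \<delta>(2)[of w] by (cases "w = z") (auto simp: dist_norm norm_divide field_simps)
  qed
qed

lemma Re_cosh: "Re (cosh t) = cosh (Re t) * cos (Im t)"
  and Im_cosh: "Im (cosh t) = sinh (Re t) * sin (Im t)"
  by (simp_all add: cosh_def sinh_def Re_exp Im_exp algebra_simps)

text \<open>A complex number \<open>v\<close> with \<open>v\<^sup>2 = -1\<close> stands for the choice of sign in \<open>\<plusminus>\<i>\<close>.\<close>

lemma square_eq_minus_one_iff: "v\<^sup>2 = - 1 \<longleftrightarrow> v = \<i> \<or> v = - \<i>"
  using power2_eq_iff[of v \<i>] by simp

lemma exp_of_real_mult_unit:
  fixes v :: complex
  assumes "v\<^sup>2 = - 1"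
  shows "exp (of_real b * v) = of_real (cos b) + v * of_real (sin b)"
    and "exp (- (of_real b * v)) = of_real (cos b) - v * of_real (sin b)"
  using assms exp_Euler[of "of_real b"] exp_minus_Euler[of "of_real b"]
  by (auto simp: square_eq_minus_one_iff cos_of_real sin_of_real mult.commute)

definition mehler_kernel :: "real \<Rightarrow> real \<Rightarrow> complex \<Rightarrow> complex \<Rightarrow> complex" where
  "mehler_kernel b m \<nu> t = exp ((\<nu> + 1/2) * t) * (cosh t - of_real (cos b)) powr of_real (- m - 1/2)"

definition mehler_domain :: "real \<Rightarrow> complex set" where
  "mehler_domain b = {t. \<bar>Im t\<bar> < pi \<and> (Re t = 0 \<longrightarrow> \<bar>Im t\<bar> < b)}"

lemma open_mehler_domain: "open (mehler_domain b)"
proof -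
  have "mehler_domain b = {t. \<bar>Im t\<bar> < pi} \<inter> ({t. Re t \<noteq> 0} \<union> {t. \<bar>Im t\<bar> < b})"
    by (auto simp: mehler_domain_def)
  moreover have "open ({t. \<bar>Im t\<bar> < pi} \<inter> ({t. Re t \<noteq> 0} \<union> {t. \<bar>Im t\<bar> < b}))"
    by (intro open_Int open_Un open_Collect_less open_Collect_neq continuous_intros)
  ultimately show ?thesis by simp
qed

lemma starlike_mehler_domain:
  assumes "b > 0"
  shows "starlike (mehler_domain b)"
  unfolding starlike_def
proof (intro bexI[of _ 0] ballI subsetI)
  fix t w assume t: "t \<in> mehler_domain b" and "w \<in> closed_segment 0 t"
  then obtain u where u: "0 \<le> u" "u \<le> 1" "w = of_real u * t"
    by (auto simp: in_segment scaleR_conv_of_real)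
  then have "\<bar>Im w\<bar> \<le> \<bar>Im t\<bar>"
    by (simp add: abs_mult mult_left_le_one_le)
  then show "w \<in> mehler_domain b"
    using t u assms by (auto simp: mehler_domain_def)
qed (use assms in \<open>simp add: mehler_domain_def\<close>)

lemma cosh_minus_cos_notin_nonpos_Reals:
  assumes b: "0 < b" "b < pi" and t: "t \<in> mehler_domain b"
  shows "cosh t - of_real (cos b) \<notin> \<real>\<^sub>\<le>\<^sub>0"
proof
  assume "cosh t - of_real (cos b) \<in> \<real>\<^sub>\<le>\<^sub>0"
  then have le: "cosh (Re t) * cos (Im t) \<le> cos b" and Im_0: "sinh (Re t) = 0 \<or> sin (Im t) = 0"
    by (auto simp: complex_nonpos_Reals_iff Re_cosh Im_cosh)
  have Im_t: "\<bar>Im t\<bar> < pi" using t by (simp add: mehler_domain_def)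
  show False
  proof (cases "Re t = 0")
    case True
    then have "cos b < cos \<bar>Im t\<bar>"
      using t b by (intro cos_monotone_0_pi) (auto simp: mehler_domain_def)
    then show False using le True by simp
  next
    case False
    then have "sin (Im t) = 0" using Im_0 by simp
    then have "Im t = 0" by (rule sin_eq_0_pi[rotated 2]) (use Im_t in linarith)+
    then have "1 \<le> cos b" using le cosh_real_ge_1[of "Re t"] by simp
    then show False using b cos_monotone_0_pi[of 0 b] by simp
  qed
qed

lemma mehler_kernel_holomorphic:
  assumes "0 < b" "b < pi"
  shows "mehler_kernel b m \<nu> holomorphic_on mehler_domain b"
  unfolding mehler_kernel_def cosh_field_def[abs_def]
  by (intro holomorphic_intros) (use cosh_minus_cos_notin_nonpos_Reals[OF assms] in \<open>auto simp: cosh_field_def\<close>)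

lemma mehler_kernel_primitive:
  assumes "0 < b" "b < pi"
  obtains A where "\<And>t. t \<in> mehler_domain b \<Longrightarrow> (A has_field_derivative mehler_kernel b m \<nu> t) (at t)"
proof -
  have "\<exists>A. \<forall>t\<in>mehler_domain b. (A has_field_derivative mehler_kernel b m \<nu> t) (at t)"
    using mehler_kernel_holomorphic[OF assms] open_mehler_domain
    by (intro holomorphic_starlike_primitive[where k = "{}"] starlike_mehler_domain
      holomorphic_on_imp_continuous_on assms)
       (auto intro: holomorphic_on_imp_differentiable_at)
  then show ?thesis using that by blast
qed

lemma norm_mehler_kernel_le:
  assumes "\<bar>Im t\<bar> < pi" "m > - 1/2" "d > 0" "norm (cosh t - of_real (cos b)) \<ge> d"
  shows "norm (mehler_kernel b m \<nu> t) \<le> exp (pi * \<bar>Im \<nu>\<bar>) * (exp ((Re \<nu> + 1/2) * Re t) * d powr (- m - 1/2))"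
proof -
  have "- (Im \<nu> * Im t) \<le> \<bar>Im t\<bar> * \<bar>Im \<nu>\<bar>"
    by (metis abs_ge_minus_self abs_mult mult.commute)
  also have "\<dots> \<le> pi * \<bar>Im \<nu>\<bar>"
    using assms(1) by (intro mult_right_mono) auto
  finally have "norm (exp ((\<nu> + 1/2) * t)) \<le> exp (pi * \<bar>Im \<nu>\<bar>) * exp ((Re \<nu> + 1/2) * Re t)"
    by (simp add: exp_add[symmetric])
  moreover have "norm ((cosh t - of_real (cos b)) powr of_real (- m - 1/2)) =
      norm (cosh t - of_real (cos b)) powr (- m - 1/2)"
    by (subst norm_powr_real_powr') auto
  moreover have "norm (cosh t - of_real (cos b)) powr (- m - 1/2) \<le> d powr (- m - 1/2)"
    using assms(2-4) by (intro powr_mono2') auto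
  ultimately show ?thesis
    unfolding mehler_kernel_def norm_mult mult.assoc[symmetric] by (intro mult_mono) auto
qed

lemma set_integral_exp_minus_one:
  fixes f k :: "real \<Rightarrow> 'b::euclidean_space"
  assumes "continuous_on {0<..} f" "set_integrable lborel {0<..} f"
    and k: "\<And>\<theta>. \<theta> < 0 \<Longrightarrow> k \<theta> = exp (- \<theta>) *\<^sub>R f (exp (- \<theta>) - 1)"
  shows "set_integrable lborel {..<0} k" and "(LINT \<theta>:{..<0}|lborel. k \<theta>) = (LINT s:{0<..}|lborel. f s)"
proof -
  let ?g = "\<lambda>\<theta>::real. exp (- \<theta>) - 1"
  have im: "?g ` {..<0} = {0<..}"
  proof (intro equalityI subsetI)
    fix s :: real assume "s \<in> {0<..}"
    then show "s \<in> ?g ` {..<0}" by (intro image_eqI[of _ _ "- ln (1 + s)"]) auto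
  qed auto
  have der: "(?g has_field_derivative - exp (- \<theta>)) (at \<theta>)" for \<theta>
    by (auto intro!: derivative_eq_intros)
  have "inj_on ?g {..<0}" "continuous_on {..<0} (\<lambda>\<theta>::real. - exp (- \<theta>))"
    by (auto intro!: inj_onI continuous_intros)
  note sub = set_integral_substitution[OF _ _ im this(1) der this(2) assms(1,2), of k]
  show "set_integrable lborel {..<0} k" "(LINT \<theta>:{..<0}|lborel. k \<theta>) = (LINT s:{0<..}|lborel. f s)"
    using sub k by simp_all
qed

lemma mult_powr_Re_nonneg:
  assumes "w \<noteq> 0" "Re w \<ge> 0" "Re y > 0"
  shows "(w * y) powr a = w powr a * y powr a"
proof -
  have y: "y \<noteq> 0" using assms by auto
  have "\<bar>Im (Ln w)\<bar> \<le> pi / 2" using Re_Ln_pos_le[OF assms(1)] assms(2) by simp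
  moreover have "\<bar>Im (Ln y)\<bar> < pi / 2" using Re_Ln_pos_lt[OF y] assms(3) by simp
  ultimately have "Ln (w * y) = Ln w + Ln y"
    by (intro Ln_times_simple) (use assms y in \<open>auto simp: abs_le_iff abs_less_iff\<close>)
  then show ?thesis using assms(1) y by (simp add: powr_def exp_add[symmetric] algebra_simps)
qed

lemma cosh_minus_cos_ray:
  fixes v :: complex
  assumes v: "v\<^sup>2 = - 1" and "\<theta> < 0" and b: "sin b \<noteq> 0" and s: "s = exp (- \<theta>) - 1"
  shows "cosh (of_real \<theta> + of_real b * v) - of_real (cos b) =
    of_real (s / (1 + s)) * (- v * of_real (sin b) * (1 + of_real s * ((1 + v * of_real (cot b)) / 2)))"
proof -
  define S C T where "S = complex_of_real (sin b)" and "C = complex_of_real (cos b)" and "T = complex_of_real (1 + s)"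
  have "1 + s \<noteq> 0" unfolding s by simp
  then have T: "T \<noteq> 0" "of_real s = T - 1" by (simp_all only: T_def of_real_eq_0_iff) simp_all
  have S: "S \<noteq> 0" using b by (simp add: S_def)
  define X Y where "X = v * S" and "Y = v * (C / S)"
  have "X * Y = v\<^sup>2 * C" using S by (simp add: X_def Y_def power2_eq_square)
  then have XY: "X * Y = - C" using v by simp
  have "exp (of_real \<theta>) = 1 / T" "exp (- of_real \<theta>) = T"
    by (simp_all add: T_def s exp_of_real[symmetric] exp_minus divide_inverse)
  then have "exp (of_real \<theta> + of_real b * v) = (C + v * S) / T"
    "exp (- (of_real \<theta> + of_real b * v)) = T * (C - v * S)"
    by (simp_all only: minus_add_distrib exp_add exp_of_real_mult_unit[OF v] S_def C_def) simp_all
  then have "cosh (of_real \<theta> + of_real b * v) - C = ((C + v * S) / T + T * (C - v * S)) / 2 - C"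
    unfolding cosh_field_def by simp
  also have "\<dots> = (T - 1) / T * (- X - (T - 1) * ((X + X * Y) / 2))"
    unfolding XY X_def[symmetric] using T(1) by (simp add: field_simps)
  also have "- X - (T - 1) * ((X + X * Y) / 2) = - v * S * (1 + (T - 1) * ((1 + v * (C / S)) / 2))"
    unfolding Y_def[symmetric] mult_minus_left X_def[symmetric] by (simp add: algebra_simps)
  also have "C / S = of_real (cot b)" by (simp add: C_def S_def cot_def)
  also have "(T - 1) / T = of_real (s / (1 + s))" by (simp only: of_real_divide T_def[symmetric] T(2))
  finally show ?thesis
    by (simp only: S_def C_def T(2))
qed

lemma of_real_exp_powr: "complex_of_real (exp x) powr z = exp (z * of_real x)"
  by (simp add: powr_def exp_of_real[symmetric] Ln_of_real)

lemma mehler_kernel_ray: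
  assumes v: "v\<^sup>2 = - 1" and \<theta>: "\<theta> < 0" and b: "sin b \<noteq> 0"
  shows "mehler_kernel b m \<nu> (of_real \<theta> + of_real b * v) = exp (- \<theta>) *\<^sub>R
    (exp ((\<nu> + 1/2) * (of_real b * v)) * (- v * of_real (sin b)) powr of_real (- m - 1/2) *
     (beta_prime_weight (1/2 - of_real m) (\<nu> + 1/2) (exp (- \<theta>) - 1) *
      (1 + of_real (exp (- \<theta>) - 1) * ((1 + v * of_real (cot b)) / 2)) powr of_real (- m - 1/2)))"
proof -
  define s a where "s = exp (- \<theta>) - 1" and "a = complex_of_real (- m - 1/2)"
  let ?w = "- v * complex_of_real (sin b)" and ?y = "1 + of_real s * ((1 + v * of_real (cot b)) / 2)"
  have s: "s > 0" "exp (- \<theta>) = 1 + s" using \<theta> by (simp_all add: s_def)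
  have v': "v \<noteq> 0" "Re v = 0"
    using v by (auto simp: square_eq_minus_one_iff)
  have Re_y: "Re ?y > 0" using s v'(2) by simp
  have T_powr: "complex_of_real (1 + s) powr z = exp (- (z * of_real \<theta>))" for z
    using of_real_exp_powr[of "- \<theta>" z] by (simp add: s(2))
  have T: "complex_of_real (1 + s) = exp (- of_real \<theta>)"
    unfolding s(2)[symmetric] by (simp add: exp_of_real[symmetric])
  have "(cosh (of_real \<theta> + of_real b * v) - of_real (cos b)) powr a = of_real (s / (1 + s)) powr a * (?w * ?y) powr a"
    unfolding cosh_minus_cos_ray[OF v \<theta> b s_def] using s by (intro powr_times_real_left) auto
  also have "of_real (s / (1 + s)) powr a = of_real s powr a / of_real (1 + s) powr a"
    using s powr_of_real[of s "- m - 1/2"] powr_of_real[of "1 + s" "- m - 1/2"]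
      powr_of_real[of "s / (1 + s)" "- m - 1/2"]
    by (simp only: a_def powr_divide) (simp add: powr_divide)
  also have "(?w * ?y) powr a = ?w powr a * ?y powr a"
    using v' b Re_y by (intro mult_powr_Re_nonneg) auto
  finally have kernel: "mehler_kernel b m \<nu> (of_real \<theta> + of_real b * v) =
      exp ((\<nu> + 1/2) * (of_real \<theta> + of_real b * v)) / of_real (1 + s) powr a *
      (of_real s powr a * (?w powr a * ?y powr a))"
    unfolding mehler_kernel_def a_def by (simp only: times_divide_eq_left times_divide_eq_right)
  have "exp ((\<nu> + 1/2) * (of_real \<theta> + of_real b * v)) / of_real (1 + s) powr a =
      exp ((\<nu> + 1/2) * (of_real b * v)) *
          (of_real (1 + s) * of_real (1 + s) powr (- ((1/2 - of_real m) + (\<nu> + 1/2))))"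
    unfolding T_powr unfolding T by (simp add: a_def exp_add[symmetric] exp_diff[symmetric] algebra_simps)
  moreover have "beta_prime_weight (1/2 - of_real m) (\<nu> + 1/2) s =
      of_real s powr a * of_real (1 + s) powr (- ((1/2 - of_real m) + (\<nu> + 1/2)))"
    by (simp only: beta_prime_weight_def a_def of_real_diff of_real_minus) (simp add: algebra_simps)
  ultimately show ?thesis
    unfolding kernel s_def[symmetric] unfolding s(2) a_def[symmetric] scaleR_conv_of_real by (simp only: mult_ac)
qed

lemma mehler_kernel_ray_integral:
  assumes m: "\<bar>m\<bar> < 1/2" and \<nu>: "Re \<nu> > - 1/2" and b: "sin b \<noteq> 0" and v: "v\<^sup>2 = - 1"
  shows "set_integrable lborel {..<0} (\<lambda>\<theta>. mehler_kernel b m \<nu> (of_real \<theta> + of_real b * v))"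
    and "(LINT \<theta>:{..<0}|lborel. mehler_kernel b m \<nu> (of_real \<theta> + of_real b * v)) =
      exp ((\<nu> + 1/2) * (of_real b * v)) * (- v * of_real (sin b)) powr of_real (- m - 1/2) *
      euler_integral m \<nu> (1 + v * of_real (cot b))"
proof -
  let ?x = "1 + v * complex_of_real (cot b)"
  let ?K = "exp ((\<nu> + 1/2) * (of_real b * v)) * (- v * of_real (sin b)) powr of_real (- m - 1/2)"
  let ?f = "\<lambda>s. beta_prime_weight (1/2 - of_real m) (\<nu> + 1/2) s * (1 + of_real s * (?x / 2)) powr of_real (- m - 1/2)"
  have "?x \<notin> \<real>\<^sub>\<le>\<^sub>0"
    using v by (intro notin_nonpos_Reals_Re) (auto simp: square_eq_minus_one_iff)
  then have "continuous_on {0<..} (\<lambda>s. ?K * ?f s)" "set_integrable lborel {0<..} (\<lambda>s. ?K * ?f s)"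
    using continuous_on_mult[OF integral_weight.continuous[OF integral_weight_euler[OF m \<nu>]] euler_kernel_continuous]
      euler_integrable[OF m \<nu>] by (auto intro!: continuous_on_mult_left set_integrable_mult_right)
  note ray = set_integral_exp_minus_one[OF this, of "\<lambda>\<theta>. mehler_kernel b m \<nu> (of_real \<theta> + of_real b * v)"]
  show "set_integrable lborel {..<0} (\<lambda>\<theta>. mehler_kernel b m \<nu> (of_real \<theta> + of_real b * v))"
    by (rule ray(1)) (rule mehler_kernel_ray[OF v _ b])
  have "(LINT \<theta>:{..<0}|lborel. mehler_kernel b m \<nu> (of_real \<theta> + of_real b * v)) = (LINT s:{0<..}|lborel. ?K * ?f s)"
    by (rule ray(2)) (rule mehler_kernel_ray[OF v _ b])
  then show "(LINT \<theta>:{..<0}|lborel. mehler_kernel b m \<nu> (of_real \<theta> + of_real b * v)) = ?K * euler_integral m \<nu> ?x"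
    by (simp only: euler_integral_def set_integral_mult_right)
qed

lemma bij_betw_sin_half_squared:
  assumes b: "0 < b" "b < pi"
  shows "bij_betw (\<lambda>\<eta>. (sin (\<eta>/2))\<^sup>2 / (sin (b/2))\<^sup>2) {0<..<b} {0<..<1}"
  unfolding bij_betw_def
proof
  let ?g = "\<lambda>\<eta>. (sin (\<eta>/2))\<^sup>2 / (sin (b/2))\<^sup>2"
  have sin_less: "sin (x/2) < sin (y/2)" if "0 \<le> x" "x < y" "y \<le> b" for x y
    using that b by (intro sin_monotone_2pi) auto
  have sin_pos: "sin (x/2) > 0" if "0 < x" "x \<le> b" for x using sin_less[of 0 x] that by simp
  have g_less: "?g x < ?g y" if "0 < x" "x < y" "y \<le> b" for x y
    using sin_less[of x y] sin_pos[of x] sin_pos[of b] b that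
    by (intro divide_strict_right_mono power_strict_mono) auto
  have g_b: "?g b = 1" using sin_pos[of b] b by simp
  show "inj_on ?g {0<..<b}"
    by (rule linorder_inj_onI) (use g_less in force)+
  show "?g ` {0<..<b} = {0<..<1}"
  proof (intro equalityI subsetI)
    fix r :: real assume r: "r \<in> {0<..<1}"
    have "continuous_on {0..b} ?g" using sin_pos[of b] b by (intro continuous_intros) auto
    then obtain \<eta> where \<eta>: "0 \<le> \<eta>" "\<eta> \<le> b" "?g \<eta> = r"
      using IVT'[of ?g 0 r b] r b g_b by auto
    moreover from this have "\<eta> \<noteq> 0" "\<eta> \<noteq> b" using r g_b by auto
    ultimately show "r \<in> ?g ` {0<..<b}" by (intro image_eqI[of _ _ \<eta>]) auto
  next
    fix r assume "r \<in> ?g ` {0<..<b}"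
    then obtain \<eta> where "0 < \<eta>" "\<eta> < b" "r = ?g \<eta>" by auto
    then show "r \<in> {0<..<1}" using g_less[of \<eta> b] g_b sin_pos[of \<eta>] sin_pos[of b] by simp
  qed
qed

lemma set_integral_sin_half:
  fixes f k :: "real \<Rightarrow> 'b::euclidean_space"
  assumes b: "0 < b" "b < pi" and f: "continuous_on {0<..<1} f" "set_integrable lborel {0<..<1} f"
    and k: "\<And>\<eta>. \<eta> \<in> {0<..<b} \<Longrightarrow>
      k \<eta> = (sin (\<eta>/2) * cos (\<eta>/2) / (sin (b/2))\<^sup>2) *\<^sub>R f ((sin (\<eta>/2))\<^sup>2 / (sin (b/2))\<^sup>2)"
  shows "set_integrable lborel {0<..<b} k" and "(LINT \<eta>:{0<..<b}|lborel. k \<eta>) = (LINT r:{0<..<1}|lborel. f r)"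
proof -
  let ?g = "\<lambda>\<eta>. (sin (\<eta>/2))\<^sup>2 / (sin (b/2))\<^sup>2" and ?h = "\<lambda>\<eta>. sin (\<eta>/2) * cos (\<eta>/2) / (sin (b/2))\<^sup>2"
  note bij = bij_betw_sin_half_squared[OF b]
  have sin_pos: "sin (x/2) > 0" if "0 < x" "x \<le> b" for x using that b by (intro sin_gt_zero) auto
  have der: "(?g has_field_derivative ?h \<eta>) (at \<eta>)" for \<eta>
    by (rule DERIV_cdivide) (auto intro!: derivative_eq_intros)
  have h: "continuous_on {0<..<b} ?h"
    using sin_pos[of b] b by (intro continuous_intros) auto
  have "?h \<eta> > 0" if "\<eta> \<in> {0<..<b}" for \<eta>
    using that b sin_pos[of \<eta>] sin_pos[of b] by (intro divide_pos_pos mult_pos_pos cos_gt_zero_pi) auto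
  then have "k \<eta> = \<bar>?h \<eta>\<bar> *\<^sub>R f (?g \<eta>)" if "\<eta> \<in> {0<..<b}" for \<eta>
    using that k[OF that] by (simp only: abs_of_pos)
  note sub = set_integral_substitution[OF _ _ bij_betw_imp_surj_on[OF bij] bij_betw_imp_inj_on[OF bij] der h f this]
  show "set_integrable lborel {0<..<b} k" "(LINT \<eta>:{0<..<b}|lborel. k \<eta>) = (LINT r:{0<..<1}|lborel. f r)"
    using sub by simp_all
qed

lemma cos_minus_cos_half: "cos \<eta> - cos (b::real) = 2 * ((sin (b/2))\<^sup>2 - (sin (\<eta>/2))\<^sup>2)"
  using cos_double_sin[of "\<eta>/2"] cos_double_sin[of "b/2"] by simp

lemma beta_weight_sin_half:
  assumes \<eta>: "0 < \<eta>" "\<eta> < b" "b < pi"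
  shows "of_real ((2 * (sin (b/2))\<^sup>2) powr (- m - 1/2) * sin (\<eta>/2)) *
      beta_weight (1/2) (1/2 - of_real m) ((sin (\<eta>/2))\<^sup>2 / (sin (b/2))\<^sup>2) =
    of_real (sin (b/2) * (cos \<eta> - cos b) powr (- m - 1/2))"
proof -
  define s \<beta> r where "s = sin (\<eta>/2)" and "\<beta> = sin (b/2)" and "r = s\<^sup>2 / \<beta>\<^sup>2"
  have s: "0 < s" "s < \<beta>"
    using \<eta> unfolding s_def \<beta>_def by (auto intro!: sin_gt_zero sin_monotone_2pi)
  then have "s\<^sup>2 < \<beta>\<^sup>2" by (intro power_strict_mono) auto
  then have r: "r \<in> {0<..<1}" using s by (simp add: r_def)
  have "r = (s / \<beta>)\<^sup>2" by (simp add: r_def power_divide)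
  then have "r powr (- (1/2)) = \<beta> / s"
    using s by (simp only: powr_minus) (simp add: powr_half_sqrt)
  then have "beta_weight (1/2) (1/2 - of_real m) r = of_real (\<beta> / s * (1 - r) powr (- m - 1/2))"
    using beta_weight_of_real[OF r, of "1/2" "1/2 - m"] by (simp add: algebra_simps)
  moreover have "(cos \<eta> - cos b) powr (- m - 1/2) = (2 * \<beta>\<^sup>2) powr (- m - 1/2) * (1 - r) powr (- m - 1/2)"
    unfolding powr_mult[symmetric] cos_minus_cos_half using s by (simp add: r_def s_def \<beta>_def right_diff_distrib)
  ultimately show ?thesis
    using s unfolding s_def[symmetric] \<beta>_def[symmetric] r_def[symmetric] by simp
qed

lemma mehler_weight_substitution:
  fixes H :: "real \<Rightarrow> complex"
  assumes b: "0 < b" "b < pi" and m: "m < 1/2" and H: "continuous_on {0<..<(sin (b/2))\<^sup>2} H"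
    "\<And>x. x \<in> {0<..<(sin (b/2))\<^sup>2} \<Longrightarrow> norm (H x) \<le> B"
  defines "k \<equiv> \<lambda>\<eta>. of_real ((cos \<eta> - cos b) powr (- m - 1/2) * cos (\<eta>/2)) * H ((sin (\<eta>/2))\<^sup>2)"
  shows "set_integrable lborel {0<..<b} k"
    and "(LINT \<eta>:{0<..<b}|lborel. k \<eta>) = of_real ((2 * (sin (b/2))\<^sup>2) powr (- m - 1/2) * sin (b/2)) *
      (LINT r:{0<..<1}|lborel. beta_weight (1/2) (1/2 - of_real m) r * H ((sin (b/2))\<^sup>2 * r))"
proof -
  define \<beta> where "\<beta> = sin (b/2)"
  have \<beta>: "\<beta> > 0" using b by (auto simp: \<beta>_def intro: sin_gt_zero)
  let ?K = "complex_of_real ((2 * \<beta>\<^sup>2) powr (- m - 1/2) * \<beta>)"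
  let ?f = "\<lambda>r. ?K * (beta_weight (1/2) (1/2 - of_real m) r * H (\<beta>\<^sup>2 * r))"
  have r: "\<beta>\<^sup>2 * r \<in> {0<..<\<beta>\<^sup>2}" if "r \<in> {0<..<1}" for r
    using that \<beta> by simp
  have weight: "integral_weight {0<..<1} (beta_weight (1/2) (1/2 - of_real m))"
    using m by (intro integral_weight_beta) auto
  have cont: "continuous_on {0<..<1} (\<lambda>r. H (\<beta>\<^sup>2 * r))"
    using r by (intro continuous_on_compose2[OF H(1)[folded \<beta>_def]] continuous_intros) auto
  have f: "continuous_on {0<..<1} ?f" "set_integrable lborel {0<..<1} ?f"
    using continuous_on_mult[OF continuous_on_beta_weight cont]
      integral_weight.mult_integrable[OF weight cont, of B] r H(2)[folded \<beta>_def]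
    by (auto intro!: continuous_on_mult_left set_integrable_mult_right)
  have k: "k \<eta> = (sin (\<eta>/2) * cos (\<eta>/2) / \<beta>\<^sup>2) *\<^sub>R ?f ((sin (\<eta>/2))\<^sup>2 / \<beta>\<^sup>2)" if \<eta>: "\<eta> \<in> {0<..<b}" for \<eta>
    unfolding scaleR_conv_of_real k_def using beta_weight_sin_half[of \<eta> b m] \<eta> b \<beta>
    by (simp add: \<beta>_def field_simps power2_eq_square)
  note sub = set_integral_sin_half[OF b f, folded \<beta>_def, OF k]
  show "set_integrable lborel {0<..<b} k" using sub(1) .
  have "(LINT \<eta>:{0<..<b}|lborel. k \<eta>) = (LINT r:{0<..<1}|lborel. ?f r)" using sub(2) .
  then show "(LINT \<eta>:{0<..<b}|lborel. k \<eta>) = of_real ((2 * (sin (b/2))\<^sup>2) powr (- m - 1/2) * sin (b/2)) *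
      (LINT r:{0<..<1}|lborel. beta_weight (1/2) (1/2 - of_real m) r * H ((sin (b/2))\<^sup>2 * r))"
    by (simp only: \<beta>_def set_integral_mult_right)
qed

lemma cos_minus_cos_powr_integrable:
  assumes b: "0 < b" "b < pi" and m: "m < 1/2"
  shows "set_integrable lborel {0<..<b} (\<lambda>\<eta>. (cos \<eta> - cos b) powr (- m - 1/2))"
proof -
  let ?w = "(sin (b/2))\<^sup>2"
  have w: "?w < 1" "0 < cos (b/2)" "1 - ?w = (cos (b/2))\<^sup>2"
    using b cos_gt_zero_pi[of "b/2"] by (auto simp: sin_squared_eq)
  define H where "H = (\<lambda>x. complex_of_real (1 / sqrt (1 - x)))"
  have "norm (H x) \<le> 1 / cos (b/2)" if "x \<in> {0<..<?w}" for x
  proof -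
    have "x < 1" using that w(1) by simp
    have "cos (b/2) = sqrt (1 - ?w)" using w(2) unfolding w(3) by simp
    also have "\<dots> \<le> sqrt (1 - x)" using that by simp
    finally have "1 / sqrt (1 - x) \<le> 1 / cos (b/2)"
      using w(2) \<open>x < 1\<close> by (intro divide_left_mono mult_pos_pos) auto
    then show ?thesis using \<open>x < 1\<close> unfolding H_def norm_of_real by simp
  qed
  moreover have "continuous_on {0<..<?w} H"
    unfolding H_def using w(1) by (intro continuous_intros) auto
  moreover have "complex_of_real ((cos \<eta> - cos b) powr (- m - 1/2) * cos (\<eta>/2)) * H ((sin (\<eta>/2))\<^sup>2) =
      of_real ((cos \<eta> - cos b) powr (- m - 1/2))"
    if "\<eta> \<in> {0<..<b}" for \<eta>
    using that b cos_gt_zero_pi[of "\<eta>/2"] by (simp add: H_def cos_squared_eq[symmetric])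
  ultimately have "set_integrable lborel {0<..<b} (\<lambda>\<eta>. complex_of_real ((cos \<eta> - cos b) powr (- m - 1/2)))"
    using mehler_weight_substitution(1)[OF b m, of H "1 / cos (b/2)"]
    by (subst set_integrable_cong[OF refl refl sym]) auto
  then show ?thesis by (simp only: set_integrable_complex_of_real_iff)
qed

lemma cosh_of_real_mult_unit:
  fixes v :: complex
  assumes "v\<^sup>2 = - 1"
  shows "cosh (of_real b * v) = of_real (cos b)" and "sinh (of_real b * v) = v * of_real (sin b)"
  using exp_of_real_mult_unit[OF assms] by (simp_all add: cosh_field_def sinh_field_def)

lemma of_real_mult_unit_in_mehler_domain:
  assumes "v\<^sup>2 = - 1" "b < pi" "\<bar>x\<bar> \<le> b" "y < 0 \<or> \<bar>x\<bar> < b"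
  shows "of_real y + of_real x * v \<in> mehler_domain b"
  using assms by (auto simp: mehler_domain_def square_eq_minus_one_iff)

lemma mehler_kernel_vertical:
  assumes v: "v\<^sup>2 = - 1" and "0 < \<eta>" "\<eta> < b" "b < pi"
  shows "mehler_kernel b m \<nu> (of_real \<eta> * v) =
    exp ((\<nu> + 1/2) * (of_real \<eta> * v)) * of_real ((cos \<eta> - cos b) powr (- m - 1/2))"
proof -
  have "cos \<eta> - cos b \<ge> 0" using cos_monotone_0_pi[of \<eta> b] assms by simp
  then show ?thesis
    using powr_of_real[of "cos \<eta> - cos b" "- m - 1/2"]
    by (simp add: mehler_kernel_def cosh_of_real_mult_unit[OF v])
qed

lemma mehler_kernel_vertical_integrable:
  assumes v: "v\<^sup>2 = - 1" and b: "0 < b" "b < pi" and m: "\<bar>m\<bar> < 1/2"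
  shows "set_integrable lborel {0<..<b} (\<lambda>\<eta>. mehler_kernel b m \<nu> (of_real \<eta> * v))"
proof (rule set_integrable_bound_continuous)
  have domain: "of_real \<eta> * v \<in> mehler_domain b" if "\<eta> \<in> {0<..<b}" for \<eta>
    using of_real_mult_unit_in_mehler_domain[OF v b(2), of \<eta> 0] that by simp
  then show "continuous_on {0<..<b} (\<lambda>\<eta>. mehler_kernel b m \<nu> (of_real \<eta> * v))"
    by (intro continuous_on_compose2[OF holomorphic_on_imp_continuous_on[OF mehler_kernel_holomorphic[OF b]]]
      continuous_intros) auto
  show "set_integrable lborel {0<..<b} (\<lambda>\<eta>. exp (pi * \<bar>Im \<nu>\<bar>) * (cos \<eta> - cos b) powr (- m - 1/2))"
    using m by (intro set_integrable_mult_right cos_minus_cos_powr_integrable b) simp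
  fix \<eta> assume \<eta>: "\<eta> \<in> {0<..<b}"
  then have d: "cos \<eta> - cos b > 0" using cos_monotone_0_pi[of \<eta> b] b by simp
  moreover have "norm (cosh (of_real \<eta> * v) - of_real (cos b)) \<ge> cos \<eta> - cos b"
    using d by (simp add: cosh_of_real_mult_unit[OF v] flip: of_real_diff)
  moreover have "Re v = 0" "\<bar>Im (of_real \<eta> * v)\<bar> < pi"
    using v \<eta> b by (auto simp: square_eq_minus_one_iff)
  ultimately show "norm (mehler_kernel b m \<nu> (of_real \<eta> * v)) \<le> exp (pi * \<bar>Im \<nu>\<bar>) * (cos \<eta> - cos b) powr (- m - 1/2)"
    using norm_mehler_kernel_le[of "of_real \<eta> * v" m "cos \<eta> - cos b" b \<nu>] m by simp
qed simp

lemma mehler_corner_segment: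
  assumes v: "v\<^sup>2 = - 1" and b: "b < pi" and e: "0 < e" "e < b"
    and t: "t \<in> closed_segment (of_real b * v - of_real e) (of_real (b - e) * v)"
  shows "t \<in> mehler_domain b" and "Re t \<le> 0"
    and "norm (t - of_real b * v) \<ge> e / 2" and "norm (t - of_real b * v) \<le> e"
proof -
  obtain u where u: "0 \<le> u" "u \<le> 1"
      "t = of_real (1 - u) * (of_real b * v - of_real e) + of_real u * (of_real (b - e) * v)"
    using t by (auto simp: in_segment scaleR_conv_of_real)
  then have t_eq: "t = of_real (- (e * (1 - u))) + of_real (b - e * u) * v"
    by (simp add: algebra_simps)
  have eu: "e * u \<le> e" "0 \<le> e * u" "0 \<le> e * (1 - u)" "e * (1 - u) \<le> e"
    using u e by (simp_all add: mult_left_le)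
  have "\<bar>b - e * u\<bar> \<le> b" using eu e by linarith
  moreover have "- (e * (1 - u)) < 0 \<or> \<bar>b - e * u\<bar> < b"
    using u e by (cases "u = 1") auto
  ultimately show "t \<in> mehler_domain b"
    unfolding t_eq by (rule of_real_mult_unit_in_mehler_domain[OF v b])
  show "Re t \<le> 0"
    using v eu by (auto simp: t_eq square_eq_minus_one_iff)
  have diff: "t - of_real b * v = - (of_real (e * (1 - u)) + of_real (e * u) * v)"
    by (simp add: t_eq algebra_simps)
  have "norm v = 1" using v by (auto simp: square_eq_minus_one_iff)
  then have "norm (complex_of_real (e * (1 - u))) + norm (of_real (e * u) * v) = e"
    using e u by (simp only: norm_mult norm_of_real abs_mult) (simp add: algebra_simps)
  then show "norm (t - of_real b * v) \<le> e"
    unfolding diff norm_minus_cancel by (intro norm_triangle_le) simp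
  have "e * (1 - u) = \<bar>Re (t - of_real b * v)\<bar>" "e * u = \<bar>Im (t - of_real b * v)\<bar>"
    using v eu unfolding diff by (auto simp: square_eq_minus_one_iff)
  then have "e * (1 - u) + e * u \<le> 2 * norm (t - of_real b * v)"
    using abs_Re_le_cmod[of "t - of_real b * v"] abs_Im_le_cmod[of "t - of_real b * v"] by linarith
  then show "norm (t - of_real b * v) \<ge> e / 2"
    by (simp add: algebra_simps)
qed

lemma norm_mehler_kernel_corner_le:
  assumes v: "v\<^sup>2 = - 1" and b: "b < pi" and m: "m > - 1/2" and \<nu>: "Re \<nu> > - 1/2" and e: "0 < e" "e < b" and "k > 0"
    and cosh: "\<And>w. norm (w - of_real b * v) \<le> e \<Longrightarrow> norm (cosh w - of_real (cos b)) \<ge> k * norm (w - of_real b * v)"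
    and t: "t \<in> closed_segment (of_real b * v - of_real e) (of_real (b - e) * v)"
  shows "norm (mehler_kernel b m \<nu> t) \<le> exp (pi * \<bar>Im \<nu>\<bar>) * (k * (e / 2)) powr (- m - 1/2)"
proof -
  note segment = mehler_corner_segment[OF v b e t]
  have "k * (e / 2) \<le> k * norm (t - of_real b * v)"
    using segment(3) \<open>k > 0\<close> by (intro mult_left_mono) auto
  also have "\<dots> \<le> norm (cosh t - of_real (cos b))"
    by (rule cosh[OF segment(4)])
  finally have "norm (mehler_kernel b m \<nu> t) \<le>
      exp (pi * \<bar>Im \<nu>\<bar>) * (exp ((Re \<nu> + 1/2) * Re t) * (k * (e / 2)) powr (- m - 1/2))"
    using segment(1) m \<open>k > 0\<close> e(1) by (intro norm_mehler_kernel_le) (auto simp: mehler_domain_def)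
  also have "\<dots> \<le> exp (pi * \<bar>Im \<nu>\<bar>) * (1 * (k * (e / 2)) powr (- m - 1/2))"
    using segment(2) \<nu> by (intro mult_left_mono mult_right_mono) (auto simp: mult_nonneg_nonpos)
  finally show ?thesis by simp
qed

lemma cosh_minus_cos_ge_near_corner:
  fixes v :: complex
  assumes v: "v\<^sup>2 = - 1" and "sin b > 0"
  obtains k \<delta> where "k > 0" "\<delta> > 0"
    "\<And>w. norm (w - of_real b * v) < \<delta> \<Longrightarrow> norm (cosh w - of_real (cos b)) \<ge> k * norm (w - of_real b * v)"
proof -
  have norm_v: "norm v = 1" using v by (auto simp: square_eq_minus_one_iff)
  have "(cosh has_field_derivative v * of_real (sin b)) (at (of_real b * v))"
    by (auto intro!: derivative_eq_intros simp: cosh_of_real_mult_unit[OF v])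
  then obtain \<delta> where \<delta>: "\<delta> > 0" "\<And>w. norm (w - of_real b * v) < \<delta> \<Longrightarrow>
      norm (cosh w - cosh (of_real b * v)) \<ge> norm (v * of_real (sin b)) / 2 * norm (w - of_real b * v)"
    by (rule has_field_derivative_bounded_below) (use norm_v \<open>sin b > 0\<close> in auto)
  show ?thesis
    by (rule that[of "sin b / 2" \<delta>])
       (use \<delta> \<open>sin b > 0\<close> in \<open>simp_all add: cosh_of_real_mult_unit[OF v] norm_mult norm_v\<close>)
qed

lemma norm_mehler_primitive_corner_le:
  assumes v: "v\<^sup>2 = - 1" and b: "b < pi" and m: "m > - 1/2" and \<nu>: "Re \<nu> > - 1/2" and e: "0 < e" "e < b"
    and k: "k > 0"
    and cosh: "\<And>w. norm (w - of_real b * v) \<le> e \<Longrightarrow> norm (cosh w - of_real (cos b)) \<ge> k * norm (w - of_real b * v)"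
    and A: "\<And>t. t \<in> mehler_domain b \<Longrightarrow> (A has_field_derivative mehler_kernel b m \<nu> t) (at t)"
  shows "norm (A (of_real b * v - of_real e) - A (of_real (b - e) * v)) \<le>
    2 * exp (pi * \<bar>Im \<nu>\<bar>) * (k / 2) powr (- m - 1/2) * e powr (1/2 - m)"
proof -
  let ?K = "exp (pi * \<bar>Im \<nu>\<bar>)" and ?S = "closed_segment (of_real b * v - of_real e) (of_real (b - e) * v)"
  have "norm (A (of_real b * v - of_real e) - A (of_real (b - e) * v)) \<le>
      ?K * (k * (e / 2)) powr (- m - 1/2) * norm ((of_real b * v - of_real e) - of_real (b - e) * v)"
  proof (rule field_differentiable_bound[OF convex_closed_segment])
    fix t assume t: "t \<in> ?S"
    show "(A has_field_derivative mehler_kernel b m \<nu> t) (at t within ?S)"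
      by (rule has_field_derivative_at_within[OF A[OF mehler_corner_segment(1)[OF v b e t]]])
    show "norm (mehler_kernel b m \<nu> t) \<le> ?K * (k * (e / 2)) powr (- m - 1/2)"
      by (rule norm_mehler_kernel_corner_le[OF v b m \<nu> e k cosh t])
  qed auto
  also have "norm ((of_real b * v - of_real e) - of_real (b - e) * v) \<le> 2 * e"
  proof -
    have "norm v = 1" using v by (auto simp: square_eq_minus_one_iff)
    moreover have diff: "(of_real b * v - of_real e) - of_real (b - e) * v = of_real e * v - of_real e"
      by (simp add: algebra_simps)
    ultimately show ?thesis
      unfolding diff using norm_triangle_ineq4[of "of_real e * v" "of_real e"] e by (simp add: norm_mult)
  qed
  also have "(k * (e / 2)) powr (- m - 1/2) = (k / 2) powr (- m - 1/2) * e powr (- m - 1/2)"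
    by (subst powr_mult[symmetric]) (simp add: mult_ac)
  also have "?K * ((k / 2) powr (- m - 1/2) * e powr (- m - 1/2)) * (2 * e) =
      2 * ?K * (k / 2) powr (- m - 1/2) * (e powr (- m - 1/2) * e powr 1)"
    using e by simp
  also have "e powr (- m - 1/2) * e powr 1 = e powr (1/2 - m)"
    unfolding powr_add[symmetric] by simp
  finally show ?thesis by (simp add: mult_left_mono)
qed

lemma mehler_primitive_corner:
  assumes b: "0 < b" "b < pi" and m: "\<bar>m\<bar> < 1/2" and \<nu>: "Re \<nu> > - 1/2" and v: "v\<^sup>2 = - 1"
    and A: "\<And>t. t \<in> mehler_domain b \<Longrightarrow> (A has_field_derivative mehler_kernel b m \<nu> t) (at t)"
  shows "((\<lambda>e. A (of_real b * v - of_real e) - A (of_real (b - e) * v)) \<longlongrightarrow> 0) (at_right 0)"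
proof -
  obtain k \<delta> where k: "k > 0" and \<delta>: "\<delta> > 0"
    and cosh: "\<And>w. norm (w - of_real b * v) < \<delta> \<Longrightarrow> norm (cosh w - of_real (cos b)) \<ge> k * norm (w - of_real b * v)"
    using cosh_minus_cos_ge_near_corner[OF v sin_gt_zero[OF b]] by blast
  let ?C = "2 * exp (pi * \<bar>Im \<nu>\<bar>) * (k / 2) powr (- m - 1/2)"
  show ?thesis
  proof (rule Lim_null_comparison)
    have "norm (A (of_real b * v - of_real e) - A (of_real (b - e) * v)) \<le> ?C * e powr (1/2 - m)"
      if "0 < e" "e < min b \<delta>" for e
      using that m by (intro norm_mehler_primitive_corner_le[OF v b(2) _ \<nu> _ _ k cosh A]) auto
    then show "\<forall>\<^sub>F e in at_right 0. norm (A (of_real b * v - of_real e) - A (of_real (b - e) * v)) \<le>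
        ?C * e powr (1/2 - m)"
      unfolding eventually_at_right_field using b \<delta> by (intro exI[of _ "min b \<delta>"]) auto
    have "((\<lambda>e::real. e powr (1/2 - m)) \<longlongrightarrow> 0) (at_right 0)"
      using m by (intro tendsto_zero_powrI[where b = "1/2 - m"] tendsto_intros)
        (auto simp: eventually_at_right_less intro: eventually_mono[OF eventually_at_right_less])
    then show "((\<lambda>e. ?C * e powr (1/2 - m)) \<longlongrightarrow> 0) (at_right 0)"
      by (rule tendsto_mult_right_zero)
  qed
qed

lemma norm_cosh_minus_cos_ge_1:
  assumes "Re t \<le> - 4"
  shows "norm (cosh t - of_real (cos b)) \<ge> 1"
proof -
  have "exp (- Re t) \<ge> 5" using exp_ge_add_one_self[of "- Re t"] assms by linarith
  moreover have "exp (Re t) \<le> 1" using assms by simp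
  moreover have "norm (exp (- t)) = exp (- Re t)" "norm (exp t) = exp (Re t)" by simp_all
  ultimately have "norm (exp t + exp (- t)) \<ge> 4"
    using norm_diff_ineq[of "exp (- t)" "exp t"] unfolding add.commute[of "exp t"] by linarith
  then have "norm (cosh t) \<ge> 2" by (simp add: cosh_field_def norm_divide)
  moreover have "norm (complex_of_real (cos b)) \<le> 1" by simp
  ultimately show ?thesis
    using norm_triangle_ineq2[of "cosh t" "of_real (cos b)"] by linarith
qed

lemma mehler_primitive_far:
  assumes b: "0 < b" "b < pi" and m: "\<bar>m\<bar> < 1/2" and \<nu>: "Re \<nu> > - 1/2"
    and A: "\<And>t. t \<in> mehler_domain b \<Longrightarrow> (A has_field_derivative mehler_kernel b m \<nu> t) (at t)"
  shows "((\<lambda>L. A (of_real b * \<i> - of_real L) - A (of_real b * (- \<i>) - of_real L)) \<longlongrightarrow> 0) at_top"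
proof (rule Lim_null_comparison)
  let ?K = "exp (pi * \<bar>Im \<nu>\<bar>)"
  have "norm (A (of_real b * \<i> - of_real L) - A (of_real b * (- \<i>) - of_real L)) \<le>
      ?K * exp (- ((Re \<nu> + 1/2) * L)) * norm ((of_real b * \<i> - of_real L) - (of_real b * (- \<i>) - of_real L))"
    if L: "L \<ge> 4" for L :: real
  proof (rule field_differentiable_bound[OF convex_closed_segment])
    let ?S = "closed_segment (of_real b * \<i> - of_real L) (of_real b * (- \<i>) - of_real L)"
    fix t assume "t \<in> ?S"
    then obtain u where u: "0 \<le> u" "u \<le> 1"
      and t: "t = of_real (1 - u) * (of_real b * \<i> - of_real L) + of_real u * (of_real b * (- \<i>) - of_real L)"
      by (auto simp: in_segment scaleR_conv_of_real)
    have Re_t: "Re t = - L" by (simp add: t algebra_simps)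
    have "\<bar>1 - 2 * u\<bar> * b \<le> 1 * b" using u b by (intro mult_right_mono) auto
    moreover have "Im t = (1 - 2 * u) * b" by (simp add: t algebra_simps)
    then have "\<bar>Im t\<bar> = \<bar>1 - 2 * u\<bar> * b" using b by (simp add: abs_mult)
    ultimately have Im_t: "\<bar>Im t\<bar> < pi" using b by linarith
    then have "t \<in> mehler_domain b" using Re_t L by (simp add: mehler_domain_def)
    then show "(A has_field_derivative mehler_kernel b m \<nu> t) (at t within ?S)"
      by (rule has_field_derivative_at_within[OF A])
    have "norm (cosh t - of_real (cos b)) \<ge> 1"
      using Re_t L by (intro norm_cosh_minus_cos_ge_1) simp
    then have "norm (mehler_kernel b m \<nu> t) \<le> ?K * (exp ((Re \<nu> + 1/2) * Re t) * 1 powr (- m - 1/2))"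
      using m Im_t by (intro norm_mehler_kernel_le) auto
    then show "norm (mehler_kernel b m \<nu> t) \<le> ?K * exp (- ((Re \<nu> + 1/2) * L))"
      by (simp add: Re_t)
  qed auto
  moreover have "norm ((of_real b * \<i> - of_real L) - (of_real b * (- \<i>) - of_real L)) = 2 * b" for L :: real
    using b by (simp add: norm_mult)
  ultimately show "\<forall>\<^sub>F L in at_top. norm (A (of_real b * \<i> - of_real L) - A (of_real b * (- \<i>) - of_real L)) \<le>
      ?K * exp (- ((Re \<nu> + 1/2) * L)) * (2 * b)"
    by (intro eventually_mono[OF eventually_ge_at_top[of 4]]) (simp only:)
  have "filterlim (\<lambda>L. - ((Re \<nu> + 1/2) * L)) at_bot at_top"
    using \<nu> by (intro filterlim_compose[OF filterlim_uminus_at_bot_at_top]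
      filterlim_tendsto_pos_mult_at_top[OF tendsto_const] filterlim_ident) auto
  then have "((\<lambda>L. exp (- ((Re \<nu> + 1/2) * L))) \<longlongrightarrow> 0) at_top"
    by (rule filterlim_compose[OF exp_at_bot])
  then show "((\<lambda>L. ?K * exp (- ((Re \<nu> + 1/2) * L)) * (2 * b)) \<longlongrightarrow> 0) at_top"
    by (intro tendsto_mult_left_zero tendsto_mult_right_zero)
qed

lemma mehler_kernel_line_continuous:
  assumes "0 < b" "b < pi" "\<And>x. x \<in> S \<Longrightarrow> p + of_real x * w \<in> mehler_domain b"
  shows "continuous_on S (\<lambda>x. mehler_kernel b m \<nu> (p + of_real x * w))"
  by (intro continuous_on_compose2[OF holomorphic_on_imp_continuous_on[OF mehler_kernel_holomorphic[OF assms(1,2)]]]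
      continuous_intros)
     (use assms(3) in auto)

lemma mehler_primitive_ray:
  assumes b: "0 < b" "b < pi" and m: "\<bar>m\<bar> < 1/2" and \<nu>: "Re \<nu> > - 1/2" and v: "v\<^sup>2 = - 1"
    and A: "\<And>t. t \<in> mehler_domain b \<Longrightarrow> (A has_field_derivative mehler_kernel b m \<nu> t) (at t)"
    and e: "decseq e" "e \<longlonglongrightarrow> 0" "\<And>n. 0 < e n" "\<And>n. e n \<le> b / 2"
  shows "(\<lambda>n. A (of_real b * v - of_real (e n)) - A (of_real b * v - of_real (real n + 4))) \<longlonglongrightarrow>
    (LINT \<theta>:{..<0}|lborel. mehler_kernel b m \<nu> (of_real \<theta> + of_real b * v))"
proof -
  have "(\<lambda>n. A (of_real b * v + of_real (- e n) * 1) - A (of_real b * v + of_real (- (real n + 4)) * 1)) \<longlonglongrightarrow>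
      (LINT \<theta>:{..<0}|lborel. 1 * mehler_kernel b m \<nu> (of_real b * v + of_real \<theta> * 1))"
  proof (rule set_integral_line_primitive_limit)
    have domain: "of_real b * v + of_real \<theta> * 1 \<in> mehler_domain b" if "\<theta> \<in> {..<0}" for \<theta>
      using of_real_mult_unit_in_mehler_domain[OF v b(2), of b \<theta>] that b by (simp add: add.commute)
    show "continuous_on {..<0} (\<lambda>\<theta>. mehler_kernel b m \<nu> (of_real b * v + of_real \<theta> * 1))"
      by (rule mehler_kernel_line_continuous[OF b domain])
    show "(A has_field_derivative mehler_kernel b m \<nu> (of_real b * v + of_real \<theta> * 1))
        (at (of_real b * v + of_real \<theta> * 1))"
      if "\<theta> \<in> {..<0}" for \<theta>
      using that by (intro A domain)
    have "sin b \<noteq> 0" using sin_gt_zero b by force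
    then show "set_integrable lborel {..<0} (\<lambda>\<theta>. mehler_kernel b m \<nu> (of_real b * v + of_real \<theta> * 1))"
      using mehler_kernel_ray_integral(1)[OF m \<nu> _ v] by (simp add: add.commute)
    show "- (real n + 4) \<le> - e n" for n using e(4)[of n] b pi_less_4 by simp
    show "decseq (\<lambda>n. - (real n + 4))" "incseq (\<lambda>n. - e n)"
      using e(1) by (simp_all add: decseq_def incseq_def)
    show "(\<Union>n. {- (real n + 4)..- e n}) = {..<0}"
    proof (intro equalityI subsetI)
      fix \<theta> :: real assume "\<theta> \<in> {..<0}"
      then have "\<forall>\<^sub>F n in sequentially. e n < - \<theta>" using e(2) by (intro order_tendstoD) auto
      moreover have "\<forall>\<^sub>F n in sequentially. - \<theta> \<le> real n"
        using filterlim_real_sequentially by (simp add: filterlim_at_top)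
      ultimately have "\<forall>\<^sub>F n in sequentially. \<theta> \<in> {- (real n + 4)..- e n}"
        by eventually_elim simp
      then show "\<theta> \<in> (\<Union>n. {- (real n + 4)..- e n})" by (auto simp: eventually_sequentially)
    next
      fix \<theta> assume "\<theta> \<in> (\<Union>n. {- (real n + 4)..- e n})"
      then obtain n where "\<theta> \<le> - e n" by auto
      then show "\<theta> \<in> {..<0}" using e(3)[of n] by simp
    qed
  qed
  then show ?thesis
    unfolding mult_1 mult_1_right of_real_minus add_uminus_conv_diff by (simp only: add.commute)
qed

lemma mehler_primitive_vertical:
  assumes b: "0 < b" "b < pi" and m: "\<bar>m\<bar> < 1/2" and v: "v\<^sup>2 = - 1"
    and A: "\<And>t. t \<in> mehler_domain b \<Longrightarrow> (A has_field_derivative mehler_kernel b m \<nu> t) (at t)"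
    and e: "decseq e" "e \<longlonglongrightarrow> 0" "\<And>n. 0 < e n" "\<And>n. e n \<le> b / 2"
  shows "(\<lambda>n. A (of_real (b - e n) * v) - A (of_real (e n) * v)) \<longlonglongrightarrow>
    (LINT \<eta>:{0<..<b}|lborel. v * mehler_kernel b m \<nu> (of_real \<eta> * v))"
proof -
  have "(\<lambda>n. A (0 + of_real (b - e n) * v) - A (0 + of_real (e n) * v)) \<longlonglongrightarrow>
      (LINT \<eta>:{0<..<b}|lborel. v * mehler_kernel b m \<nu> (0 + of_real \<eta> * v))"
  proof (rule set_integral_line_primitive_limit)
    have domain: "0 + of_real \<eta> * v \<in> mehler_domain b" if "\<eta> \<in> {0<..<b}" for \<eta>
      using of_real_mult_unit_in_mehler_domain[OF v b(2), of \<eta> 0] that by simp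
    show "continuous_on {0<..<b} (\<lambda>\<eta>. mehler_kernel b m \<nu> (0 + of_real \<eta> * v))"
      by (rule mehler_kernel_line_continuous[OF b domain])
    show "(A has_field_derivative mehler_kernel b m \<nu> (0 + of_real \<eta> * v)) (at (0 + of_real \<eta> * v))"
      if "\<eta> \<in> {0<..<b}" for \<eta>
      using that by (intro A domain)
    show "set_integrable lborel {0<..<b} (\<lambda>\<eta>. mehler_kernel b m \<nu> (0 + of_real \<eta> * v))"
      using mehler_kernel_vertical_integrable[OF v b m] by simp
    show "e n \<le> b - e n" for n using e(4)[of n] by simp
    show "decseq e" "incseq (\<lambda>n. b - e n)"
      using e(1) by (simp_all add: decseq_def incseq_def)
    show "(\<Union>n. {e n..b - e n}) = {0<..<b}"
    proof (intro equalityI subsetI)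
      fix \<eta> assume "\<eta> \<in> {0<..<b}"
      then have "\<forall>\<^sub>F n in sequentially. e n < min \<eta> (b - \<eta>)" using e(2) by (intro order_tendstoD) auto
      then have "\<forall>\<^sub>F n in sequentially. \<eta> \<in> {e n..b - e n}" by eventually_elim simp
      then show "\<eta> \<in> (\<Union>n. {e n..b - e n})" by (auto simp: eventually_sequentially)
    next
      fix \<eta> assume "\<eta> \<in> (\<Union>n. {e n..b - e n})"
      then obtain n where "e n \<le> \<eta>" "\<eta> \<le> b - e n" by auto
      then show "\<eta> \<in> {0<..<b}" using e(3)[of n] by simp
    qed
  qed
  then show ?thesis by simp
qed

lemma mehler_primitive_branch:
  assumes b: "0 < b" "b < pi" and m: "\<bar>m\<bar> < 1/2" and \<nu>: "Re \<nu> > - 1/2" and v: "v\<^sup>2 = - 1"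
    and A: "\<And>t. t \<in> mehler_domain b \<Longrightarrow> (A has_field_derivative mehler_kernel b m \<nu> t) (at t)"
  shows "(\<lambda>n. A (of_real b * v - of_real (real n + 4))) \<longlonglongrightarrow>
    A 0 + (LINT \<eta>:{0<..<b}|lborel. v * mehler_kernel b m \<nu> (of_real \<eta> * v)) -
    (LINT \<theta>:{..<0}|lborel. mehler_kernel b m \<nu> (of_real \<theta> + of_real b * v))"
proof -
  define e where "e n = b / 2 * inverse (real (Suc n))" for n
  have e: "decseq e" "e \<longlonglongrightarrow> 0" "0 < e n" "e n \<le> b / 2" for n
  proof -
    show "decseq e" unfolding e_def decseq_def using b by (auto intro!: mult_left_mono le_imp_inverse_le)
    show "e \<longlonglongrightarrow> 0" unfolding e_def by (rule tendsto_mult_right_zero[OF LIMSEQ_inverse_real_of_nat])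
    show "0 < e n" "e n \<le> b / 2" using b by (simp_all add: e_def field_simps)
  qed
  have "filterlim e (at_right 0) sequentially"
    using e by (intro tendsto_imp_filterlim_at_right) auto
  then have corner: "(\<lambda>n. A (of_real b * v - of_real (e n)) - A (of_real (b - e n) * v)) \<longlonglongrightarrow> 0"
    using filterlim_compose[OF mehler_primitive_corner[OF b m \<nu> v A]] by blast
  have "0 \<in> mehler_domain b" using b by (simp add: mehler_domain_def)
  then have "isCont A 0" using A DERIV_isCont by blast
  moreover have "(\<lambda>n. of_real (e n) * v) \<longlonglongrightarrow> 0"
    using tendsto_mult[OF tendsto_of_real[OF e(2)] tendsto_const[of v]] by simp
  ultimately have "(\<lambda>n. A (of_real (e n) * v)) \<longlonglongrightarrow> A 0"
    by (rule isCont_tendsto_compose)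
  from tendsto_diff[OF tendsto_add[OF tendsto_add[OF this mehler_primitive_vertical[OF b m v A e]] corner]
      mehler_primitive_ray[OF b m \<nu> v A e]]
  show ?thesis by simp
qed

lemma mehler_contour:
  assumes b: "0 < b" "b < pi" and m: "\<bar>m\<bar> < 1/2" and \<nu>: "Re \<nu> > - 1/2"
  shows "(LINT \<theta>:{..<0}|lborel. mehler_kernel b m \<nu> (of_real \<theta> + of_real b * \<i>)) -
      (LINT \<theta>:{..<0}|lborel. mehler_kernel b m \<nu> (of_real \<theta> + of_real b * (- \<i>))) =
    2 * \<i> * (LINT \<eta>:{0<..<b}|lborel. of_real ((cos \<eta> - cos b) powr (- m - 1/2)) * cos ((\<nu> + 1/2) * of_real \<eta>))"
proof -
  let ?R = "\<lambda>v. LINT \<theta>:{..<0}|lborel. mehler_kernel b m \<nu> (of_real \<theta> + of_real b * v)"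
  let ?V = "\<lambda>v. LINT \<eta>:{0<..<b}|lborel. v * mehler_kernel b m \<nu> (of_real \<eta> * v)"
  obtain A where A: "\<And>t. t \<in> mehler_domain b \<Longrightarrow> (A has_field_derivative mehler_kernel b m \<nu> t) (at t)"
    using mehler_kernel_primitive[OF b] by blast
  have unit: "\<i>\<^sup>2 = - 1" "(- \<i>)\<^sup>2 = - 1" by simp_all
  have "(\<lambda>n. A (of_real b * \<i> - of_real (real n + 4)) - A (of_real b * (- \<i>) - of_real (real n + 4))) \<longlonglongrightarrow>
      (A 0 + ?V \<i> - ?R \<i>) - (A 0 + ?V (- \<i>) - ?R (- \<i>))"
    by (intro tendsto_diff mehler_primitive_branch b m \<nu> A unit)
  moreover have "filterlim (\<lambda>n. real n + 4) at_top sequentially"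
    by (rule filterlim_at_top_mono[OF filterlim_real_sequentially]) simp
  then have "(\<lambda>n. A (of_real b * \<i> - of_real (real n + 4)) - A (of_real b * (- \<i>) - of_real (real n + 4))) \<longlonglongrightarrow> 0"
    using filterlim_compose[OF mehler_primitive_far[OF b m \<nu> A]] by blast
  ultimately have "(A 0 + ?V \<i> - ?R \<i>) - (A 0 + ?V (- \<i>) - ?R (- \<i>)) = 0"
    by (rule LIMSEQ_unique)
  then have "?R \<i> - ?R (- \<i>) = ?V \<i> - ?V (- \<i>)" by (simp add: algebra_simps)
  also have "\<dots> = (LINT \<eta>:{0<..<b}|lborel. \<i> * mehler_kernel b m \<nu> (of_real \<eta> * \<i>) -
      (- \<i>) * mehler_kernel b m \<nu> (of_real \<eta> * (- \<i>)))"
    by (rule set_integral_diff(2)[symmetric])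
      (intro set_integrable_mult_right mehler_kernel_vertical_integrable b m unit)+
  also have "\<dots> = (LINT \<eta>:{0<..<b}|lborel. 2 * \<i> *
      (of_real ((cos \<eta> - cos b) powr (- m - 1/2)) * cos ((\<nu> + 1/2) * of_real \<eta>)))"
  proof (intro set_lebesgue_integral_cong allI impI)
    fix \<eta> assume "\<eta> \<in> {0<..<b}"
    then have \<eta>: "0 < \<eta>" "\<eta> < b" by simp_all
    let ?p = "complex_of_real ((cos \<eta> - cos b) powr (- m - 1/2))" and ?z = "(\<nu> + 1/2) * complex_of_real \<eta>"
    have "\<i> * mehler_kernel b m \<nu> (of_real \<eta> * \<i>) - (- \<i>) * mehler_kernel b m \<nu> (of_real \<eta> * (- \<i>)) =
        2 * \<i> * (?p * ((exp (\<i> * ?z) + exp (- (\<i> * ?z))) / 2))"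
      unfolding mehler_kernel_vertical[OF unit(1) \<eta> b(2)] mehler_kernel_vertical[OF unit(2) \<eta> b(2)]
      by (simp add: algebra_simps)
    then show "\<i> * mehler_kernel b m \<nu> (of_real \<eta> * \<i>) - (- \<i>) * mehler_kernel b m \<nu> (of_real \<eta> * (- \<i>)) =
        2 * \<i> * (?p * cos ?z)"
      by (simp only: cos_exp_eq)
  qed simp
  finally show ?thesis by (simp only: set_integral_mult_right)
qed

section \<open>The regularised hypergeometric function\<close>

definition hyp_coeff :: "complex \<Rightarrow> complex \<Rightarrow> complex \<Rightarrow> nat \<Rightarrow> complex" where
  "hyp_coeff a b c n = pochhammer a n * pochhammer b n / fact n * rGamma (c + of_nat n)"

lemma hyp2F1_reg_series_eq: "hyp2F1_reg_series a b c w = (\<Sum>n. hyp_coeff a b c n * w ^ n)"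
  by (simp add: hyp2F1_reg_series_def hyp_coeff_def)

lemma hyp_coeff_Suc:
  "hyp_coeff a b c (Suc n) * ((of_nat n + c) * (of_nat n + 1)) =
      hyp_coeff a b c n * ((of_nat n + a) * (of_nat n + b))"
proof -
  have "rGamma (c + of_nat n) = (c + of_nat n) * rGamma (c + of_nat (Suc n))"
    using rGamma_plus1[of "c + of_nat n"] by (simp add: add_ac)
  moreover have "(of_nat (Suc n) :: complex) \<noteq> 0" by (simp only: of_nat_eq_0_iff)
  ultimately show ?thesis
    by (simp add: hyp_coeff_def pochhammer_Suc field_simps del: of_nat_Suc) (simp add: algebra_simps)
qed

lemma tendsto_shift_quotient:
  fixes a b :: complex
  shows "(\<lambda>n. (of_nat n + a) / (of_nat n + b)) \<longlonglongrightarrow> 1"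
proof -
  have infinity: "filterlim (\<lambda>n. of_nat n + b) at_infinity sequentially"
    by (rule tendsto_add_filterlim_at_infinity'[OF tendsto_of_nat tendsto_const])
  then have "(\<lambda>n. 1 + (a - b) * inverse (of_nat n + b)) \<longlonglongrightarrow> 1 + (a - b) * 0"
    by (intro tendsto_intros filterlim_compose[OF tendsto_inverse_0])
  moreover have "\<forall>\<^sub>F n in sequentially. 1 + (a - b) * inverse (of_nat n + b) = (of_nat n + a) / (of_nat n + b)"
    using filterlim_at_infinity_imp_eventually_ne[OF infinity, of 0] by eventually_elim (simp add: field_simps)
  ultimately show ?thesis
    by (simp add: tendsto_cong)
qed

lemma hyp_coeff_norm_summable:
  assumes "norm w < 1"
  shows "summable (\<lambda>n. norm (hyp_coeff a b c n * w ^ n))"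
proof -
  define q where "q = (norm w + 1) / 2"
  let ?r = "\<lambda>n. (of_nat n + a) / (of_nat n + c) * ((of_nat n + b) / (of_nat n + 1)) * w"
  have "(\<lambda>n. norm (?r n)) \<longlonglongrightarrow> norm (1 * 1 * w)"
    by (intro tendsto_intros tendsto_shift_quotient)
  then have "\<forall>\<^sub>F n in sequentially. norm (?r n) < q"
    using assms by (intro order_tendstoD) (auto simp: q_def)
  moreover have "\<forall>\<^sub>F n in sequentially. of_nat n + c \<noteq> 0"
    by (intro filterlim_at_infinity_imp_eventually_ne
      tendsto_add_filterlim_at_infinity'[OF tendsto_of_nat tendsto_const])
  ultimately have "\<forall>\<^sub>F n in sequentially. norm (?r n) < q \<and> of_nat n + c \<noteq> 0"
    by eventually_elim simp
  then obtain N where N: "\<And>n. n \<ge> N \<Longrightarrow> norm (?r n) < q" "\<And>n. n \<ge> N \<Longrightarrow> of_nat n + c \<noteq> 0"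
    by (auto simp: eventually_sequentially)
  show ?thesis
  proof (rule summable_ratio_test[of q N])
    fix n assume n: "n \<ge> N"
    have "of_nat n + 1 \<noteq> (0 :: complex)" by (simp add: complex_eq_iff)
    then have "hyp_coeff a b c (Suc n) =
        hyp_coeff a b c n * ((of_nat n + a) / (of_nat n + c) * ((of_nat n + b) / (of_nat n + 1)))"
      using hyp_coeff_Suc[of a b c n] N(2)[OF n] by (simp add: divide_simps mult_ac)
    then have "norm (hyp_coeff a b c (Suc n) * w ^ Suc n) = norm (hyp_coeff a b c n * w ^ n) * norm (?r n)"
      by (simp only: power_Suc norm_mult[symmetric] mult_ac)
    also have "\<dots> \<le> norm (hyp_coeff a b c n * w ^ n) * q"
      using N(1)[OF n] by (intro mult_left_mono) auto
    finally show "norm (norm (hyp_coeff a b c (Suc n) * w ^ Suc n)) \<le> q * norm (norm (hyp_coeff a b c n * w ^ n))"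
      by (simp add: mult.commute)
  qed (use assms in \<open>simp add: q_def\<close>)
qed

lemmas hyp_coeff_summable = summable_norm_cancel[OF hyp_coeff_norm_summable]

lemma norm_pochhammer_ge_fact:
  fixes z :: complex
  assumes "Re z \<ge> 1"
  shows "norm (pochhammer z n) \<ge> fact n"
proof (induction n)
  case (Suc n)
  have "real (Suc n) \<le> Re (z + of_nat n)" using assms by simp
  also have "\<dots> \<le> norm (z + of_nat n)" by (rule complex_Re_le_cmod)
  finally have "fact n * real (Suc n) \<le> norm (pochhammer z n) * norm (z + of_nat n)"
    using Suc by (intro mult_mono) auto
  then show ?case unfolding pochhammer_Suc norm_mult fact_Suc by (simp only: mult.commute)
qed simp

lemma norm_hyp_coeff_le:
  assumes "n \<ge> k" "Re c + real k \<ge> 1"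
  shows "norm (hyp_coeff a b c n) \<le> norm (rGamma (c + of_nat k)) * norm (hyp_coeff a b (1 - of_nat k) n)"
proof -
  have "rGamma (c + of_nat k) = pochhammer (c + of_nat k) (n - k) * rGamma (c + of_nat k + of_nat (n - k))"
    by (rule pochhammer_rGamma)
  also have "c + of_nat k + of_nat (n - k) = c + of_nat n"
    using assms(1) by simp
  finally have "norm (rGamma (c + of_nat k)) =
      norm (pochhammer (c + of_nat k) (n - k)) * norm (rGamma (c + of_nat n))"
    by (simp add: norm_mult)
  moreover have "fact (n - k) * norm (rGamma (c + of_nat n)) \<le>
      norm (pochhammer (c + of_nat k) (n - k)) * norm (rGamma (c + of_nat n))"
    using assms(2) by (intro mult_right_mono norm_pochhammer_ge_fact) auto
  ultimately have "norm (rGamma (c + of_nat n)) \<le> norm (rGamma (c + of_nat k)) / fact (n - k)"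
    by (simp add: field_simps)
  moreover have "1 - of_nat k + of_nat n = (1 + of_nat (n - k) :: complex)"
    using assms(1) by simp
  then have "norm (rGamma (1 - of_nat k + of_nat n :: complex)) = 1 / fact (n - k)"
    by (simp only: rGamma_inverse_Gamma Gamma_fact norm_inverse norm_fact divide_inverse mult_1)
  ultimately have "norm (rGamma (c + of_nat n)) \<le>
      norm (rGamma (c + of_nat k)) * norm (rGamma (1 - of_nat k + of_nat n :: complex))"
    by simp
  then have "norm (pochhammer a n * pochhammer b n / fact n) * norm (rGamma (c + of_nat n)) \<le>
      norm (pochhammer a n * pochhammer b n / fact n) *
          (norm (rGamma (c + of_nat k)) * norm (rGamma (1 - of_nat k + of_nat n :: complex)))"
    by (intro mult_left_mono) auto
  then show ?thesis
    unfolding hyp_coeff_def norm_mult[of "pochhammer a n * pochhammer b n / fact n"] by (simp only: mult_ac)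
qed

lemma hyp2F1_reg_series_holomorphic_parameter:
  assumes w: "norm w < 1"
  shows "(\<lambda>c. hyp2F1_reg_series a b c w) holomorphic_on UNIV"
proof (rule holomorphic_uniform_sequence[where f = "\<lambda>N c. \<Sum>n<N. hyp_coeff a b c n * w ^ n"])
  show "(\<lambda>c. \<Sum>n<N. hyp_coeff a b c n * w ^ n) holomorphic_on UNIV" for N
    unfolding hyp_coeff_def by (intro holomorphic_intros)
  fix c0 :: complex
  obtain k :: nat where k: "2 - Re c0 \<le> real k" using real_arch_simple by blast
  have "continuous_on (cball c0 1) (\<lambda>c. rGamma (c + of_nat k))"
    by (intro holomorphic_on_imp_continuous_on holomorphic_intros)
  then have "bounded ((\<lambda>c. rGamma (c + of_nat k)) ` cball c0 1)"
    by (intro compact_imp_bounded compact_continuous_image compact_cball)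
  then obtain C where C: "\<forall>z\<in>(\<lambda>c. rGamma (c + of_nat k)) ` cball c0 1. norm z \<le> C"
    unfolding bounded_iff by blast
  have bound: "norm (hyp_coeff a b c n * w ^ n) \<le> C * norm (hyp_coeff a b (1 - of_nat k) n * w ^ n)"
    if "n \<ge> k" "c \<in> cball c0 1" for n c
  proof -
    have "Re c0 - Re c \<le> 1"
      using that(2) complex_Re_le_cmod[of "c0 - c"] by (simp add: dist_norm)
    then have "norm (hyp_coeff a b c n) \<le> norm (rGamma (c + of_nat k)) * norm (hyp_coeff a b (1 - of_nat k) n)"
      using k that(1) by (intro norm_hyp_coeff_le) auto
    also have "\<dots> \<le> C * norm (hyp_coeff a b (1 - of_nat k) n)"
      using that(2) C by (intro mult_right_mono) auto
    finally show ?thesis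
      unfolding norm_mult mult.assoc[symmetric] by (intro mult_right_mono) auto
  qed
  have "uniform_limit (cball c0 1) (\<lambda>N c. \<Sum>n<N. hyp_coeff a b c n * w ^ n)
      (\<lambda>c. \<Sum>n. hyp_coeff a b c n * w ^ n) sequentially"
  proof (rule Weierstrass_m_test_ev)
    show "\<forall>\<^sub>F n in sequentially. \<forall>c\<in>cball c0 1. norm (hyp_coeff a b c n * w ^ n) \<le>
        C * norm (hyp_coeff a b (1 - of_nat k) n * w ^ n)"
      using bound by (intro eventually_sequentiallyI[of k]) blast
    show "summable (\<lambda>n. C * norm (hyp_coeff a b (1 - of_nat k) n * w ^ n))"
      by (intro summable_mult hyp_coeff_norm_summable w)
  qed
  then show "\<exists>d>0. cball c0 d \<subseteq> UNIV \<and> uniform_limit (cball c0 d) (\<lambda>N c. \<Sum>n<N. hyp_coeff a b c n * w ^ n)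
      (\<lambda>c. hyp2F1_reg_series a b c w) sequentially"
    unfolding hyp2F1_reg_series_eq by (intro exI[of _ 1]) simp
qed simp

lemma sums_powser_mult:
  fixes f :: "nat \<Rightarrow> complex"
  assumes "(\<lambda>n. f (Suc n) * w ^ n) sums s" "f 0 = 0"
  shows "(\<lambda>n. f n * w ^ n) sums (w * s)"
proof -
  have "(\<lambda>n. f (Suc n) * w ^ Suc n) sums (w * s)"
    using sums_mult[OF assms(1), of w] by (simp add: mult_ac)
  then show ?thesis using assms(2) by (subst (asm) sums_Suc_iff) simp
qed

lemma hyp_coeff_diffs:
  assumes "norm w < 1"
  shows "((\<lambda>w. hyp2F1_reg_series a b c w) has_field_derivative (\<Sum>n. diffs (hyp_coeff a b c) n * w ^ n)) (at w)"
    and "summable (\<lambda>n. diffs (hyp_coeff a b c) n * w ^ n)"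
    and "((\<lambda>w. \<Sum>n. diffs (hyp_coeff a b c) n * w ^ n) has_field_derivative
      (\<Sum>n. diffs (diffs (hyp_coeff a b c)) n * w ^ n)) (at w)"
    and "summable (\<lambda>n. diffs (diffs (hyp_coeff a b c)) n * w ^ n)"
proof -
  have summable1: "summable (\<lambda>n. diffs (hyp_coeff a b c) n * w ^ n)" if "norm w < 1" for w
    using that by (rule termdiff_converges) (rule hyp_coeff_summable)
  show "((\<lambda>w. hyp2F1_reg_series a b c w) has_field_derivative (\<Sum>n. diffs (hyp_coeff a b c) n * w ^ n)) (at w)"
    unfolding hyp2F1_reg_series_eq by (rule termdiffs_strong'[OF hyp_coeff_summable assms])
  show "summable (\<lambda>n. diffs (hyp_coeff a b c) n * w ^ n)"
    using assms by (rule summable1)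
  show "((\<lambda>w. \<Sum>n. diffs (hyp_coeff a b c) n * w ^ n) has_field_derivative
      (\<Sum>n. diffs (diffs (hyp_coeff a b c)) n * w ^ n)) (at w)"
    by (rule termdiffs_strong'[OF summable1 assms])
  show "summable (\<lambda>n. diffs (diffs (hyp_coeff a b c)) n * w ^ n)"
    using assms by (rule termdiff_converges) (rule summable1)
qed

lemma hypergeometric_ODE:
  fixes a b c w :: complex
  assumes w: "norm w < 1"
  defines "d1 \<equiv> \<Sum>n. diffs (hyp_coeff a b c) n * w ^ n" and "d2 \<equiv> \<Sum>n. diffs (diffs (hyp_coeff a b c)) n * w ^ n"
  shows "w * (1 - w) * d2 + (c - (a + b + 1) * w) * d1 = a * b * hyp2F1_reg_series a b c w"
proof -
  define h where "h = hyp_coeff a b c"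
  let ?F = "hyp2F1_reg_series a b c w"
  have series: "(\<lambda>n. h n * w ^ n) sums ?F"
    unfolding h_def hyp2F1_reg_series_eq by (rule summable_sums[OF hyp_coeff_summable[OF w]])
  have series_d1: "(\<lambda>n. (of_nat (Suc n) * h (Suc n)) * w ^ n) sums d1"
    using summable_sums[OF hyp_coeff_diffs(2)[OF w]] by (simp add: d1_def h_def diffs_def)
  have series_d2: "(\<lambda>n. (of_nat (Suc n) * (of_nat (Suc (Suc n)) * h (Suc (Suc n)))) * w ^ n) sums d2"
    using summable_sums[OF hyp_coeff_diffs(4)[OF w]] by (simp add: d2_def h_def diffs_def)
  have shifted_d1: "(\<lambda>n. (of_nat n * h n) * w ^ n) sums (w * d1)"
    by (rule sums_powser_mult) (use series_d1 in simp_all)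
  have shifted_d2: "(\<lambda>n. (of_nat n * (of_nat (Suc n) * h (Suc n))) * w ^ n) sums (w * d2)"
    by (rule sums_powser_mult) (use series_d2 in simp_all)
  have shifted_twice_d2: "(\<lambda>n. ((of_nat n - 1) * (of_nat n * h n)) * w ^ n) sums (w * (w * d2))"
    by (rule sums_powser_mult) (use shifted_d2 in simp_all)
  let ?t = "\<lambda>n. of_nat n * (of_nat (Suc n) * h (Suc n)) * w ^ n + c * (of_nat (Suc n) * h (Suc n) * w ^ n) -
      ((of_nat n - 1) * (of_nat n * h n) * w ^ n + (a + b + 1) * (of_nat n * h n * w ^ n) + a * b * (h n * w ^ n))"
  have "?t sums (w * d2 + c * d1 - (w * (w * d2) + (a + b + 1) * (w * d1) + a * b * ?F))"
    by (intro sums_add sums_diff sums_mult series series_d1 shifted_d1 shifted_d2 shifted_twice_d2)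
  moreover have "?t n = 0" for n
  proof -
    have "?t n = (h (Suc n) * ((of_nat n + c) * (of_nat n + 1)) - h n * ((of_nat n + a) * (of_nat n + b))) * w ^ n"
      by (simp add: algebra_simps)
    then show ?thesis unfolding h_def hyp_coeff_Suc by simp
  qed
  ultimately have "(\<lambda>n. 0) sums (w * d2 + c * d1 - (w * (w * d2) + (a + b + 1) * (w * d1) + a * b * ?F))"
    by (simp only:)
  then have "w * d2 + c * d1 - (w * (w * d2) + (a + b + 1) * (w * d1) + a * b * ?F) = 0"
    by (rule sums_unique2[OF _ sums_zero])
  then show ?thesis by (simp add: algebra_simps)
qed

lemma harmonic_oscillator:
  fixes S T :: "complex \<Rightarrow> complex"
  assumes D: "convex D" "0 \<in> D" "z \<in> D"
    and S: "\<And>y. y \<in> D \<Longrightarrow> (S has_field_derivative T y) (at y within D)"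
    and T: "\<And>y. y \<in> D \<Longrightarrow> (T has_field_derivative - (l\<^sup>2 * S y)) (at y within D)"
  shows "l * S z = l * S 0 * cos (l * z) + T 0 * sin (l * z)"
proof -
  let ?A = "\<lambda>y. l * S y * cos (l * y) - T y * sin (l * y)" and ?B = "\<lambda>y. l * S y * sin (l * y) + T y * cos (l * y)"
  have "(?A has_field_derivative 0) (at y within D)" "(?B has_field_derivative 0) (at y within D)" if "y \<in> D" for y
    using S[OF that] T[OF that] by (auto intro!: derivative_eq_intros simp: algebra_simps power2_eq_square)
  then have "\<exists>\<alpha>. \<forall>y\<in>D. ?A y = \<alpha>" "\<exists>\<beta>. \<forall>y\<in>D. ?B y = \<beta>"
    using has_field_derivative_zero_constant[OF D(1), of ?A] has_field_derivative_zero_constant[OF D(1), of ?B]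
    by blast+
  then have "?A z = ?A 0" "?B z = ?B 0" using D by metis+
  then have AB: "?A z = l * S 0" "?B z = T 0" by simp_all
  have "?A z * cos (l * z) + ?B z * sin (l * z) = l * S z * ((cos (l * z))\<^sup>2 + (sin (l * z))\<^sup>2)"
    by algebra
  then show ?thesis unfolding AB by simp
qed

text \<open>In the variable \<open>z\<close> with \<open>w = sin\<^sup>2 z\<close>, the function \<open>cos z F(\<nu> + 1, -\<nu>; 1/2; w)\<close>
  satisfies the equation of the harmonic oscillator with frequency \<open>2 \<nu> + 1\<close>.\<close>

lemma oscillator_of_hypergeometric_ODE:
  fixes E E' :: "complex \<Rightarrow> complex"
  defines "S \<equiv> \<lambda>z. cos z * E ((sin z)\<^sup>2)"
    and "T \<equiv> \<lambda>z. - (sin z * E ((sin z)\<^sup>2)) + 2 * sin z * (cos z)\<^sup>2 * E' ((sin z)\<^sup>2)"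
  assumes w: "w = (sin z)\<^sup>2" and E: "(E has_field_derivative E' w) (at w)"
    and E': "(E' has_field_derivative d2) (at w)"
    and ODE: "w * (1 - w) * d2 + (1/2 - ((\<nu> + 1) + - \<nu> + 1) * w) * E' w = (\<nu> + 1) * - \<nu> * E w"
  shows "(S has_field_derivative T z) (at z)" and "(T has_field_derivative - ((2 * \<nu> + 1)\<^sup>2 * S z)) (at z)"
proof -
  have square: "((\<lambda>z. (sin z)\<^sup>2) has_field_derivative 2 * sin z * cos z) (at z)"
    by (auto intro!: derivative_eq_intros)
  have dE: "((\<lambda>z. E ((sin z)\<^sup>2)) has_field_derivative E' w * (2 * sin z * cos z)) (at z)"
    using E square unfolding w by (rule DERIV_chain2)
  have dE': "((\<lambda>z. E' ((sin z)\<^sup>2)) has_field_derivative d2 * (2 * sin z * cos z)) (at z)"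
    using E' square unfolding w by (rule DERIV_chain2)
  have "(S has_field_derivative cos z * (E' w * (2 * sin z * cos z)) + (- sin z) * E ((sin z)\<^sup>2)) (at z)"
    unfolding S_def by (rule DERIV_mult'[OF DERIV_cos dE])
  then show "(S has_field_derivative T z) (at z)"
    unfolding T_def w by (rule DERIV_cong) (simp add: power2_eq_square)
  have cos_squared: "(cos z)\<^sup>2 = 1 - w" by (simp add: w cos_squared_eq)
  have "(T has_field_derivative - (cos z * E w + sin z * (E' w * (2 * sin z * cos z))) +
      ((2 * (cos z) ^ 3 - 4 * (sin z)\<^sup>2 * cos z) * E' w + 2 * sin z * (cos z)\<^sup>2 * (d2 * (2 * sin z * cos z)))) (at z)"
    unfolding T_def
    by (rule derivative_eq_intros dE dE' refl)+ (simp add: w power2_eq_square power3_eq_cube algebra_simps)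
  also have "- (cos z * E w + sin z * (E' w * (2 * sin z * cos z))) +
      ((2 * (cos z) ^ 3 - 4 * (sin z)\<^sup>2 * cos z) * E' w + 2 * sin z * (cos z)\<^sup>2 * (d2 * (2 * sin z * cos z))) =
      cos z * (4 * ((sin z)\<^sup>2 * (cos z)\<^sup>2 * d2) + (2 * (cos z)\<^sup>2 - 6 * (sin z)\<^sup>2) * E' w - E w)"
    by (simp add: power2_eq_square power3_eq_cube algebra_simps)
  also have "\<dots> = cos z * (4 * (w * (1 - w) * d2 + (1/2 - ((\<nu> + 1) + - \<nu> + 1) * w) * E' w) - E w)"
    unfolding cos_squared w[symmetric] by (simp add: algebra_simps)
  also have "\<dots> = - ((2 * \<nu> + 1)\<^sup>2 * S z)"
    unfolding ODE by (simp add: S_def w power2_eq_square algebra_simps)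
  finally show "(T has_field_derivative - ((2 * \<nu> + 1)\<^sup>2 * S z)) (at z)" .
qed

lemma norm_sin_squared_less_1:
  assumes x: "\<bar>x\<bar> < pi / 2" and z: "z \<in> closed_segment 0 (complex_of_real x)"
  shows "norm ((sin z)\<^sup>2) < 1"
proof -
  obtain u where u: "0 \<le> u" "u \<le> 1" "z = of_real (u * x)"
    using z by (auto simp: in_segment scaleR_conv_of_real)
  have "\<bar>u * x\<bar> \<le> \<bar>x\<bar>" using u by (simp add: abs_mult mult_left_le_one_le)
  then have "cos (u * x) > 0" using x by (intro cos_gt_zero_pi) linarith+
  then have "(sin (u * x))\<^sup>2 < 1" by (simp add: sin_squared_eq)
  then show ?thesis unfolding u(3) sin_of_real by (simp add: norm_power)
qed

lemma hyp2F1_reg_series_sin_squared: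
  assumes \<nu>: "2 * \<nu> + 1 \<noteq> 0" and x: "\<bar>x\<bar> < pi / 2"
  shows "cos (of_real x) * hyp2F1_reg_series (\<nu> + 1) (- \<nu>) (1/2) ((sin (of_real x))\<^sup>2) =
    cos ((2 * \<nu> + 1) * of_real x) / of_real (sqrt pi)"
proof -
  let ?D = "closed_segment 0 (complex_of_real x)"
  let ?h = "hyp_coeff (\<nu> + 1) (- \<nu>) (1/2)"
  define E where "E = hyp2F1_reg_series (\<nu> + 1) (- \<nu>) (1/2)"
  define E' where "E' w = (\<Sum>n. diffs ?h n * w ^ n)" for w
  define S where "S z = cos z * E ((sin z)\<^sup>2)" for z
  define T where "T z = - (sin z * E ((sin z)\<^sup>2)) + 2 * sin z * (cos z)\<^sup>2 * E' ((sin z)\<^sup>2)" for z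
  have "(2 * \<nu> + 1) * S (of_real x) = (2 * \<nu> + 1) * S 0 * cos ((2 * \<nu> + 1) * of_real x) +
      T 0 * sin ((2 * \<nu> + 1) * of_real x)"
  proof (rule harmonic_oscillator)
    fix z assume "z \<in> ?D"
    note small = norm_sin_squared_less_1[OF x this]
    note diffs = hyp_coeff_diffs[OF small, of "\<nu> + 1" "- \<nu>" "1/2", folded E_def E'_def]
      and ODE = hypergeometric_ODE[OF small, where a = "\<nu> + 1" and b = "- \<nu>" and c = "1/2", folded E_def E'_def]
    note derivs = oscillator_of_hypergeometric_ODE[where E = E and E' = E',
        OF refl diffs(1,3) ODE, folded S_def T_def]
    show "(S has_field_derivative T z) (at z within ?D)"
      by (rule has_field_derivative_at_within[OF derivs(1)])
    show "(T has_field_derivative - ((2 * \<nu> + 1)\<^sup>2 * S z)) (at z within ?D)"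
      by (rule has_field_derivative_at_within[OF derivs(2)])
  qed auto
  moreover have "S 0 = 1 / of_real (sqrt pi)" "T 0 = 0"
    using powser_zero[of ?h]
    by (simp_all add: S_def T_def E_def hyp2F1_reg_series_eq hyp_coeff_def rGamma_inverse_Gamma
      Gamma_one_half_complex inverse_eq_divide)
  ultimately have "(2 * \<nu> + 1) * S (of_real x) = (2 * \<nu> + 1) * (cos ((2 * \<nu> + 1) * of_real x) / of_real (sqrt pi))"
    by simp
  then show ?thesis
    using \<nu> unfolding mult_cancel_left by (simp add: S_def E_def)
qed

lemma cos_half_mult_hyp2F1_reg_series:
  assumes \<nu>: "Re \<nu> > - 1/2" and \<eta>: "\<bar>\<eta>\<bar> < pi"
  shows "of_real (cos (\<eta> / 2)) * (of_real (sqrt pi) *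
      hyp2F1_reg_series (\<nu> + 1) (- \<nu>) (1/2) (of_real ((sin (\<eta> / 2))\<^sup>2))) =
    cos ((\<nu> + 1/2) * of_real \<eta>)"
proof -
  have "2 * \<nu> + 1 \<noteq> 0" using \<nu> by (auto simp: complex_eq_iff)
  then have "cos (of_real (\<eta> / 2)) * hyp2F1_reg_series (\<nu> + 1) (- \<nu>) (1/2) ((sin (of_real (\<eta> / 2)))\<^sup>2) =
      cos ((2 * \<nu> + 1) * of_real (\<eta> / 2)) / of_real (sqrt pi)"
    using \<eta> by (intro hyp2F1_reg_series_sin_squared) auto
  then show ?thesis
    unfolding sin_of_real cos_of_real by (simp add: field_simps)
qed

lemma integral_weight_powser:
  fixes f :: "nat \<Rightarrow> complex"
  assumes W: "integral_weight {0<..<1} W" and f: "summable (\<lambda>n. norm (f n))"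
  shows "(\<lambda>n. f n * (LINT r:{0<..<1}|lborel. W r * of_real (r ^ n))) sums
    (LINT r:{0<..<1}|lborel. W r * (\<Sum>n. f n * of_real (r ^ n)))"
proof -
  let ?s = "\<lambda>N r. \<Sum>n<N. f n * of_real (r ^ n)"
  have bound: "norm (f n * of_real (r ^ n)) \<le> norm (f n)" if "r \<in> {0<..<1}" for r n
    using that power_le_one[of r n] by (simp add: norm_mult norm_power mult_left_le)
  have "set_integrable lborel {0<..<1} (\<lambda>r. W r * of_real (r ^ n))" for n
    by (rule integral_weight.mult_integrable[OF W, of _ 1])
       (auto intro!: continuous_intros power_le_one simp: norm_power)
  then have integrable: "set_integrable lborel {0<..<1} (\<lambda>r. f n * (W r * of_real (r ^ n)))" for n
    by (intro set_integrable_mult_right)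
  have "(LINT r:{0<..<1}|lborel. W r * ?s N r) = (\<Sum>n<N. f n * (LINT r:{0<..<1}|lborel. W r * of_real (r ^ n)))" for N
  proof -
    have "(LINT r:{0<..<1}|lborel. W r * ?s N r) = (LINT r:{0<..<1}|lborel. (\<Sum>n<N. f n * (W r * of_real (r ^ n))))"
      by (simp add: sum_distrib_left mult_ac)
    also have "\<dots> = (\<Sum>n<N. LINT r:{0<..<1}|lborel. f n * (W r * of_real (r ^ n)))"
      using integrable unfolding set_lebesgue_integral_def set_integrable_def scaleR_sum_right
      by (intro Bochner_Integration.integral_sum)
    finally show ?thesis by (simp only: set_integral_mult_right)
  qed
  moreover have "(\<lambda>N. LINT r:{0<..<1}|lborel. W r * ?s N r) \<longlonglongrightarrow>
      (LINT r:{0<..<1}|lborel. W r * (\<Sum>n. f n * of_real (r ^ n)))"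
  proof (rule set_integral_dominated_convergence)
    show "set_integrable lborel {0<..<1} (\<lambda>r. norm (W r) * (\<Sum>n. norm (f n)))"
      by (intro set_integrable_mult_left integral_weight.norm_integrable W)
    show "continuous_on {0<..<1} (\<lambda>r. W r * ?s N r)" for N
      by (intro continuous_intros integral_weight.continuous[OF W])
    fix r :: real assume r: "r \<in> {0<..<1}"
    show "norm (W r * ?s N r) \<le> norm (W r) * (\<Sum>n. norm (f n))" for N
    proof -
      have "norm (?s N r) \<le> (\<Sum>n<N. norm (f n))" by (intro sum_norm_le bound r)
      also have "\<dots> \<le> (\<Sum>n. norm (f n))" by (intro sum_le_suminf f) auto
      finally show ?thesis unfolding norm_mult by (intro mult_left_mono) auto
    qed
    have "summable (\<lambda>n. f n * of_real (r ^ n))"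
      by (rule summable_norm_cancel, rule summable_comparison_test'[OF f]) (use bound[OF r] in simp)
    then show "(\<lambda>N. W r * ?s N r) \<longlonglongrightarrow> W r * (\<Sum>n. f n * of_real (r ^ n))"
      by (intro tendsto_intros summable_LIMSEQ)
  qed auto
  ultimately show ?thesis by (simp only: sums_def)
qed

lemma hyp2F1_reg_series_beta_integral:
  assumes c: "Re c > 0" and d: "Re d > 0" and w: "norm w < 1"
  shows "(LINT r:{0<..<1}|lborel. beta_weight c d r * hyp2F1_reg_series a b c (w * of_real r)) =
    Gamma d * hyp2F1_reg_series a b (c + d) w"
proof -
  let ?h = "\<lambda>n. hyp_coeff a b c n * w ^ n"
  have coeff: "?h n * (LINT r:{0<..<1}|lborel. beta_weight c d r * of_real (r ^ n)) =
      Gamma d * (hyp_coeff a b (c + d) n * w ^ n)" for n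
  proof -
    have "(LINT r:{0<..<1}|lborel. beta_weight c d r * of_real (r ^ n)) =
        (LINT r:{0<..<1}|lborel. beta_weight (c + of_nat n) d r)"
    proof (intro set_lebesgue_integral_cong allI impI)
      fix r :: real assume "r \<in> {0<..<1}"
      then show "beta_weight c d r * of_real (r ^ n) = beta_weight (c + of_nat n) d r"
        using powr_add[of "of_real r" "of_nat n" "c - 1"] by (simp add: beta_weight_def powr_nat algebra_simps)
    qed simp
    also have "\<dots> = Beta (c + of_nat n) d"
      using c d by (intro integral_beta_weight) auto
    also have "\<dots> = Gamma (c + of_nat n) * Gamma d * rGamma (c + d + of_nat n)"
      by (simp add: Beta_altdef add_ac)
    finally show ?thesis
      using c by (simp add: hyp_coeff_def Gamma_def rGamma_eq_zero_iff notin_nonpos_Ints_Re)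
  qed
  have "(\<lambda>n. ?h n * (LINT r:{0<..<1}|lborel. beta_weight c d r * of_real (r ^ n))) sums
      (LINT r:{0<..<1}|lborel. beta_weight c d r * (\<Sum>n. ?h n * of_real (r ^ n)))"
    using c d by (intro integral_weight_powser integral_weight_beta hyp_coeff_norm_summable w)
  moreover have "(\<lambda>n. Gamma d * (hyp_coeff a b (c + d) n * w ^ n)) sums (Gamma d * hyp2F1_reg_series a b (c + d) w)"
    unfolding hyp2F1_reg_series_eq by (intro sums_mult summable_sums hyp_coeff_summable w)
  ultimately show ?thesis
    unfolding coeff by (simp add: sums_iff hyp2F1_reg_series_eq power_mult_distrib mult_ac)
qed

lemma hyp2F1_reg_series_powr:
  assumes "norm w < 1"
  shows "hyp2F1_reg_series a b a w = rGamma a * (1 - w) powr (- b)"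
proof -
  have "(\<lambda>n. ((- b) gchoose n) * (- w) ^ n) sums (1 + (- w)) powr (- b)"
    by (rule gen_binomial_complex) (use assms in simp)
  then have "(\<lambda>n. rGamma a * (((- b) gchoose n) * (- w) ^ n)) sums (rGamma a * (1 - w) powr (- b))"
    using sums_mult by fastforce
  moreover have "rGamma a * (((- b) gchoose n) * (- w) ^ n) = hyp_coeff a b a n * w ^ n" for n
  proof -
    have "((- b) gchoose n) * (- w) ^ n = pochhammer b n / fact n * w ^ n"
      by (simp add: gbinomial_pochhammer power_minus[of w])
    then show ?thesis by (simp add: hyp_coeff_def pochhammer_rGamma[of a n])
  qed
  ultimately show ?thesis
    by (simp add: hyp2F1_reg_series_eq sums_iff)
qed

definition hyp_continuation :: "complex \<Rightarrow> complex \<Rightarrow> complex \<Rightarrow> (complex \<Rightarrow> complex) \<Rightarrow> bool" where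
  "hyp_continuation a b c F \<longleftrightarrow>
    F holomorphic_on slit_plane \<and> (\<forall>w. norm w < 1 \<longrightarrow> F w = hyp2F1_reg_series a b c w)"

lemma one_minus_mult_notin_nonpos_Reals:
  assumes "w \<in> slit_plane" "r \<in> {0..1}"
  shows "1 - w * of_real r \<notin> \<real>\<^sub>\<le>\<^sub>0"
proof
  assume "1 - w * of_real r \<in> \<real>\<^sub>\<le>\<^sub>0"
  then have le: "1 \<le> Re w * r" and Im: "Im w = 0 \<or> r = 0" by (auto simp: complex_nonpos_Reals_iff)
  then have "r \<noteq> 0" by auto
  then have w: "w = of_real (Re w)" using Im by (simp add: complex_eq_iff)
  have "Re w > 0" using le assms(2) by (smt (verit) atLeastAtMost_iff mult_nonneg_nonpos2 mult_nonneg_nonpos)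
  then have "Re w * r \<le> Re w * 1" using assms(2) by (intro mult_left_mono) auto
  then have "1 \<le> Re w" using le by simp
  then show False using assms(1) w by (auto simp: slit_plane_def)
qed

lemma hyp_Euler_integral_holomorphic:
  assumes "Re a > 0" "Re c > Re a"
  shows "(\<lambda>w. LINT r:{0<..<1}|lborel. beta_weight a (c - a) r *
      (1 - w * of_real r) powr (- b)) holomorphic_on slit_plane"
proof (rule integral_weight.integral_holomorphic[OF _ open_slit_plane])
  show "integral_weight {0<..<1} (beta_weight a (c - a))"
    using assms by (intro integral_weight_beta) auto
  show "(\<lambda>w. (1 - w * of_real r) powr (- b)) holomorphic_on slit_plane" if "r \<in> {0<..<1}" for r
    using that by (intro holomorphic_intros one_minus_mult_notin_nonpos_Reals) auto
  fix w assume w: "w \<in> slit_plane"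
  show "continuous_on {0<..<1} (\<lambda>r. (1 - w * complex_of_real r) powr (- b))"
    by (intro continuous_on_powr_slit continuous_intros one_minus_mult_notin_nonpos_Reals[OF w]) auto
  obtain e where e: "e > 0" "cball w e \<subseteq> slit_plane"
    using open_slit_plane w open_contains_cball by blast
  let ?K = "(\<lambda>p. (1 - fst p * of_real (snd p)) powr (- b)) ` (cball w e \<times> {0..1})"
  have "continuous_on (cball w e \<times> {0..1}) (\<lambda>p. (1 - fst p * of_real (snd p)) powr (- b))"
    using e(2) by (intro continuous_on_powr_slit continuous_intros one_minus_mult_notin_nonpos_Reals)
      (auto simp: subset_iff)
  then have "bounded ?K"
    by (intro compact_imp_bounded compact_continuous_image compact_Times) auto
  then obtain B where "\<forall>x\<in>?K. norm x \<le> B"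
    unfolding bounded_iff by blast
  then have "\<forall>v\<in>ball w e \<inter> slit_plane. \<forall>r\<in>{0<..<1}. norm ((1 - v * complex_of_real r) powr (- b)) \<le> B"
    by force
  then show "\<exists>e>0. \<exists>B. \<forall>v\<in>ball w e \<inter> slit_plane. \<forall>r\<in>{0<..<1}. norm ((1 - v * complex_of_real r) powr (- b)) \<le> B"
    using e(1) by blast
qed

lemma hyp2F1_reg_series_Euler_integral:
  assumes a: "Re a > 0" and c: "Re c > Re a" and w: "norm w < 1"
  shows "rGamma a * rGamma (c - a) * (LINT r:{0<..<1}|lborel. beta_weight a (c - a) r *
      (1 - w * of_real r) powr (- b)) =
    hyp2F1_reg_series a b c w"
proof -
  let ?I = "LINT r:{0<..<1}|lborel. beta_weight a (c - a) r * (1 - w * of_real r) powr (- b)"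
  have "rGamma a * ?I = (LINT r:{0<..<1}|lborel. beta_weight a (c - a) r * hyp2F1_reg_series a b a (w * of_real r))"
    unfolding set_integral_mult_right[symmetric]
  proof (intro set_lebesgue_integral_cong allI impI)
    fix r :: real assume "r \<in> {0<..<1}"
    then have "norm w * r \<le> norm w" by (intro mult_left_le) auto
    then have "norm (w * of_real r) < 1" using w \<open>r \<in> {0<..<1}\<close> by (simp add: norm_mult)
    then show "rGamma a * (beta_weight a (c - a) r * (1 - w * of_real r) powr (- b)) =
        beta_weight a (c - a) r * hyp2F1_reg_series a b a (w * of_real r)"
      by (simp add: hyp2F1_reg_series_powr)
  qed simp
  also have "\<dots> = Gamma (c - a) * hyp2F1_reg_series a b (a + (c - a)) w"
    using a c by (intro hyp2F1_reg_series_beta_integral w) auto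
  finally have "rGamma (c - a) * (rGamma a * ?I) = (rGamma (c - a) * Gamma (c - a)) * hyp2F1_reg_series a b c w"
    by simp
  also have "rGamma (c - a) * Gamma (c - a) = 1"
    using c by (simp add: Gamma_def rGamma_eq_zero_iff notin_nonpos_Ints_Re)
  finally show ?thesis by (simp add: mult_ac)
qed

lemma hyp_continuation_Euler:
  assumes "Re a > 0" "Re c > Re a"
  shows "hyp_continuation a b c (\<lambda>w. rGamma a * rGamma (c - a) *
    (LINT r:{0<..<1}|lborel. beta_weight a (c - a) r * (1 - w * of_real r) powr (- b)))"
  unfolding hyp_continuation_def
  using hyp2F1_reg_series_Euler_integral[OF assms]
  by (auto intro!: holomorphic_intros hyp_Euler_integral_holomorphic assms)

lemma hyp2F1_reg_series_contiguous:
  assumes "norm w < 1"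
  shows "hyp2F1_reg_series a b c w =
    c * hyp2F1_reg_series a b (c + 1) w + w * deriv (hyp2F1_reg_series a b (c + 1)) w"
proof -
  let ?h = "hyp_coeff a b (c + 1)"
  have "deriv (hyp2F1_reg_series a b (c + 1)) w = (\<Sum>n. diffs ?h n * w ^ n)"
    by (rule DERIV_imp_deriv[OF hyp_coeff_diffs(1)[OF assms]])
  then have "(\<lambda>n. (of_nat (Suc n) * ?h (Suc n)) * w ^ n) sums deriv (hyp2F1_reg_series a b (c + 1)) w"
    using summable_sums[OF hyp_coeff_diffs(2)[OF assms]] by (simp add: diffs_def)
  then have "(\<lambda>n. (of_nat n * ?h n) * w ^ n) sums (w * deriv (hyp2F1_reg_series a b (c + 1)) w)"
    by (intro sums_powser_mult) auto
  moreover have "(\<lambda>n. c * (?h n * w ^ n)) sums (c * hyp2F1_reg_series a b (c + 1) w)"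
    unfolding hyp2F1_reg_series_eq by (intro sums_mult summable_sums hyp_coeff_summable assms)
  ultimately have "(\<lambda>n. c * (?h n * w ^ n) + (of_nat n * ?h n) * w ^ n) sums
      (c * hyp2F1_reg_series a b (c + 1) w + w * deriv (hyp2F1_reg_series a b (c + 1)) w)"
    by (rule sums_add[rotated])
  moreover have "c * (?h n * w ^ n) + (of_nat n * ?h n) * w ^ n = hyp_coeff a b c n * w ^ n" for n
  proof -
    have "(c + of_nat n) * rGamma (c + 1 + of_nat n) = rGamma (c + of_nat n)"
      using rGamma_plus1[of "c + of_nat n"] by (simp add: add_ac)
    then have "hyp_coeff a b c n = (c + of_nat n) * ?h n"
      by (simp add: hyp_coeff_def)
    then show ?thesis by (simp add: algebra_simps)
  qed
  ultimately show ?thesis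
    by (simp add: hyp2F1_reg_series_eq sums_iff)
qed

lemma hyp_continuation_contiguous:
  assumes F: "hyp_continuation a b (c + 1) F"
  shows "hyp_continuation a b c (\<lambda>w. c * F w + w * deriv F w)"
  unfolding hyp_continuation_def
proof (intro conjI allI impI)
  show "(\<lambda>w. c * F w + w * deriv F w) holomorphic_on slit_plane"
    using F unfolding hyp_continuation_def by (intro holomorphic_intros holomorphic_deriv open_slit_plane) auto
  fix w :: complex assume w: "norm w < 1"
  then have "\<forall>\<^sub>F v in nhds w. v \<in> ball 0 1" by (intro eventually_nhds_in_open) auto
  then have "\<forall>\<^sub>F v in nhds w. F v = hyp2F1_reg_series a b (c + 1) v"
    by eventually_elim (use F in \<open>simp add: hyp_continuation_def\<close>)
  then have "deriv F w = deriv (hyp2F1_reg_series a b (c + 1)) w" by (rule deriv_cong_ev) simp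
  then show "c * F w + w * deriv F w = hyp2F1_reg_series a b c w"
    using F w by (simp add: hyp_continuation_def hyp2F1_reg_series_contiguous[OF w, of a b c])
qed

lemma hyp_continuation_exists:
  assumes a: "Re a > 0"
  shows "\<exists>F. hyp_continuation a b c F"
proof -
  have "\<exists>F. hyp_continuation a b c F" if "Re c + real k > Re a" for k c
    using that
  proof (induction k arbitrary: c)
    case 0
    then show ?case using hyp_continuation_Euler[OF a] by fastforce
  next
    case (Suc k)
    then have "\<exists>F. hyp_continuation a b (c + 1) F" by (intro Suc.IH) simp
    then show ?case using hyp_continuation_contiguous by blast
  qed
  moreover obtain k :: nat where "Re a - Re c < real k" using reals_Archimedean2 by blast
  ultimately show ?thesis by (metis diff_less_eq add.commute)
qed

lemma
  assumes "Re a > 0"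
  shows hyp2F1_reg_holomorphic: "hyp2F1_reg a b c holomorphic_on slit_plane"
    and hyp2F1_reg_eq_series: "norm w < 1 \<Longrightarrow> hyp2F1_reg a b c w = hyp2F1_reg_series a b c w"
  using someI_ex[OF hyp_continuation_exists[OF assms, of b c]]
  unfolding hyp2F1_reg_def hyp_continuation_def by blast+

section \<open>The expansion on the imaginary segment\<close>

lemma Ln_unit:
  assumes "v\<^sup>2 = - 1"
  shows "Ln v = v * of_real (pi / 2)"
  using assms by (auto simp: square_eq_minus_one_iff)

lemma powr_of_real_mult_unit:
  fixes v :: complex
  assumes s: "s > 0" and v: "v\<^sup>2 = - 1"
  shows "(of_real s * v) powr of_real a = of_real (s powr a) * exp (of_real a * (v * of_real (pi / 2)))"
proof -
  have "(of_real s * v) powr of_real a = of_real s powr of_real a * v powr of_real a"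
    using s by (intro powr_times_real_left) auto
  moreover have "v \<noteq> 0" using v by auto
  ultimately show ?thesis
    using powr_of_real[of s a] s by (simp add: powr_def[of v] Ln_unit[OF v])
qed

definition coth_half :: "complex \<Rightarrow> complex" where
  "coth_half \<xi> = cosh (\<xi> / 2) / sinh (\<xi> / 2)"

lemma sin_half_pos: "0 < b \<Longrightarrow> b < pi \<Longrightarrow> sin (b / 2) > 0"
  and cos_half_pos: "0 < b \<Longrightarrow> b < pi \<Longrightarrow> cos (b / 2) > 0"
  by (auto intro: sin_gt_zero cos_gt_zero_pi)

lemma coth_half_unit:
  assumes "v\<^sup>2 = - 1"
  shows "coth_half (of_real b * v) = of_real (cos (b/2) / sin (b/2)) * (- v)"
proof -
  have "coth_half (of_real b * v) = of_real (cos (b/2)) / (v * of_real (sin (b/2)))"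
    using cosh_of_real_mult_unit[OF assms, of "b/2"] by (simp add: coth_half_def mult.commute)
  also have "\<dots> = of_real (cos (b/2) / sin (b/2)) * inverse v"
    by (simp only: of_real_mult of_real_inverse divide_inverse inverse_mult_distrib mult_ac)
  also have "inverse v = - v" using assms by (auto simp: square_eq_minus_one_iff)
  finally show ?thesis .
qed

lemma legendre_prefactor_modulus:
  assumes b: "0 < b" "b < pi"
  shows "sqrt (2 * pi * sin b) * (cos (b/2) / sin (b/2)) powr m * sin b powr (- m - 1/2) =
    2 * (sqrt pi * ((2 * (sin (b/2))\<^sup>2) powr (- m - 1/2) * sin (b/2)))"
proof -
  define s c where "s = sin (b/2)" and "c = cos (b/2)"
  have s: "s > 0" and c: "c > 0" using sin_half_pos[OF b] cos_half_pos[OF b] by (simp_all add: s_def c_def)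
  have sin_b: "sin b = 2 * s\<^sup>2 * (c / s)"
    using s sin_double[of "b/2"] by (simp add: s_def c_def power2_eq_square)
  have "(c / s) powr m * sin b powr (- m - 1/2) = (2 * s\<^sup>2) powr (- m - 1/2) * (c / s) powr (m + (- m - 1/2))"
    unfolding sin_b powr_mult powr_add by (simp only: mult_ac)
  also have "(c / s) powr (m + (- m - 1/2)) = 1 / sqrt (c / s)"
    using s c by (simp add: powr_minus_divide[of _ "1/2"] powr_half_sqrt)
  finally have "(c / s) powr m * sin b powr (- m - 1/2) = (2 * s\<^sup>2) powr (- m - 1/2) * (1 / sqrt (c / s))" .
  moreover have "2 * pi * sin b = pi * (2 * s)\<^sup>2 * (c / s)" by (simp add: sin_b power2_eq_square)
  then have "sqrt (2 * pi * sin b) = sqrt pi * (2 * s) * sqrt (c / s)"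
    using s by (simp only: real_sqrt_mult real_sqrt_abs abs_of_pos mult_pos_pos zero_less_numeral)
  ultimately show ?thesis
    using s c unfolding s_def[symmetric] c_def[symmetric] by (simp only: mult.assoc) simp
qed

lemma legendre_prefactor_phase:
  fixes v :: complex
  assumes v: "v\<^sup>2 = - 1"
  shows "exp (of_real (1/2) * (v * of_real (pi / 2))) * exp (of_real m * (- v * of_real (pi / 2))) *
    exp (of_real (- m - 1/2) * (- v * of_real (pi / 2))) = v"
proof -
  have "exp (of_real (1/2) * (v * of_real (pi / 2))) * exp (of_real m * (- v * of_real (pi / 2))) *
      exp (of_real (- m - 1/2) * (- v * of_real (pi / 2))) = exp (of_real (pi / 2) * v)"
    unfolding exp_add[symmetric] by (simp add: algebra_simps)
  then show ?thesis using exp_of_real_mult_unit(1)[OF v, of "pi / 2"] by simp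
qed

lemma legendre_prefactor_unit:
  assumes b: "0 < b" "b < pi" and v: "v\<^sup>2 = - 1"
  defines "\<xi> \<equiv> of_real b * v"
  shows "csqrt (2 * of_real pi * sinh \<xi>) * coth_half \<xi> powr of_real m *
      (- v * of_real (sin b)) powr of_real (- m - 1/2) =
    2 * v * of_real (sqrt pi * ((2 * (sin (b/2))\<^sup>2) powr (- m - 1/2) * sin (b/2)))"
proof -
  let ?c = "cos (b/2) / sin (b/2)" and ?e = "\<lambda>a v. exp (complex_of_real a * (v * of_real (pi / 2)))"
  have v': "(- v)\<^sup>2 = - 1" using v by simp
  have sin_b: "sin b > 0" using sin_gt_zero b by simp
  have c: "?c > 0" using sin_half_pos[OF b] cos_half_pos[OF b] by simp
  have "csqrt (2 * of_real pi * sinh \<xi>) = (of_real (2 * pi * sin b) * v) powr of_real (1/2)"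
    unfolding \<xi>_def cosh_of_real_mult_unit(2)[OF v] csqrt_conv_powr by (simp add: mult_ac)
  then have sqrt: "csqrt (2 * of_real pi * sinh \<xi>) = of_real (sqrt (2 * pi * sin b)) * ?e (1/2) v"
    using powr_of_real_mult_unit[OF _ v, of "2 * pi * sin b" "1/2"] sin_b by (simp add: powr_half_sqrt)
  have coth: "coth_half \<xi> powr of_real m = of_real (?c powr m) * ?e m (- v)"
    unfolding \<xi>_def coth_half_unit[OF v] by (rule powr_of_real_mult_unit[OF c v'])
  have ray: "(- v * of_real (sin b)) powr of_real (- m - 1/2) =
      of_real (sin b powr (- m - 1/2)) * ?e (- m - 1/2) (- v)"
    using powr_of_real_mult_unit[OF sin_b v', of "- m - 1/2"] by (simp only: mult.commute)
  have "csqrt (2 * of_real pi * sinh \<xi>) * coth_half \<xi> powr of_real m *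
      (- v * of_real (sin b)) powr of_real (- m - 1/2) =
      of_real (sqrt (2 * pi * sin b) * ?c powr m * sin b powr (- m - 1/2)) *
          (?e (1/2) v * ?e m (- v) * ?e (- m - 1/2) (- v))"
    unfolding sqrt coth ray by (simp only: of_real_mult mult_ac)
  then show ?thesis
    unfolding legendre_prefactor_modulus[OF b] legendre_prefactor_phase[OF v] by simp
qed

lemma continuous_on_hyp2F1_reg_series: "continuous_on (ball 0 1) (hyp2F1_reg_series a b c)"
  using DERIV_isCont[OF hyp_coeff_diffs(1)] by (intro continuous_at_imp_continuous_on) auto

lemma mehler_integral_hypergeometric:
  assumes b: "0 < b" "b < pi" and m: "\<bar>m\<bar> < 1/2" and \<nu>: "Re \<nu> > - 1/2"
  shows "(LINT \<eta>:{0<..<b}|lborel. of_real ((cos \<eta> - cos b) powr (- m - 1/2)) * cos ((\<nu> + 1/2) * of_real \<eta>)) =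
    of_real (sqrt pi * ((2 * (sin (b/2))\<^sup>2) powr (- m - 1/2) * sin (b/2))) *
    (Gamma (1/2 - of_real m) * hyp2F1_reg_series (\<nu> + 1) (- \<nu>) (1 - of_real m) (of_real ((sin (b/2))\<^sup>2)))"
proof -
  define w where "w = (sin (b/2))\<^sup>2"
  have w: "0 < w" "w < 1"
  proof -
    show "0 < w" using sin_half_pos[OF b] by (simp add: w_def)
    show "w < 1" using cos_half_pos[OF b] by (simp add: w_def sin_squared_eq)
  qed
  define H where "H = (\<lambda>x. complex_of_real (sqrt pi) * hyp2F1_reg_series (\<nu> + 1) (- \<nu>) (1/2) (of_real x))"
  have H: "continuous_on {0..w} H"
    unfolding H_def using w
    by (intro continuous_on_mult_left continuous_on_compose2[OF continuous_on_hyp2F1_reg_series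
      continuous_on_of_real_id]) auto
  then have H_Ioo: "continuous_on {0<..<w} H" by (rule continuous_on_subset) auto
  from H have "bounded (H ` {0..w})"
    by (intro compact_imp_bounded compact_continuous_image compact_Icc)
  then obtain B where B: "\<forall>z\<in>H ` {0..w}. norm z \<le> B" unfolding bounded_iff by blast
  have "(LINT \<eta>:{0<..<b}|lborel. of_real ((cos \<eta> - cos b) powr (- m - 1/2)) * cos ((\<nu> + 1/2) * of_real \<eta>)) =
      (LINT \<eta>:{0<..<b}|lborel. of_real ((cos \<eta> - cos b) powr (- m - 1/2) * cos (\<eta>/2)) * H ((sin (\<eta>/2))\<^sup>2))"
    using b cos_half_mult_hyp2F1_reg_series[OF \<nu>]
    by (intro set_lebesgue_integral_cong) (simp_all add: H_def mult.assoc)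
  also have "\<dots> = of_real ((2 * w) powr (- m - 1/2) * sin (b/2)) *
      (LINT r:{0<..<1}|lborel. beta_weight (1/2) (1/2 - of_real m) r * H (w * r))"
    unfolding w_def
    by (rule mehler_weight_substitution(2)[OF b]) (use m B H_Ioo in \<open>auto simp: w_def\<close>)
  also have "(LINT r:{0<..<1}|lborel. beta_weight (1/2) (1/2 - of_real m) r * H (w * r)) = (LINT r:{0<..<1}|lborel.
      of_real (sqrt pi) * (beta_weight (1/2) (1/2 - of_real m) r * hyp2F1_reg_series (\<nu> + 1) (- \<nu>) (1/2)
          (of_real w * of_real r)))"
    by (simp add: H_def mult_ac)
  also have "\<dots> = of_real (sqrt pi) * (Gamma (1/2 - of_real m) *
      hyp2F1_reg_series (\<nu> + 1) (- \<nu>) (1/2 + (1/2 - of_real m)) (of_real w))"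
    using m w by (simp only: set_integral_mult_right) (subst hyp2F1_reg_series_beta_integral; simp)
  finally show ?thesis by (simp add: w_def mult_ac)
qed

definition legendre_borel_sum :: "nat \<Rightarrow> complex \<Rightarrow> complex \<Rightarrow> complex \<Rightarrow> complex" where
  "legendre_borel_sum N x \<mu> \<nu> = (\<Sum>n<N. a_coeff n \<mu> * Gamma (\<nu> - of_nat n + 1/2) * x ^ n) + legendre_rem N x \<mu> \<nu>"

lemma legendre_borel_sum_independent:
  assumes "\<bar>Re \<mu>\<bar> < real (min N M) + 1/2" "Re \<nu> > real (max N M) - 1/2" "x \<notin> \<real>\<^sub>\<le>\<^sub>0"
  shows "legendre_borel_sum N x \<mu> \<nu> = legendre_borel_sum M x \<mu> \<nu>"
  using assms
proof (induction N M rule: linorder_wlog)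
  case (le N M)
  then show ?case
    using legendre_rem_expand[OF \<open>N \<le> M\<close>, of \<mu> x \<nu>]
    by (simp add: legendre_borel_sum_def lessThan_atLeast0 sum.atLeastLessThan_concat[of 0 N M, symmetric])
qed (simp add: min.commute max.commute)

lemma a_coeff_holomorphic: "(\<lambda>\<mu>. a_coeff n \<mu> :: complex) holomorphic_on A"
  unfolding a_coeff_def by (intro holomorphic_intros) auto

lemma legendre_borel_sum_holomorphic:
  assumes "\<bar>Re \<mu>\<bar> < real N + 1/2" "Re \<nu> > real N - 1/2"
  shows "(\<lambda>x. legendre_borel_sum N x \<mu> \<nu>) holomorphic_on - \<real>\<^sub>\<le>\<^sub>0"
  unfolding legendre_borel_sum_def by (intro holomorphic_intros legendre_rem_holomorphic assms)

lemma legendre_borel_sum_holomorphic_order: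
  assumes "x \<notin> \<real>\<^sub>\<le>\<^sub>0" "Re \<nu> > real N - 1/2"
  shows "(\<lambda>\<mu>. legendre_borel_sum N x \<mu> \<nu>) holomorphic_on {\<mu>. \<bar>Re \<mu>\<bar> < real N + 1/2}"
  unfolding legendre_borel_sum_def
  by (intro holomorphic_intros a_coeff_holomorphic legendre_rem_holomorphic_order assms)

definition connection_coeff :: "complex \<Rightarrow> complex \<Rightarrow> complex" where
  "connection_coeff v \<mu> = v * exp (- (v * of_real pi * \<mu>))"

lemma connection_coeff_powr:
  assumes s: "s > 0" and v: "v\<^sup>2 = - 1"
  shows "(v * of_real s) powr of_real (- m - 1/2) = - connection_coeff v (of_real m) *
      (- v * of_real s) powr of_real (- m - 1/2)"
proof -
  let ?a = "complex_of_real (- m - 1/2)"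
  have v': "(- v)\<^sup>2 = - 1" using v by simp
  have "exp (?a * (v * of_real (pi / 2))) = exp (?a * (v * of_real pi)) * exp (?a * (- v * of_real (pi / 2)))"
    unfolding exp_add[symmetric] by (rule arg_cong[where f = exp]) (simp add: field_simps)
  also have "exp (?a * (v * of_real pi)) = exp (- (v * of_real pi * of_real m)) * exp (- (of_real (pi / 2) * v))"
    unfolding exp_add[symmetric] by (rule arg_cong[where f = exp]) (simp add: field_simps)
  also have "exp (- (of_real (pi / 2) * v)) = - v"
    using exp_of_real_mult_unit(2)[OF v, of "pi / 2"] by simp
  finally show ?thesis
    using powr_of_real_mult_unit[OF s v, of "- m - 1/2"] powr_of_real_mult_unit[OF s v', of "- m - 1/2"]
    by (simp add: connection_coeff_def mult_ac)
qed

lemma legendre_arguments_unit: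
  fixes v :: complex
  assumes "sin b \<noteq> 0" and v: "v\<^sup>2 = - 1"
  shows "- exp (- (of_real b * v)) / sinh (of_real b * v) = 1 + v * of_real (cot b)"
    and "exp (of_real b * v) / sinh (of_real b * v) = 1 - v * of_real (cot b)"
  using assms unfolding exp_of_real_mult_unit[OF v] cosh_of_real_mult_unit[OF v]
  by (auto simp: square_eq_minus_one_iff cot_def field_simps)

lemma mehler_ray_legendre_rem:
  assumes b: "sin b \<noteq> 0" and m: "\<bar>m\<bar> < 1/2" and \<nu>: "Re \<nu> > - 1/2" and v: "v\<^sup>2 = - 1"
  shows "Gamma (\<nu> - of_real m + 1) * rGamma (1/2 - of_real m) *
      (LINT \<theta>:{..<0}|lborel. mehler_kernel b m \<nu> (of_real \<theta> + of_real b * v)) =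
    exp ((\<nu> + 1/2) * (of_real b * v)) * (- v * of_real (sin b)) powr of_real (- m - 1/2) *
      legendre_rem 0 (1 + v * of_real (cot b)) (of_real m) \<nu>"
proof -
  have "1 + v * of_real (cot b) \<notin> \<real>\<^sub>\<le>\<^sub>0"
    using v by (intro notin_nonpos_Reals_Re) (auto simp: square_eq_minus_one_iff)
  from legendre_rem_0_euler[OF m \<nu> this] show ?thesis
    unfolding mehler_kernel_ray_integral(2)[OF m \<nu> b v] by (simp add: algebra_simps)
qed

lemma mehler_rays:
  assumes b: "0 < b" "b < pi" and m: "\<bar>m\<bar> < 1/2" and \<nu>: "Re \<nu> > - 1/2" and v: "v\<^sup>2 = - 1"
  shows "(LINT \<theta>:{..<0}|lborel. mehler_kernel b m \<nu> (of_real \<theta> + of_real b * v)) -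
      (LINT \<theta>:{..<0}|lborel. mehler_kernel b m \<nu> (of_real \<theta> + of_real b * (- v))) =
    2 * v * (LINT \<eta>:{0<..<b}|lborel. of_real ((cos \<eta> - cos b) powr (- m - 1/2)) * cos ((\<nu> + 1/2) * of_real \<eta>))"
proof -
  consider "v = \<i>" | "v = - \<i>" using v by (auto simp: square_eq_minus_one_iff)
  then show ?thesis using mehler_contour[OF b m \<nu>] by cases (simp_all add: algebra_simps)
qed

lemma legendre_expansion_imaginary_real:
  assumes b: "0 < b" "b < pi" and m: "\<bar>m\<bar> < 1/2" and \<nu>: "Re \<nu> > - 1/2" and v: "v\<^sup>2 = - 1"
  defines "\<xi> \<equiv> of_real b * v"
  shows "Gamma (\<nu> - of_real m + 1) * csqrt (2 * of_real pi * sinh \<xi>) *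
      (coth_half \<xi> powr of_real m * hyp2F1_reg_series (\<nu> + 1) (- \<nu>) (1 - of_real m) ((1 - cosh \<xi>) / 2)) =
    exp ((\<nu> + 1/2) * \<xi>) * legendre_rem 0 (- exp (- \<xi>) / sinh \<xi>) (of_real m) \<nu> +
    connection_coeff v (of_real m) * exp (- (\<nu> + 1/2) * \<xi>) * legendre_rem 0 (exp \<xi> / sinh \<xi>) (of_real m) \<nu>"
proof -
  have sin_b: "sin b > 0" "sin b \<noteq> 0" using sin_gt_zero b by force+
  have v': "(- v)\<^sup>2 = - 1" using v by simp
  let ?F = "hyp2F1_reg_series (\<nu> + 1) (- \<nu>) (1 - of_real m) ((1 - cosh \<xi>) / 2)"
  let ?G = "Gamma (\<nu> - of_real m + 1)" and ?g = "rGamma (1/2 - complex_of_real m)"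
  let ?A = "csqrt (2 * of_real pi * sinh \<xi>) * coth_half \<xi> powr of_real m"
  let ?p = "(- v * of_real (sin b)) powr of_real (- m - 1/2)"
  let ?R = "\<lambda>v. LINT \<theta>:{..<0}|lborel. mehler_kernel b m \<nu> (of_real \<theta> + of_real b * v)"
  have "(1 - cosh \<xi>) / 2 = of_real ((sin (b/2))\<^sup>2)"
    using cos_double_sin[of "b/2"] by (simp add: \<xi>_def cosh_of_real_mult_unit[OF v])
  then have F: "?F = hyp2F1_reg_series (\<nu> + 1) (- \<nu>) (1 - of_real m) (of_real ((sin (b/2))\<^sup>2))"
    by (simp only:)
  have g: "?g * Gamma (1/2 - complex_of_real m) = 1"
    using m by (simp add: Gamma_def rGamma_eq_zero_iff notin_nonpos_Ints_Re)
  have "?G * (?A * ?F) * ?p = ?G * ?F * (?A * ?p) * (?g * Gamma (1/2 - complex_of_real m))"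
    unfolding g by (simp only: mult_ac mult_1_left)
  also have "?A * ?p = 2 * v * of_real (sqrt pi * ((2 * (sin (b/2))\<^sup>2) powr (- m - 1/2) * sin (b/2)))"
    unfolding \<xi>_def by (rule legendre_prefactor_unit[OF b v])
  also have "?G * ?F * (2 * v * of_real (sqrt pi * ((2 * (sin (b/2))\<^sup>2) powr (- m - 1/2) * sin (b/2)))) *
      (?g * Gamma (1/2 - complex_of_real m)) = ?G * ?g * (2 * v *
      (LINT \<eta>:{0<..<b}|lborel. of_real ((cos \<eta> - cos b) powr (- m - 1/2)) * cos ((\<nu> + 1/2) * of_real \<eta>)))"
    unfolding mehler_integral_hypergeometric[OF b m \<nu>] F by (simp only: mult_ac)
  also have "\<dots> = ?G * ?g * ?R v - ?G * ?g * ?R (- v)"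
    unfolding mehler_rays[OF b m \<nu> v, symmetric] by (rule right_diff_distrib)
  also have "\<dots> = (exp ((\<nu> + 1/2) * \<xi>) * legendre_rem 0 (- exp (- \<xi>) / sinh \<xi>) (of_real m) \<nu> +
      connection_coeff v (of_real m) * exp (- (\<nu> + 1/2) * \<xi>) * legendre_rem 0 (exp \<xi> / sinh \<xi>) (of_real m) \<nu>) * ?p"
    unfolding mehler_ray_legendre_rem[OF sin_b(2) m \<nu> v] mehler_ray_legendre_rem[OF sin_b(2) m \<nu> v']
    unfolding \<xi>_def legendre_arguments_unit[OF sin_b(2) v] minus_minus connection_coeff_powr[OF sin_b(1) v]
    by (simp add: algebra_simps)
  finally show ?thesis
    using sin_b v by (auto simp: mult.assoc)
qed

lemma norm_hyp_argument_unit: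
  fixes v :: complex
  assumes "0 < b" "b < pi" "v\<^sup>2 = - 1"
  shows "norm ((1 - cosh (of_real b * v)) / 2) < 1"
proof -
  have "(1 - cosh (of_real b * v)) / 2 = of_real ((1 - cos b) / 2)"
    by (simp add: cosh_of_real_mult_unit[OF assms(3)])
  moreover have "cos pi < cos b" using assms by (intro cos_monotone_0_pi) auto
  then have "\<bar>(1 - cos b) / 2\<bar> < 1" using cos_le_one[of b] by simp
  ultimately show ?thesis by (simp only: norm_of_real)
qed

lemma legendre_arguments_unit_notin_nonpos_Reals:
  fixes v :: complex
  assumes "sin b \<noteq> 0" and v: "v\<^sup>2 = - 1"
  shows "- exp (- (of_real b * v)) / sinh (of_real b * v) \<notin> \<real>\<^sub>\<le>\<^sub>0"
    and "exp (of_real b * v) / sinh (of_real b * v) \<notin> \<real>\<^sub>\<le>\<^sub>0"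
  unfolding legendre_arguments_unit[OF assms]
  using v by (auto intro!: notin_nonpos_Reals_Re simp: square_eq_minus_one_iff)

lemma legendre_expansion_imaginary:
  assumes \<mu>: "\<bar>Re \<mu>\<bar> < real N + 1/2" and \<nu>: "Re \<nu> > real N - 1/2" and b: "0 < b" "b < pi" and v: "v\<^sup>2 = - 1"
  defines "\<xi> \<equiv> of_real b * v"
  shows "Gamma (\<nu> - \<mu> + 1) * csqrt (2 * of_real pi * sinh \<xi>) *
      (coth_half \<xi> powr \<mu> * hyp2F1_reg_series (\<nu> + 1) (- \<nu>) (1 - \<mu>) ((1 - cosh \<xi>) / 2)) =
    exp ((\<nu> + 1/2) * \<xi>) * legendre_borel_sum N (- exp (- \<xi>) / sinh \<xi>) \<mu> \<nu> +
    connection_coeff v \<mu> * exp (- (\<nu> + 1/2) * \<xi>) * legendre_borel_sum N (exp \<xi> / sinh \<xi>) \<mu> \<nu>" (is "?L \<mu> = ?R \<mu>")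
proof (rule analytic_continuation_from_reals[where f = ?L and g = ?R and S = "{\<mu>. \<bar>Re \<mu>\<bar> < real N + 1/2}"
    and a = "- 1/2" and b = "1/2"])
  let ?U = "{\<mu>. \<bar>Re \<mu>\<bar> < real N + 1/2}"
  have "sin b \<noteq> 0" using sin_gt_zero b by force
  note notin = legendre_arguments_unit_notin_nonpos_Reals[OF this v, folded \<xi>_def]
  have "(\<lambda>\<mu>. hyp2F1_reg_series (\<nu> + 1) (- \<nu>) (1 - \<mu>) ((1 - cosh \<xi>) / 2)) holomorphic_on ?U"
    unfolding \<xi>_def
    by (rule holomorphic_on_compose_gen[OF _
      hyp2F1_reg_series_holomorphic_parameter[OF norm_hyp_argument_unit[OF b v]], unfolded o_def])
       (auto intro!: holomorphic_intros)
  then show "?L holomorphic_on ?U"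
    using \<nu> by (intro holomorphic_intros notin_nonpos_Ints_Re) auto
  show "?R holomorphic_on ?U"
    unfolding connection_coeff_def by (intro holomorphic_intros legendre_borel_sum_holomorphic_order notin \<nu>)
  show "open ?U" by (intro open_Collect_less continuous_intros)
  have "?U = {\<mu>. Re \<mu> < real N + 1/2} \<inter> {\<mu>. Re \<mu> > - (real N + 1/2)}" by auto
  then show "connected ?U"
    by (simp only:) (intro convex_connected convex_Int convex_halfspace_Re_lt convex_halfspace_Re_gt)
  fix m :: real assume "- 1/2 < m" "m < 1/2"
  then have m: "\<bar>m\<bar> < 1/2" by auto
  have "legendre_borel_sum N x (of_real m) \<nu> = legendre_rem 0 x (of_real m) \<nu>" if "x \<notin> \<real>\<^sub>\<le>\<^sub>0" for x
    using legendre_borel_sum_independent[of "of_real m" N 0 \<nu> x] m \<nu> that by (simp add: legendre_borel_sum_def)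
  then show "?L (of_real m) = ?R (of_real m)"
    unfolding \<xi>_def using legendre_expansion_imaginary_real[OF b m _ v, of \<nu>] \<nu> notin by (simp add: \<xi>_def)
qed (use \<mu> in auto)

section \<open>Continuation off the imaginary axis\<close>

definition legendre_domain :: "complex set" where
  "legendre_domain = {\<xi>. \<bar>Im \<xi>\<bar> < pi \<and> (Im \<xi> = 0 \<longrightarrow> Re \<xi> > 0)}"

lemma D1_subset_legendre_domain: "D1 \<subseteq> legendre_domain"
  by (auto simp: D1_def legendre_domain_def)

lemma open_legendre_domain: "open legendre_domain"
proof -
  have "legendre_domain = {\<xi>. \<bar>Im \<xi>\<bar> < pi} \<inter> ({\<xi>. Im \<xi> \<noteq> 0} \<union> {\<xi>. Re \<xi> > 0})"
    by (auto simp: legendre_domain_def)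
  moreover have "open ({\<xi>. \<bar>Im \<xi>\<bar> < pi} \<inter> ({\<xi>. Im \<xi> \<noteq> 0} \<union> {\<xi>. Re \<xi> > 0}))"
    by (intro open_Int open_Un open_Collect_less open_Collect_neq continuous_intros)
  ultimately show ?thesis by simp
qed

lemma Re_sinh: "Re (sinh t) = sinh (Re t) * cos (Im t)"
  and Im_sinh: "Im (sinh t) = cosh (Re t) * sin (Im t)"
  by (simp_all add: cosh_def sinh_def Re_exp Im_exp algebra_simps)

lemma sin_nonzero_strip: "y \<noteq> 0 \<Longrightarrow> \<bar>y\<bar> < pi \<Longrightarrow> sin y \<noteq> (0::real)"
  using sin_eq_0_pi[of y] by (auto simp: abs_less_iff)

lemma two_pi_sinh_notin_nonpos_Reals:
  assumes "\<xi> \<in> legendre_domain"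
  shows "2 * of_real pi * sinh \<xi> \<notin> \<real>\<^sub>\<le>\<^sub>0"
proof (cases "Im \<xi> = 0")
  case True
  then show ?thesis using assms by (intro notin_nonpos_Reals_Re) (simp add: legendre_domain_def Re_sinh)
next
  case False
  then have "Im (sinh \<xi>) \<noteq> 0"
    using assms sin_nonzero_strip[of "Im \<xi>"] cosh_real_pos[of "Re \<xi>"] by (simp add: legendre_domain_def Im_sinh)
  then show ?thesis by (simp add: complex_nonpos_Reals_iff)
qed

lemma sinh_nonzero: "\<xi> \<in> legendre_domain \<Longrightarrow> sinh \<xi> \<noteq> 0"
  using two_pi_sinh_notin_nonpos_Reals by fastforce

lemma sinh_half_nonzero: "\<xi> \<in> legendre_domain \<Longrightarrow> sinh (\<xi> / 2) \<noteq> 0"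
  using sinh_nonzero[of \<xi>] sinh_double[of "\<xi> / 2"] by auto

lemma coth_half_eq: "coth_half \<xi> = (1 + exp (- \<xi>)) / (1 - exp (- \<xi>))"
proof -
  have "2 * cosh (\<xi> / 2) = exp (\<xi> / 2) * (1 + exp (- \<xi>))" "2 * sinh (\<xi> / 2) = exp (\<xi> / 2) * (1 - exp (- \<xi>))"
    by (simp_all add: cosh_field_def sinh_field_def distrib_left right_diff_distrib exp_add[symmetric])
  then have "(2 * cosh (\<xi> / 2)) / (2 * sinh (\<xi> / 2)) = (1 + exp (- \<xi>)) / (1 - exp (- \<xi>))"
    by (simp only:) simp
  then show ?thesis by (simp add: coth_half_def)
qed

lemma Re_coth_half_pos:
  assumes "Re \<xi> > 0"
  shows "Re (coth_half \<xi>) > 0"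
proof -
  let ?q = "exp (- \<xi>)"
  have "(norm ?q)\<^sup>2 < 1" using assms by (simp add: power_less_one_iff)
  moreover have "Re ((1 + ?q) * cnj (1 - ?q)) = 1 - (norm ?q)\<^sup>2"
    unfolding cmod_power2 by (simp add: power2_eq_square algebra_simps)
  ultimately show ?thesis
    unfolding coth_half_eq Re_complex_div_gt_0 by simp
qed

lemma coth_half_notin_nonpos_Reals:
  assumes "\<xi> \<in> legendre_domain"
  shows "coth_half \<xi> \<notin> \<real>\<^sub>\<le>\<^sub>0"
proof (cases "Im \<xi> = 0")
  case True
  then show ?thesis
    using assms by (intro notin_nonpos_Reals_Re Re_coth_half_pos) (simp add: legendre_domain_def)
next
  case False
  have "Im ((1 + exp (- \<xi>)) * cnj (1 - exp (- \<xi>))) = - 2 * exp (- Re \<xi>) * sin (Im \<xi>)"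
    by (simp add: Im_exp algebra_simps)
  moreover have "sin (Im \<xi>) \<noteq> 0" using assms False by (intro sin_nonzero_strip) (auto simp: legendre_domain_def)
  ultimately have "Im (coth_half \<xi>) \<noteq> 0" unfolding coth_half_eq Im_complex_div_eq_0 by simp
  then show ?thesis by (auto simp: complex_nonpos_Reals_iff)
qed

lemma hyp_argument_in_slit_plane:
  assumes "\<xi> \<in> legendre_domain"
  shows "(1 - cosh \<xi>) / 2 \<in> slit_plane"
proof (rule ccontr)
  assume "(1 - cosh \<xi>) / 2 \<notin> slit_plane"
  then obtain r where r: "r \<ge> 1" "(1 - cosh \<xi>) / 2 = of_real r" by (auto simp: slit_plane_def)
  then have "cosh \<xi> = of_real (1 - 2 * r)" by (simp add: field_simps)
  then have "Re (cosh \<xi>) \<le> - 1" "Im (cosh \<xi>) = 0" using r(1) by simp_all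
  then have le: "cosh (Re \<xi>) * cos (Im \<xi>) \<le> - 1" and Im_0: "sinh (Re \<xi>) = 0 \<or> sin (Im \<xi>) = 0"
    by (auto simp: Re_cosh Im_cosh)
  have Im_lt: "\<bar>Im \<xi>\<bar> < pi" using assms by (simp add: legendre_domain_def)
  show False
  proof (cases "Im \<xi> = 0")
    case True
    then show False using le cosh_real_pos[of "Re \<xi>"] by simp
  next
    case False
    then have "Re \<xi> = 0" using Im_0 sin_nonzero_strip[OF _ Im_lt] by simp
    then have "cos \<bar>Im \<xi>\<bar> \<le> cos pi" using le by simp
    moreover have "cos pi < cos \<bar>Im \<xi>\<bar>" using Im_lt by (intro cos_monotone_0_pi) auto
    ultimately show False by linarith
  qed
qed

lemma legendre_P_cosh:
  assumes "\<xi> \<in> D1"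
  shows "legendre_P \<nu> \<mu> (cosh \<xi>) = coth_half \<xi> powr \<mu> * hyp2F1_reg (\<nu> + 1) (- \<nu>) (1 - \<mu>) ((1 - cosh \<xi>) / 2)"
proof -
  have pos: "Re (coth_half \<xi>) > 0" using assms by (intro Re_coth_half_pos) (simp add: D1_def)
  then have nonzero: "coth_half \<xi> \<noteq> 0" by auto
  have "cosh \<xi> + 1 = 2 * (cosh (\<xi> / 2))\<^sup>2" "cosh \<xi> - 1 = 2 * (sinh (\<xi> / 2))\<^sup>2"
    using cosh_double_cosh[of "\<xi> / 2"] cosh_square_eq[of "\<xi> / 2"] by simp_all
  then have "(cosh \<xi> + 1) / (cosh \<xi> - 1) = coth_half \<xi> * coth_half \<xi>"
    by (simp only:) (simp add: coth_half_def power2_eq_square)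
  moreover have "\<bar>Im (Ln (coth_half \<xi>))\<bar> < pi / 2" using Re_Ln_pos_lt[OF nonzero] pos by simp
  then have "Ln (coth_half \<xi> * coth_half \<xi>) = Ln (coth_half \<xi>) + Ln (coth_half \<xi>)"
    by (intro Ln_times_simple nonzero) auto
  then have "(coth_half \<xi> * coth_half \<xi>) powr (\<mu> / 2) = coth_half \<xi> powr \<mu>"
    using nonzero by (simp add: powr_def)
  ultimately show ?thesis unfolding legendre_P_def by simp
qed

lemma exp_div_sinh_eq: "exp \<xi> / sinh \<xi> = 2 / (1 - exp (- (2 * \<xi>)) :: complex)"
proof -
  have "2 * sinh \<xi> = exp \<xi> * (1 - exp (- (2 * \<xi>)))"
    by (simp add: sinh_field_def right_diff_distrib exp_add[symmetric])
  then have "2 * exp \<xi> / (2 * sinh \<xi>) = 2 / (1 - exp (- (2 * \<xi>)))"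
    by (simp only:) simp
  then show ?thesis by simp
qed

lemma minus_exp_div_sinh_eq: "- exp (- \<xi>) / sinh \<xi> = 2 / (1 - exp (2 * \<xi>) :: complex)"
  using exp_div_sinh_eq[of "- \<xi>"] by simp

lemma Re_exp_div_sinh_pos:
  assumes "Re \<xi> > 0"
  shows "Re (exp \<xi> / sinh \<xi>) > 0"
proof -
  have "Re (exp (- (2 * \<xi>))) \<le> norm (exp (- (2 * \<xi>)))" by (rule complex_Re_le_cmod)
  also have "\<dots> < 1" using assms by simp
  finally show ?thesis unfolding exp_div_sinh_eq Re_complex_div_gt_0 by simp
qed

lemma exp_div_sinh_notin_nonpos_Reals_strip:
  assumes "Im \<xi> \<noteq> 0" "\<bar>Im \<xi>\<bar> < pi"
  shows "exp \<xi> / sinh \<xi> \<notin> \<real>\<^sub>\<le>\<^sub>0"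
proof
  assume "exp \<xi> / sinh \<xi> \<in> \<real>\<^sub>\<le>\<^sub>0"
  then have "inverse (exp \<xi> / sinh \<xi>) \<in> \<real>\<^sub>\<le>\<^sub>0" by (simp only: nonpos_Reals_inverse_iff)
  then have "Re (exp (- (2 * \<xi>))) \<ge> 1" "Im (exp (- (2 * \<xi>))) = 0"
    unfolding exp_div_sinh_eq by (simp_all add: complex_nonpos_Reals_iff)
  then have Re_ge: "exp (- 2 * Re \<xi>) * cos (2 * Im \<xi>) \<ge> 1" and sin_0: "sin (2 * Im \<xi>) = 0"
    by (simp_all add: Re_exp Im_exp)
  have "cos (Im \<xi>) = 0" using sin_0 sin_nonzero_strip[OF assms] by (simp add: sin_double)
  then have "cos (2 * Im \<xi>) \<le> 0" by (simp add: cos_double)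
  then show False using Re_ge mult_nonneg_nonpos[of "exp (- 2 * Re \<xi>)" "cos (2 * Im \<xi>)"] by simp
qed

lemma exp_div_sinh_notin_nonpos_Reals: "\<xi> \<in> legendre_domain \<Longrightarrow> exp \<xi> / sinh \<xi> \<notin> \<real>\<^sub>\<le>\<^sub>0"
  using exp_div_sinh_notin_nonpos_Reals_strip notin_nonpos_Reals_Re[OF Re_exp_div_sinh_pos]
  by (cases "Im \<xi> = 0") (auto simp: legendre_domain_def)

lemma minus_exp_div_sinh_notin_nonpos_Reals:
  assumes "Im \<xi> \<noteq> 0" "\<bar>Im \<xi>\<bar> < pi"
  shows "- exp (- \<xi>) / sinh \<xi> \<notin> \<real>\<^sub>\<le>\<^sub>0"
  using exp_div_sinh_notin_nonpos_Reals_strip[of "- \<xi>"] assms by simp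

text \<open>The expansion solved for its first remainder, with \<open>c\<close> in the place of the connection coefficient.\<close>

definition first_remainder :: "complex \<Rightarrow> nat \<Rightarrow> complex \<Rightarrow> complex \<Rightarrow> complex \<Rightarrow> complex" where
  "first_remainder c N \<xi> \<mu> \<nu> =
    (Gamma (\<nu> - \<mu> + 1) * csqrt (2 * of_real pi * sinh \<xi>) *
       (coth_half \<xi> powr \<mu> * hyp2F1_reg (\<nu> + 1) (- \<nu>) (1 - \<mu>) ((1 - cosh \<xi>) / 2)) -
     c * exp (- (\<nu> + 1/2) * \<xi>) * legendre_borel_sum N (exp \<xi> / sinh \<xi>) \<mu> \<nu>) / exp ((\<nu> + 1/2) * \<xi>) -
    (\<Sum>n<N. P1_term n \<xi> \<mu> \<nu>)"

lemma holomorphic_on_sinh [holomorphic_intros]: "f holomorphic_on A \<Longrightarrow> (\<lambda>\<xi>. sinh (f \<xi>) :: complex) holomorphic_on A"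
  and holomorphic_on_cosh [holomorphic_intros]: "f holomorphic_on A \<Longrightarrow> (\<lambda>\<xi>. cosh (f \<xi>) :: complex) holomorphic_on A"
  unfolding sinh_field_def cosh_field_def by (intro holomorphic_intros; simp)+

lemma first_remainder_holomorphic:
  assumes "\<bar>Re \<mu>\<bar> < real N + 1/2" and \<nu>: "Re \<nu> > real N - 1/2"
  shows "(\<lambda>\<xi>. first_remainder c N \<xi> \<mu> \<nu>) holomorphic_on legendre_domain"
proof -
  have "Re (\<nu> + 1) > 0" using \<nu> by simp
  then have hyp: "(\<lambda>\<xi>. hyp2F1_reg (\<nu> + 1) (- \<nu>) (1 - \<mu>) ((1 - cosh \<xi>) / 2)) holomorphic_on legendre_domain"
    by (intro holomorphic_on_compose_gen[OF _ hyp2F1_reg_holomorphic, unfolded o_def])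
       (auto intro!: holomorphic_intros hyp_argument_in_slit_plane)
  have borel: "(\<lambda>\<xi>. legendre_borel_sum N (exp \<xi> / sinh \<xi>) \<mu> \<nu>) holomorphic_on legendre_domain"
    by (intro holomorphic_on_compose_gen[OF _ legendre_borel_sum_holomorphic[OF assms], unfolded o_def])
       (use exp_div_sinh_notin_nonpos_Reals sinh_nonzero in \<open>auto intro!: holomorphic_intros\<close>)
  have "coth_half holomorphic_on legendre_domain"
    unfolding coth_half_def[abs_def] using sinh_half_nonzero by (intro holomorphic_intros) auto
  then show ?thesis
    unfolding first_remainder_def P1_term_def
    using sinh_nonzero coth_half_notin_nonpos_Reals two_pi_sinh_notin_nonpos_Reals
    by (intro holomorphic_intros hyp borel) auto
qed

lemma first_remainder_imaginary:
  assumes \<mu>: "\<bar>Re \<mu>\<bar> < real N + 1/2" and \<nu>: "Re \<nu> > real N - 1/2" and b: "0 < b" "b < pi" and v: "v\<^sup>2 = - 1"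
  defines "\<xi> \<equiv> of_real b * v"
  shows "first_remainder (connection_coeff v \<mu>) N \<xi> \<mu> \<nu> = legendre_rem N (- exp (- \<xi>) / sinh \<xi>) \<mu> \<nu>"
proof -
  have hyp: "hyp2F1_reg (\<nu> + 1) (- \<nu>) (1 - \<mu>) ((1 - cosh \<xi>) / 2) =
      hyp2F1_reg_series (\<nu> + 1) (- \<nu>) (1 - \<mu>) ((1 - cosh \<xi>) / 2)"
    using \<nu> norm_hyp_argument_unit[OF b v] unfolding \<xi>_def by (intro hyp2F1_reg_eq_series) auto
  have "first_remainder (connection_coeff v \<mu>) N \<xi> \<mu> \<nu> =
      legendre_borel_sum N (- exp (- \<xi>) / sinh \<xi>) \<mu> \<nu> - (\<Sum>n<N. P1_term n \<xi> \<mu> \<nu>)"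
    unfolding first_remainder_def hyp legendre_expansion_imaginary[OF \<mu> \<nu> b v, folded \<xi>_def] by simp
  then show ?thesis
    by (simp add: legendre_borel_sum_def P1_term_def)
qed

lemma first_remainder_strip:
  assumes \<mu>: "\<bar>Re \<mu>\<bar> < real N + 1/2" and \<nu>: "Re \<nu> > real N - 1/2" and v: "v\<^sup>2 = - 1"
    and \<xi>: "0 < Im v * Im \<xi>" "\<bar>Im \<xi>\<bar> < pi"
  shows "first_remainder (connection_coeff v \<mu>) N \<xi> \<mu> \<nu> = legendre_rem N (- exp (- \<xi>) / sinh \<xi>) \<mu> \<nu>"
proof -
  let ?T = "{t. 0 < Re t \<and> Re t < pi}"
  let ?f = "\<lambda>t. first_remainder (connection_coeff v \<mu>) N (t * v) \<mu> \<nu>"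
  let ?g = "\<lambda>t. legendre_rem N (- exp (- (t * v)) / sinh (t * v)) \<mu> \<nu>"
  have Im_tv: "Im (t * v) \<noteq> 0" "\<bar>Im (t * v)\<bar> < pi" if "t \<in> ?T" for t
    using that v by (auto simp: square_eq_minus_one_iff)
  then have domain: "t * v \<in> legendre_domain" if "t \<in> ?T" for t
    using that by (simp add: legendre_domain_def)
  have "?f (- \<xi> * v) = ?g (- \<xi> * v)"
  proof (rule analytic_continuation_from_reals[where S = ?T and a = 0 and b = pi and f = ?f and g = ?g])
    show "?f holomorphic_on ?T"
      by (rule holomorphic_on_compose_gen[OF _ first_remainder_holomorphic[OF \<mu> \<nu>], unfolded o_def])
         (use domain in \<open>auto intro!: holomorphic_intros\<close>)
    show "?g holomorphic_on ?T"
      by (rule holomorphic_on_compose_gen[OF _ legendre_rem_holomorphic[OF \<mu> \<nu>], unfolded o_def])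
         (use minus_exp_div_sinh_notin_nonpos_Reals[OF Im_tv] sinh_nonzero[OF domain]
           in \<open>auto intro!: holomorphic_intros\<close>)
    have T: "?T = {t. 0 < Re t} \<inter> {t. Re t < pi}" by auto
    show "open ?T" unfolding T by (intro open_Int open_halfspace_Re_gt open_halfspace_Re_lt)
    show "connected ?T" unfolding T
      by (intro convex_connected convex_Int convex_halfspace_Re_gt convex_halfspace_Re_lt)
    show "?f (of_real b) = ?g (of_real b)" if "0 < b" "b < pi" for b
      using first_remainder_imaginary[OF \<mu> \<nu> _ _ v, of b] that by simp
    show "- \<xi> * v \<in> ?T" using \<xi> v by (auto simp: square_eq_minus_one_iff)
  qed auto
  moreover have "- \<xi> * v * v = \<xi>" using v by (simp add: power2_eq_square mult.assoc)
  ultimately show ?thesis by (simp only:)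
qed

section \<open>The remainders and their bounds\<close>

lemma connection_coeff_mean: "(connection_coeff \<i> \<mu> + connection_coeff (- \<i>) \<mu>) / 2 = sin (of_real pi * \<mu>)"
  by (simp add: connection_coeff_def sin_exp_eq field_simps)

lemma C_coeff_eq:
  "C_coeff \<xi> \<mu> = (if Im \<xi> = 0 then (connection_coeff \<i> \<mu> + connection_coeff (- \<i>) \<mu>) / 2
     else if Im \<xi> > 0 then connection_coeff \<i> \<mu> else connection_coeff (- \<i>) \<mu>)"
  unfolding connection_coeff_mean by (simp add: C_coeff_def connection_coeff_def mult_ac)

definition legendre_R1 :: "nat \<Rightarrow> complex \<Rightarrow> complex \<Rightarrow> complex \<Rightarrow> complex" where
  "legendre_R1 N \<xi> \<mu> \<nu> = first_remainder (C_coeff \<xi> \<mu>) N \<xi> \<mu> \<nu>"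

definition legendre_R2 :: "nat \<Rightarrow> complex \<Rightarrow> complex \<Rightarrow> complex \<Rightarrow> complex" where
  "legendre_R2 M \<xi> \<mu> \<nu> = legendre_rem M (exp \<xi> / sinh \<xi>) \<mu> \<nu>"

lemma legendre_P_expansion:
  assumes \<mu>: "\<bar>Re \<mu>\<bar> < real (min N M) + 1/2" and \<nu>: "Re \<nu> > real (max N M) - 1/2" and \<xi>: "\<xi> \<in> D1"
  shows "Gamma (\<nu> - \<mu> + 1) * csqrt (2 * of_real pi * sinh \<xi>) * legendre_P \<nu> \<mu> (cosh \<xi>) =
    exp ((\<nu> + 1/2) * \<xi>) * ((\<Sum>n<N. P1_term n \<xi> \<mu> \<nu>) + legendre_R1 N \<xi> \<mu> \<nu>) +
    C_coeff \<xi> \<mu> * exp (- (\<nu> + 1/2) * \<xi>) * ((\<Sum>m<M. P2_term m \<xi> \<mu> \<nu>) + legendre_R2 M \<xi> \<mu> \<nu>)"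
proof -
  have "(\<Sum>m<M. P2_term m \<xi> \<mu> \<nu>) + legendre_R2 M \<xi> \<mu> \<nu> = legendre_borel_sum M (exp \<xi> / sinh \<xi>) \<mu> \<nu>"
    by (simp add: P2_term_def legendre_R2_def legendre_borel_sum_def)
  also have "\<dots> = legendre_borel_sum N (exp \<xi> / sinh \<xi>) \<mu> \<nu>"
    using \<mu> \<nu> \<xi> D1_subset_legendre_domain
    by (intro legendre_borel_sum_independent exp_div_sinh_notin_nonpos_Reals) (auto simp: min.commute max.commute)
  finally show ?thesis
    unfolding legendre_P_cosh[OF \<xi>] legendre_R1_def first_remainder_def by simp
qed

lemma norm_legendre_rem_le_1:
  assumes \<mu>: "\<bar>Re \<mu>\<bar> < real N + 1/2" and \<nu>: "Re \<nu> > real N - 1/2" and x: "Re x \<ge> 0"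
  shows "norm (legendre_rem N x \<mu> \<nu>) \<le> legendre_term_bound N x \<mu> \<nu>"
proof -
  have "norm (terminant (real N + 1/2) (of_real c * x)) \<le> Gamma (real N + 1/2) * 1" if "c > 0" for c
    using norm_terminant_le_Gamma[of "real N + 1/2" "of_real c * x"] that x by simp
  from norm_legendre_rem_le[OF \<mu> \<nu> this] show ?thesis by simp
qed

lemma norm_legendre_rem_le_chi:
  assumes \<mu>: "\<bar>Re \<mu>\<bar> < real N + 1/2" and \<nu>: "Re \<nu> > real N - 1/2" and x: "x \<notin> \<real>\<^sub>\<le>\<^sub>0"
  shows "norm (legendre_rem N x \<mu> \<nu>) \<le> legendre_term_bound N x \<mu> \<nu> * (1 + chi (real N + 1/2))"
  by (rule norm_legendre_rem_le[OF \<mu> \<nu>])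
    (use norm_terminant_le_chi of_real_mult_notin_nonpos_Reals[OF x] in \<open>simp add: terminant_bound_def\<close>)

lemma norm_legendre_rem_le_Im:
  assumes \<mu>: "\<bar>Re \<mu>\<bar> < real N + 1/2" and \<nu>: "Re \<nu> > real N - 1/2" and x: "Im x \<noteq> 0"
  shows "norm (legendre_rem N x \<mu> \<nu>) \<le> legendre_term_bound N x \<mu> \<nu> * (norm x / \<bar>Im x\<bar>)"
proof (rule norm_legendre_rem_le[OF \<mu> \<nu>])
  fix c :: real assume c: "c > 0"
  then have "norm (of_real c * x) / \<bar>Im (of_real c * x)\<bar> = norm x / \<bar>Im x\<bar>"
    by (simp add: norm_mult abs_mult)
  then show "norm (terminant (real N + 1/2) (of_real c * x)) \<le> Gamma (real N + 1/2) * (norm x / \<bar>Im x\<bar>)"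
    using norm_terminant_le_Im[of "real N + 1/2" "of_real c * x"] c x by simp
qed

lemma norm_over_Im_divide: "norm (2 / z) / \<bar>Im (2 / z)\<bar> = norm z / \<bar>Im z\<bar>"
proof (cases "z = 0")
  case False
  have "Im (2 / z) = - 2 * Im z / (norm z)\<^sup>2"
    by (simp add: Im_divide cmod_power2)
  then show ?thesis
    using False by (simp add: norm_divide abs_mult power2_eq_square)
qed simp

lemma norm_over_Im_minus_exp_div_sinh:
  "norm (- exp (- \<xi>) / sinh \<xi>) / \<bar>Im (- exp (- \<xi>) / sinh \<xi>)\<bar> = norm (1 - exp (- 2 * \<xi>)) * \<bar>1 / sin (2 * Im \<xi>)\<bar>"
proof -
  have "1 - exp (2 * \<xi>) = - (exp (2 * \<xi>) * (1 - exp (- 2 * \<xi>)))"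
    by (simp add: right_diff_distrib exp_add[symmetric])
  then have "norm (1 - exp (2 * \<xi>)) = exp (2 * Re \<xi>) * norm (1 - exp (- 2 * \<xi>))"
    by (simp only: norm_minus_cancel norm_mult norm_exp_eq_Re) simp
  moreover have "Im (1 - exp (2 * \<xi>)) = - (exp (2 * Re \<xi>) * sin (2 * Im \<xi>))" by (simp add: Im_exp)
  ultimately show ?thesis
    unfolding minus_exp_div_sinh_eq norm_over_Im_divide by (simp add: abs_mult)
qed

lemma norm_legendre_rem_le_P1_factor:
  assumes \<mu>: "\<bar>Re \<mu>\<bar> < real N + 1/2" and \<nu>: "Re \<nu> > real N - 1/2" and \<xi>: "Im \<xi> \<noteq> 0" "\<bar>Im \<xi>\<bar> < pi"
  shows "norm (legendre_rem N (- exp (- \<xi>) / sinh \<xi>) \<mu> \<nu>) \<le>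
      legendre_term_bound N (exp (- \<xi>) / sinh \<xi>) \<mu> \<nu> * P1_factor N \<xi>"
proof -
  let ?x = "- exp (- \<xi>) / sinh \<xi>"
  note chi_bound = norm_legendre_rem_le_chi[OF \<mu> \<nu> minus_exp_div_sinh_notin_nonpos_Reals[OF \<xi>]]
  consider (left) "Re (exp (2 * \<xi>)) \<le> 1" | (cut) "Re (exp (2 * \<xi>)) > 1" "sin (2 * Im \<xi>) = 0"
    | (right) "Re (exp (2 * \<xi>)) > 1" "sin (2 * Im \<xi>) \<noteq> 0"
    by linarith
  then show ?thesis
  proof cases
    case left
    then have "Re ?x \<ge> 0" unfolding minus_exp_div_sinh_eq Re_complex_div_ge_0 by simp
    from norm_legendre_rem_le_1[OF \<mu> \<nu> this] left show ?thesis
      unfolding P1_factor_def by simp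
  next
    case cut
    then show ?thesis using chi_bound unfolding P1_factor_def by simp
  next
    case right
    then have "Im ?x \<noteq> 0" unfolding minus_exp_div_sinh_eq Im_complex_div_eq_0 by (simp add: Im_exp)
    from norm_legendre_rem_le_Im[OF \<mu> \<nu> this] chi_bound right show ?thesis
      unfolding P1_factor_def norm_over_Im_minus_exp_div_sinh by (simp add: min_def)
  qed
qed

lemma norm_first_remainder_le_chi:
  assumes \<mu>: "\<bar>Re \<mu>\<bar> < real N + 1/2" and \<nu>: "Re \<nu> > real N - 1/2" and v: "v\<^sup>2 = - 1" and \<xi>: "\<xi> \<in> D1" "Im \<xi> = 0"
  shows "norm (first_remainder (connection_coeff v \<mu>) N \<xi> \<mu> \<nu>) \<le>
      legendre_term_bound N (- exp (- \<xi>) / sinh \<xi>) \<mu> \<nu> * (1 + chi (real N + 1/2))"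
proof -
  let ?p = "\<lambda>t. \<xi> + of_real t * v"
  let ?f = "\<lambda>\<xi>. first_remainder (connection_coeff v \<mu>) N \<xi> \<mu> \<nu>"
  let ?g = "\<lambda>\<xi>. legendre_term_bound N (- exp (- \<xi>) / sinh \<xi>) \<mu> \<nu> * (1 + chi (real N + 1/2))"
  have domain: "\<xi> \<in> legendre_domain" using \<xi>(1) D1_subset_legendre_domain by blast
  have "(\<lambda>\<xi>. - exp (- \<xi>) / sinh \<xi>) holomorphic_on legendre_domain"
    using sinh_nonzero by (intro holomorphic_intros) auto
  then have cont: "isCont ?f \<xi>" "isCont (\<lambda>\<xi>. - exp (- \<xi>) / sinh \<xi>) \<xi>"
    using first_remainder_holomorphic[OF \<mu> \<nu>] domain open_legendre_domain
    by (auto intro!: continuous_on_interior holomorphic_on_imp_continuous_on simp: interior_open)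
  have "(?p \<longlongrightarrow> \<xi> + of_real 0 * v) (at_right 0)" by (intro tendsto_intros)
  then have p: "(?p \<longlongrightarrow> \<xi>) (at_right 0)" by simp
  show ?thesis
  proof (rule tendsto_le[OF trivial_limit_at_right_real])
    show "((\<lambda>t. norm (?f (?p t))) \<longlongrightarrow> norm (?f \<xi>)) (at_right 0)"
      by (intro tendsto_norm isCont_tendsto_compose[OF cont(1) p])
    show "((\<lambda>t. ?g (?p t)) \<longlongrightarrow> ?g \<xi>) (at_right 0)"
      unfolding legendre_term_bound_def
      by (intro tendsto_mult tendsto_power tendsto_norm tendsto_const isCont_tendsto_compose[OF cont(2) p])
    have "norm (?f (?p t)) \<le> ?g (?p t)" if "0 < t" "t < pi" for t
    proof -
      have "0 < Im v * Im (?p t)" "\<bar>Im (?p t)\<bar> < pi" "Im (?p t) \<noteq> 0"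
        using that v \<xi>(2) by (auto simp: square_eq_minus_one_iff)
      then show ?thesis
        using norm_legendre_rem_le_chi[OF \<mu> \<nu> minus_exp_div_sinh_notin_nonpos_Reals]
        by (simp only: first_remainder_strip[OF \<mu> \<nu> v])
    qed
    then show "\<forall>\<^sub>F t in at_right 0. norm (?f (?p t)) \<le> ?g (?p t)"
      unfolding eventually_at_right_field using pi_gt_zero by (intro exI[of _ pi]) auto
  qed
qed

lemma first_remainder_mean:
  "first_remainder ((c + d) / 2) N \<xi> \<mu> \<nu> = (first_remainder c N \<xi> \<mu> \<nu> + first_remainder d N \<xi> \<mu> \<nu>) / 2"
  by (simp add: first_remainder_def add_divide_distrib diff_divide_distrib algebra_simps)

lemma norm_legendre_R1_le:
  assumes \<mu>: "\<bar>Re \<mu>\<bar> < real N + 1/2" and \<nu>: "Re \<nu> > real N - 1/2" and \<xi>: "\<xi> \<in> D1"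
  shows "norm (legendre_R1 N \<xi> \<mu> \<nu>) \<le> legendre_term_bound N (exp (- \<xi>) / sinh \<xi>) \<mu> \<nu> * P1_factor N \<xi>"
proof -
  have Im_lt: "\<bar>Im \<xi>\<bar> < pi" using \<xi> by (simp add: D1_def)
  consider (real) "Im \<xi> = 0" | (upper) "Im \<xi> > 0" | (lower) "Im \<xi> < 0" by linarith
  then show ?thesis
  proof cases
    case real
    let ?p = "first_remainder (connection_coeff \<i> \<mu>) N \<xi> \<mu> \<nu>"
      and ?q = "first_remainder (connection_coeff (- \<i>) \<mu>) N \<xi> \<mu> \<nu>"
    have "norm (legendre_R1 N \<xi> \<mu> \<nu>) = norm (?p + ?q) / 2"
      using real by (simp add: legendre_R1_def C_coeff_eq first_remainder_mean norm_divide)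
    also have "\<dots> \<le> (norm ?p + norm ?q) / 2" using norm_triangle_ineq[of ?p ?q] by simp
    finally have "norm (legendre_R1 N \<xi> \<mu> \<nu>) \<le>
        legendre_term_bound N (- exp (- \<xi>) / sinh \<xi>) \<mu> \<nu> * (1 + chi (real N + 1/2))"
      using norm_first_remainder_le_chi[OF \<mu> \<nu> _ \<xi> real, of \<i>]
        norm_first_remainder_le_chi[OF \<mu> \<nu> _ \<xi> real, of "- \<i>"] by simp
    moreover have "P1_factor N \<xi> = 1 + chi (real N + 1/2)"
      using real \<xi> by (simp add: P1_factor_def Re_exp D1_def)
    ultimately show ?thesis by (simp add: norm_divide)
  next
    case upper
    then show ?thesis
      using first_remainder_strip[OF \<mu> \<nu>, of \<i> \<xi>] norm_legendre_rem_le_P1_factor[OF \<mu> \<nu> _ Im_lt] Im_lt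
      by (simp add: legendre_R1_def C_coeff_eq)
  next
    case lower
    then show ?thesis
      using first_remainder_strip[OF \<mu> \<nu>, of "- \<i>" \<xi>] norm_legendre_rem_le_P1_factor[OF \<mu> \<nu> _ Im_lt] Im_lt
      by (simp add: legendre_R1_def C_coeff_eq)
  qed
qed

lemma norm_legendre_R2_le:
  assumes "\<bar>Re \<mu>\<bar> < real M + 1/2" "Re \<nu> > real M - 1/2" "Re \<xi> > 0"
  shows "norm (legendre_R2 M \<xi> \<mu> \<nu>) \<le> legendre_term_bound M (exp \<xi> / sinh \<xi>) \<mu> \<nu>"
  unfolding legendre_R2_def using assms by (intro norm_legendre_rem_le_1 less_imp_le[OF Re_exp_div_sinh_pos])

definition pos_Reals :: "complex set" where
  "pos_Reals = complex_of_real ` {0<..}"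

lemma of_real_in_pos_Reals_iff: "complex_of_real r \<in> pos_Reals \<longleftrightarrow> r > 0"
  by (auto simp: pos_Reals_def)

lemma pos_Reals_mult: "z \<in> pos_Reals \<Longrightarrow> w \<in> pos_Reals \<Longrightarrow> z * w \<in> pos_Reals"
  by (auto simp: pos_Reals_def simp flip: of_real_mult)

lemma set_integral_pos_Reals:
  fixes f :: "real \<Rightarrow> complex"
  assumes int: "set_integrable lborel A f" and A: "open A" "A \<noteq> {}" and f: "\<And>x. x \<in> A \<Longrightarrow> f x \<in> pos_Reals"
  shows "(LINT x:A|lborel. f x) \<in> pos_Reals"
proof -
  let ?g = "\<lambda>x. indicator A x * Re (f x)"
  have Re_f: "Re (f x) > 0" "f x = of_real (Re (f x))" if "x \<in> A" for x
    using f[OF that] by (auto simp: pos_Reals_def)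
  have "integrable lborel (\<lambda>x. Re (indicator A x *\<^sub>R f x))"
    using int unfolding set_integrable_def by (rule integrable_Re)
  then have g: "integrable lborel ?g" by simp
  have nonneg: "?g x \<ge> 0" for x
    using Re_f(1)[of x] by (auto simp: indicator_def)
  have "(LINT x|lborel. ?g x) \<noteq> 0"
  proof
    assume "(LINT x|lborel. ?g x) = 0"
    then have "AE x in lborel. ?g x = 0" using integral_nonneg_eq_0_iff_AE[OF g] nonneg by simp
    then have "AE x in lborel. x \<notin> A"
      by (rule AE_mp) (rule AE_I2, use Re_f(1) in \<open>force simp: indicator_def\<close>)
    then have "A \<in> null_sets lborel" using A(1) AE_iff_null_sets[of A lborel] by simp
    then have "negligible A" unfolding negligible_iff_null_sets by (rule null_sets_completionI)
    then show False using open_not_negligible[OF A] by simp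
  qed
  moreover have "(LINT x|lborel. ?g x) \<ge> 0" by (intro integral_nonneg_AE AE_I2 nonneg)
  ultimately have "(LINT x:A|lborel. Re (f x)) > 0" by (simp add: set_lebesgue_integral_def)
  moreover have "(LINT x:A|lborel. f x) = complex_of_real (LINT x:A|lborel. Re (f x))"
    unfolding set_integral_complex_of_real[symmetric]
      by (intro set_lebesgue_integral_cong allI impI) (simp add: A, rule Re_f(2))
  ultimately show ?thesis by (simp only: of_real_in_pos_Reals_iff)
qed

lemma terminant_pos:
  assumes "p > 0" "q > 0"
  shows "terminant p (of_real q) \<in> pos_Reals"
  unfolding terminant_def
proof (rule set_integral_pos_Reals)
  show "set_integrable lborel {0<..} (\<lambda>u. gamma_weight (of_real p) 1 u * inverse (1 + of_real u * of_real q))"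
    using assms by (intro terminant_integrable) auto
  fix u :: real assume "u \<in> {0<..}"
  then have u: "u > 0" by simp
  have "gamma_weight (of_real p) 1 u * inverse (1 + of_real u * of_real q) =
      of_real (u powr (p - 1) * exp (- u) * inverse (1 + u * q))"
    using gamma_weight_of_real[OF u, of p 1] by simp
  moreover have "1 + u * q > 0" using u assms by (simp add: add_pos_pos)
  ultimately show "gamma_weight (of_real p) 1 u * inverse (1 + of_real u * of_real q) \<in> pos_Reals"
    using u by (simp only: of_real_in_pos_Reals_iff) simp
qed auto

lemma terminant_beta_pos:
  assumes "p > 0" "\<bar>m\<bar> < p" "y > 0"
  shows "terminant_beta p (of_real m) (of_real y) \<in> pos_Reals"
  unfolding terminant_beta_def
proof (rule set_integral_pos_Reals)
  show "set_integrable lborel {0<..<1} (\<lambda>r. beta_weight (of_real p + of_real m) (of_real p - of_real m) r *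
      terminant p (of_real (2 * r * (1 - r)) * of_real y))"
    using assms by (intro terminant_beta_integrable) auto
  fix r :: real assume r: "r \<in> {0<..<1}"
  have "beta_weight (of_real p + of_real m) (of_real p - of_real m) r \<in> pos_Reals"
    using beta_weight_of_real[OF r, of "p + m" "p - m"] r
    by (simp only: of_real_add[symmetric] of_real_diff[symmetric] of_real_in_pos_Reals_iff) simp
  moreover have "terminant p (of_real (2 * r * (1 - r) * y)) \<in> pos_Reals"
    using assms r by (intro terminant_pos) auto
  ultimately show "beta_weight (of_real p + of_real m) (of_real p - of_real m) r *
      terminant p (of_real (2 * r * (1 - r)) * of_real y) \<in> pos_Reals"
    by (simp only: of_real_mult[symmetric] pos_Reals_mult)
qed auto

lemma legendre_rem_sign:
  assumes m: "\<bar>m\<bar> < real N + 1/2" and n: "n > real N - 1/2" and x: "x > 0"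
  obtains r where "r > 0"
    "legendre_rem N (of_real x) (of_real m) (of_real n) = complex_of_real ((- 1) ^ N * cos (pi * m) * r)"
proof -
  let ?f = "\<lambda>t. gamma_weight (complex_of_real n - of_nat N + 1/2) 1 t *
      terminant_beta (real N + 1/2) (of_real m) (of_real x / of_real t)"
  have "(LINT t:{0<..}|lborel. ?f t) \<in> pos_Reals"
  proof (rule set_integral_pos_Reals)
    show "set_integrable lborel {0<..} ?f"
      using m n x by (intro legendre_rem_integrable) auto
    fix t :: real assume "t \<in> {0<..}"
    then have t: "t > 0" by simp
    have "gamma_weight (of_real (n - real N + 1/2)) (of_real 1) t \<in> pos_Reals"
      using t by (simp only: gamma_weight_of_real of_real_in_pos_Reals_iff) simp
    moreover have "terminant_beta (real N + 1/2) (of_real m) (of_real (x / t)) \<in> pos_Reals"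
      using m x t by (intro terminant_beta_pos) auto
    ultimately show "?f t \<in> pos_Reals"
      using pos_Reals_mult by fastforce
  qed auto
  then obtain s where s: "s > 0" "(LINT t:{0<..}|lborel. ?f t) = complex_of_real s"
    by (auto simp: pos_Reals_def)
  show ?thesis
  proof (rule that)
    show "2 ^ N / pi powr (3/2) * x ^ N * s > 0" using s(1) x by simp
    show "legendre_rem N (of_real x) (of_real m) (of_real n) =
        complex_of_real ((- 1) ^ N * cos (pi * m) * (2 ^ N / pi powr (3/2) * x ^ N * s))"
      unfolding legendre_rem_def s(2) of_real_cos_pi by (simp add: power_minus[of 2])
  qed
qed

lemma exp_div_sinh_of_real: "exp (complex_of_real x) / sinh (of_real x) = of_real (exp x / sinh x)"
  by (simp add: sinh_field_def exp_of_real flip: of_real_minus)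

lemma P2_term_of_real:
  assumes "\<bar>m\<bar> < real M + 1/2"
  shows "P2_term M (of_real x) (of_real m) (of_real n) =
    complex_of_real ((- 1) ^ M * cos (pi * m) * (a_cos_ratio M m * Gamma (n - real M + 1/2) * (exp x / sinh x) ^ M))"
proof -
  have "Gamma (complex_of_real n - of_nat M + 1/2) = of_real (Gamma (n - real M + 1/2))"
    by (subst Gamma_complex_of_real[symmetric]) simp
  then show ?thesis
    unfolding P2_term_def exp_div_sinh_of_real of_real_a_coeff[symmetric] a_coeff_Beta_real[OF assms]
      a_cos_ratio_Beta[OF assms]
    by simp
qed

lemma legendre_R2_real:
  assumes x: "x > 0" and m: "\<bar>m\<bar> < real M + 1/2" and n: "n > real M - 1/2"
  defines "R \<equiv> legendre_R2 M (of_real x) (of_real m) (of_real n)"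
    and "P \<equiv> P2_term M (of_real x) (of_real m) (of_real n)"
  shows "R \<in> \<real>" and "norm R \<le> norm P" and "sgn (Re R) = sgn (Re P)"
proof -
  let ?K = "a_cos_ratio M m * Gamma (n - real M + 1/2) * (exp x / sinh x) ^ M"
  obtain r where r: "r > 0" "R = complex_of_real ((- 1) ^ M * cos (pi * m) * r)"
    using legendre_rem_sign[OF m n, of "exp x / sinh x"] x by (auto simp: R_def legendre_R2_def exp_div_sinh_of_real)
  have P: "P = complex_of_real ((- 1) ^ M * cos (pi * m) * ?K)"
    unfolding P_def by (rule P2_term_of_real[OF m])
  have "a_cos_ratio M m > 0"
    unfolding a_cos_ratio_Beta[OF m] Beta_def using m by (intro mult_pos_pos divide_pos_pos Gamma_real_pos) auto
  then have K: "?K > 0" using x n by (intro mult_pos_pos zero_less_power divide_pos_pos Gamma_real_pos) auto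
  show "R \<in> \<real>" unfolding r(2) by (rule Reals_of_real)
  show "sgn (Re R) = sgn (Re P)"
    unfolding r(2) P Re_complex_of_real sgn_mult[of _ r] sgn_mult[of _ ?K] sgn_pos[OF r(1)] sgn_pos[OF K] ..
  have "norm R \<le> \<bar>cos (pi * m)\<bar> * ?K"
    using norm_legendre_R2_le[of "of_real m" M "of_real n" "of_real x"] x m n
    unfolding R_def exp_div_sinh_of_real legendre_term_bound_def of_real_cos_pi norm_of_real by (simp add: mult_ac)
  also have "\<dots> = norm P"
    unfolding P norm_of_real abs_mult[of _ ?K] abs_of_pos[OF K] by (simp add: abs_mult power_abs)
  finally show "norm R \<le> norm P" .
qed

lemma eq_sum_divide_multI:
  fixes p :: "'a :: field"
  assumes "l * p = a * A + b * B" "l \<noteq> 0"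
  shows "p = a / l * A + b / l * B"
proof -
  have "p = (l * p) / l" using assms(2) by simp
  then show ?thesis unfolding assms(1) by (simp add: add_divide_distrib)
qed

theorem theorem3p1:
  shows "\<exists>R1 R2 :: nat \<Rightarrow> complex \<Rightarrow> complex \<Rightarrow> complex \<Rightarrow> complex.
    (\<forall>\<xi>\<in>D1. \<forall>N M. \<forall>\<mu> \<nu>.
       \<bar>Re \<mu>\<bar> < min (real N + 1/2) (real M + 1/2) \<longrightarrow>
       Re \<nu> > max (real N - 1/2) (real M - 1/2) \<longrightarrow>
         legendre_P \<nu> \<mu> (cosh \<xi>) =
           exp ((\<nu> + 1/2) * \<xi>) / (Gamma (\<nu> - \<mu> + 1) * csqrt (2 * of_real pi * sinh \<xi>)) *
             ((\<Sum>n<N. P1_term n \<xi> \<mu> \<nu>) + R1 N \<xi> \<mu> \<nu>) +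
           C_coeff \<xi> \<mu> * exp (- (\<nu> + 1/2) * \<xi>) /
               (Gamma (\<nu> - \<mu> + 1) * csqrt (2 * of_real pi * sinh \<xi>)) *
             ((\<Sum>m<M. P2_term m \<xi> \<mu> \<nu>) + R2 M \<xi> \<mu> \<nu>) \<and>
         norm (R1 N \<xi> \<mu> \<nu>) \<le>
           norm (cos (of_real pi * \<mu>)) * a_cos_ratio N (Re \<mu>) * Gamma (Re \<nu> - real N + 1/2) *
             norm (exp (- \<xi>) / sinh \<xi>) ^ N * P1_factor N \<xi> \<and>
         norm (R2 M \<xi> \<mu> \<nu>) \<le>
           norm (cos (of_real pi * \<mu>)) * a_cos_ratio M (Re \<mu>) * Gamma (Re \<nu> - real M + 1/2) *
             norm (exp \<xi> / sinh \<xi>) ^ M) \<and>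
    (\<forall>M. \<forall>x \<mu> \<nu> :: real.
       x > 0 \<longrightarrow> \<bar>\<mu>\<bar> < real M + 1/2 \<longrightarrow> \<nu> > real M - 1/2 \<longrightarrow>
         R2 M (of_real x) (of_real \<mu>) (of_real \<nu>) \<in> \<real> \<and>
         norm (R2 M (of_real x) (of_real \<mu>) (of_real \<nu>)) \<le>
           norm (P2_term M (of_real x) (of_real \<mu>) (of_real \<nu>)) \<and>
         sgn (Re (R2 M (of_real x) (of_real \<mu>) (of_real \<nu>))) =
           sgn (Re (P2_term M (of_real x) (of_real \<mu>) (of_real \<nu>))))"
proof (rule exI[of _ legendre_R1], rule exI[of _ legendre_R2], intro conjI ballI allI impI)
  fix \<xi> N M \<mu> \<nu>
  assume \<xi>: "\<xi> \<in> D1" and \<mu>: "\<bar>Re \<mu>\<bar> < min (real N + 1/2) (real M + 1/2)"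
    and \<nu>: "Re \<nu> > max (real N - 1/2) (real M - 1/2)"
  let ?L = "Gamma (\<nu> - \<mu> + 1) * csqrt (2 * of_real pi * sinh \<xi>)"
  have "Re (\<nu> - \<mu> + 1) > 0" using \<mu> \<nu> by auto
  then have "Gamma (\<nu> - \<mu> + 1) \<noteq> 0" by (intro Gamma_nonzero notin_nonpos_Ints_Re)
  moreover have "csqrt (2 * of_real pi * sinh \<xi>) \<noteq> 0"
    using sinh_nonzero \<xi> D1_subset_legendre_domain by auto
  ultimately have L: "?L \<noteq> 0" by simp
  have "?L * legendre_P \<nu> \<mu> (cosh \<xi>) =
      exp ((\<nu> + 1/2) * \<xi>) * ((\<Sum>n<N. P1_term n \<xi> \<mu> \<nu>) + legendre_R1 N \<xi> \<mu> \<nu>) +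
      C_coeff \<xi> \<mu> * exp (- (\<nu> + 1/2) * \<xi>) * ((\<Sum>m<M. P2_term m \<xi> \<mu> \<nu>) + legendre_R2 M \<xi> \<mu> \<nu>)"
    using \<mu> \<nu> by (intro legendre_P_expansion \<xi>) auto
  then show "legendre_P \<nu> \<mu> (cosh \<xi>) =
      exp ((\<nu> + 1/2) * \<xi>) / ?L * ((\<Sum>n<N. P1_term n \<xi> \<mu> \<nu>) + legendre_R1 N \<xi> \<mu> \<nu>) +
      C_coeff \<xi> \<mu> * exp (- (\<nu> + 1/2) * \<xi>) / ?L * ((\<Sum>m<M. P2_term m \<xi> \<mu> \<nu>) + legendre_R2 M \<xi> \<mu> \<nu>)"
    by (rule eq_sum_divide_multI[OF _ L])
qed (auto intro!: norm_legendre_R1_le[unfolded legendre_term_bound_def]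
    norm_legendre_R2_le[unfolded legendre_term_bound_def] legendre_R2_real simp: D1_def)

end
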